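(* Let either $0<\alpha<1$, $q=0$, $a=2$, $p_1=p_2=0$, or $1<\alpha<2$, $q=1$, $a=2-\frac2\alpha$, $p_1=1$, $p_2=\frac12$. For $h>0$, $k\in\mathbb R$ let $$\phi_h(k)=a\,\psi^{p_1}_h(k)+(1-a)\,\psi^{p_2}_{2h}(k),\qquad \psi^p_h(k)=(-1)^{q+1}h^{-\alpha}e^{-ipkh}(1-e^{ikh})^\alpha .$$ Then $\{T_{e^{t\phi_h}}\}_{t\ge0}$ are semigroups on $L_1(\mathbb R_+)$ if $0<\alpha<1$, respectively on $L_1(\mathbb R)$ if $1<\alpha<2$, that are strongly continuous, uniformly bounded in $h>0$ and $t\ge0$, and uniformly analytic in $h$; i.e. there is $M>0$ such that $\|T_{\phi_he^{t\phi_h}}\|\le Mt^{-1}$ for all $t,h>0$ (operator norm on $L_1(\mathbb R_+)$, respectively $L_1(\mathbb R)$).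
   Context: Complex powers are principal (branch cut along the negative real axis), with $0^\alpha=0$. $\hat f(k)=\int_{-\infty}^\infty e^{ikx}f(x)\,dx$. A measurable function $\psi:\mathbb R\to\mathbb C$ is an $L_1$-multiplier if for every $f\in L_1(\mathbb R)$ there is $v\in L_1(\mathbb R)$ with $\psi\hat f=\hat v$; then $T_\psi f:=v$ defines a bounded operator on $L_1(\mathbb R)$. $L_1(\mathbb R_+)$ is identified with the subspace of functions in $L_1(\mathbb R)$ vanishing on $(-\infty,0)$; saying that $T_\psi$ is an operator on $L_1(\mathbb R_+)$ means that it leaves this subspace invariant and is restricted to it. *)

theory Defs
  imports "HOL-Probability.Probability"
begin

definition L1_eq :: "(real \<Rightarrow> complex) \<Rightarrow> (real \<Rightarrow> complex) \<Rightarrow> bool" where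
  "L1_eq f g \<longleftrightarrow> integrable lborel f \<and> integrable lborel g \<and> (AE x in lborel. f x = g x)"

text \<open>
  The space of complex-valued integrable functions on the real line modulo equality almost
  everywhere. Borel representatives suffice, since every Lebesgue measurable function agrees almost
  everywhere with a Borel measurable one.
\<close>

quotient_type L1R = "real \<Rightarrow> complex" / partial: L1_eq
proof (rule part_equivpI)
  show "\<exists>f. L1_eq f f"
    by (rule exI[of _ "\<lambda>_. 0"]) (simp add: L1_eq_def)
  show "symp L1_eq"
    by (rule sympI) (auto simp: L1_eq_def)
  show "transp L1_eq"
    by (rule transpI) (auto simp: L1_eq_def elim: AE_mp)
qed

lift_definition scale_L1 :: "complex \<Rightarrow> L1R \<Rightarrow> L1R" is "\<lambda>c f x. c * f x"
  by (auto simp: L1_eq_def)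

instantiation L1R :: real_normed_vector
begin

lift_definition zero_L1R :: L1R is "\<lambda>_. 0"
  by (simp add: L1_eq_def)

lift_definition plus_L1R :: "L1R \<Rightarrow> L1R \<Rightarrow> L1R" is "\<lambda>f g x. f x + g x"
  by (auto simp: L1_eq_def)

lift_definition minus_L1R :: "L1R \<Rightarrow> L1R \<Rightarrow> L1R" is "\<lambda>f g x. f x - g x"
  by (auto simp: L1_eq_def)

lift_definition uminus_L1R :: "L1R \<Rightarrow> L1R" is "\<lambda>f x. - f x"
  by (auto simp: L1_eq_def)

lift_definition norm_L1R :: "L1R \<Rightarrow> real" is "\<lambda>f. LINT x|lborel. norm (f x)"
  by (auto simp: L1_eq_def intro!: integral_cong_AE)

definition scaleR_L1R :: "real \<Rightarrow> L1R \<Rightarrow> L1R" where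
  "scaleR_L1R r f = scale_L1 (complex_of_real r) f"

definition dist_L1R :: "L1R \<Rightarrow> L1R \<Rightarrow> real" where
  "dist_L1R f g = norm (f - g)"

definition sgn_L1R :: "L1R \<Rightarrow> L1R" where
  "sgn_L1R f = inverse (norm f) *\<^sub>R f"

definition uniformity_L1R :: "(L1R \<times> L1R) filter" where
  "uniformity_L1R = (INF e\<in>{0<..}. principal {(f, g). dist f g < e})"

definition open_L1R :: "L1R set \<Rightarrow> bool" where
  "open_L1R U \<longleftrightarrow> (\<forall>f\<in>U. eventually (\<lambda>(f', g). f' = f \<longrightarrow> g \<in> U) uniformity)"

instance
proof
  fix f g k :: L1R and r s :: real
  show "f + g + k = f + (g + k)"
    by transfer (auto simp: L1_eq_def algebra_simps)
  show "f + g = g + f"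
    by transfer (auto simp: L1_eq_def algebra_simps)
  show "0 + f = f"
    by transfer (auto simp: L1_eq_def)
  show "- f + f = 0"
    by transfer (auto simp: L1_eq_def)
  show "f - g = f + - g"
    by transfer (auto simp: L1_eq_def)
  show "r *\<^sub>R (f + g) = r *\<^sub>R f + r *\<^sub>R g"
    unfolding scaleR_L1R_def by transfer (auto simp: L1_eq_def algebra_simps)
  show "(r + s) *\<^sub>R f = r *\<^sub>R f + s *\<^sub>R f"
    unfolding scaleR_L1R_def by transfer (auto simp: L1_eq_def algebra_simps)
  show "r *\<^sub>R s *\<^sub>R f = (r * s) *\<^sub>R f"
    unfolding scaleR_L1R_def by transfer (auto simp: L1_eq_def algebra_simps)
  show "1 *\<^sub>R f = f"
    unfolding scaleR_L1R_def by transfer (auto simp: L1_eq_def)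
  show "dist f g = norm (f - g)"
    by (rule dist_L1R_def)
  show "sgn f = inverse (norm f) *\<^sub>R f"
    by (rule sgn_L1R_def)
  show "uniformity = (INF e\<in>{0<..}. principal {(f, g :: L1R). dist f g < e})"
    by (rule uniformity_L1R_def)
  show "open U \<longleftrightarrow> (\<forall>f\<in>U. eventually (\<lambda>(f', g). f' = f \<longrightarrow> g \<in> U) uniformity)" for U :: "L1R set"
    by (rule open_L1R_def)
  show "norm f = 0 \<longleftrightarrow> f = 0"
    by transfer (auto simp: L1_eq_def integral_nonneg_eq_0_iff_AE)
  show "norm (f + g) \<le> norm f + norm g"
  proof transfer
    fix f g :: "real \<Rightarrow> complex"
    assume "L1_eq f f" "L1_eq g g"
    then have "integrable lborel f" "integrable lborel g"
      by (auto simp: L1_eq_def)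
    then have "(LINT x|lborel. norm (f x + g x)) \<le> (LINT x|lborel. norm (f x) + norm (g x))"
      by (intro integral_mono) (auto intro: norm_triangle_ineq)
    also have "\<dots> = (LINT x|lborel. norm (f x)) + (LINT x|lborel. norm (g x))"
      using \<open>integrable lborel f\<close> \<open>integrable lborel g\<close> by simp
    finally show "(LINT x|lborel. norm (f x + g x))
        \<le> (LINT x|lborel. norm (f x)) + (LINT x|lborel. norm (g x))" .
  qed
  show "norm (r *\<^sub>R f) = \<bar>r\<bar> * norm f"
    unfolding scaleR_L1R_def by transfer (auto simp: norm_mult)
qed

end

lift_definition vanishes_on_negatives :: "L1R \<Rightarrow> bool" is "\<lambda>f. AE x in lborel. x < 0 \<longrightarrow> f x = 0"
  by (auto simp: L1_eq_def elim: AE_mp)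

definition L1_Rplus :: "L1R set" where
  "L1_Rplus = {f. vanishes_on_negatives f}"

lift_definition fourier :: "L1R \<Rightarrow> real \<Rightarrow> complex" is
  "\<lambda>f k. LINT x|lborel. exp (\<i> * complex_of_real (k * x)) * f x"
  by (auto simp: L1_eq_def fun_eq_iff intro!: integral_cong_AE)

definition L1_multiplier :: "(real \<Rightarrow> complex) \<Rightarrow> bool" where
  "L1_multiplier \<psi> \<longleftrightarrow> \<psi> \<in> borel_measurable borel \<and>
     (\<forall>f. \<exists>v. \<forall>k. \<psi> k * fourier f k = fourier v k)"

text \<open>
  The description is proper for every multiplier, because an integrable function is determined
  almost everywhere by its Fourier transform.
\<close>

definition mult_op :: "(real \<Rightarrow> complex) \<Rightarrow> L1R \<Rightarrow> L1R" where
  "mult_op \<psi> f = (THE v. \<forall>k. \<psi> k * fourier f k = fourier v k)"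

definition bounded_operator_on :: "L1R set \<Rightarrow> (L1R \<Rightarrow> L1R) \<Rightarrow> bool" where
  "bounded_operator_on X T \<longleftrightarrow>
     (\<forall>f\<in>X. T f \<in> X) \<and>
     (\<forall>f\<in>X. \<forall>g\<in>X. T (f + g) = T f + T g) \<and>
     (\<forall>c. \<forall>f\<in>X. T (scale_L1 c f) = scale_L1 c (T f)) \<and>
     (\<exists>B. \<forall>f\<in>X. norm (T f) \<le> B * norm f)"

text \<open>
  The operator norm of the restriction of \<open>T\<close> to \<open>X\<close>, analogous to \<^const>\<open>onorm\<close>. As the supremum is
  taken in the reals, it is meaningful only if \<open>T\<close> is bounded on \<open>X\<close>.
\<close>

definition onorm_on :: "L1R set \<Rightarrow> (L1R \<Rightarrow> L1R) \<Rightarrow> real" where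
  "onorm_on X T = (SUP f\<in>X. norm (T f) / norm f)"

definition strongly_continuous_semigroup_on :: "L1R set \<Rightarrow> (real \<Rightarrow> L1R \<Rightarrow> L1R) \<Rightarrow> bool" where
  "strongly_continuous_semigroup_on X S \<longleftrightarrow>
     (\<forall>t\<ge>0. bounded_operator_on X (S t)) \<and>
     (\<forall>f\<in>X. S 0 f = f) \<and>
     (\<forall>s\<ge>0. \<forall>t\<ge>0. \<forall>f\<in>X. S (s + t) f = S s (S t f)) \<and>
     (\<forall>f\<in>X. continuous_on {0..} (\<lambda>t. S t f))"

text \<open>The complex \<open>powr\<close> is the principal power, with \<open>0 powr \<alpha> = 0\<close>.\<close>

definition psi :: "real \<Rightarrow> nat \<Rightarrow> real \<Rightarrow> real \<Rightarrow> real \<Rightarrow> complex" where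
  "psi \<alpha> q p h k = (-1) ^ (q + 1) * complex_of_real (h powr (- \<alpha>)) *
     exp (- \<i> * complex_of_real (p * k * h)) *
     (1 - exp (\<i> * complex_of_real (k * h))) powr complex_of_real \<alpha>"

definition phi :: "real \<Rightarrow> nat \<Rightarrow> real \<Rightarrow> real \<Rightarrow> real \<Rightarrow> real \<Rightarrow> real \<Rightarrow> complex" where
  "phi \<alpha> q a p1 p2 h k =
     complex_of_real a * psi \<alpha> q p1 h k + complex_of_real (1 - a) * psi \<alpha> q p2 (2 * h) k"

end

theory Submission imports Defs "HOL-Complex_Analysis.Complex_Analysis" begin

text \<open>
  With \<open>z = exp (\<i> k h)\<close> the symbol is \<open>\<phi>\<^sub>h(k) = h\<^sup>-\<^sup>\<alpha> \<Phi>(z)\<close> for a function \<open>\<Phi>\<close> on the unit circle that does not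
  depend on \<open>h\<close>. Hence \<open>t \<phi>\<^sub>h = \<tau> \<Phi>(z)\<close> with \<open>\<tau> = t h\<^sup>-\<^sup>\<alpha>\<close>, and the parameter \<open>h\<close> disappears from
  every estimate. A function \<open>\<Sum> c\<^sub>n z\<^sup>n\<close> with \<open>\<Sum> |c\<^sub>n| \<le> M\<close> is the symbol of the convolution with a
  discrete measure supported in \<open>h \<int>\<close>; it is an \<open>L\<^sub>1\<close>-multiplier of norm at most \<open>M\<close>, and it
  preserves the functions on the half-line if only \<open>n \<ge> 0\<close> occurs. So everything follows from
  bounds on the sum of the absolute Fourier coefficients that are uniform in \<open>\<tau> > 0\<close>: a constant
  for \<open>exp (\<tau> \<Phi>)\<close> and for \<open>\<tau> \<Phi> exp (\<tau> \<Phi>)\<close>, and a multiple of \<open>\<tau>\<close> for \<open>exp (\<tau> \<Phi>) - 1\<close>. The last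
  bound makes each orbit Lipschitz continuous in time, which is the strong continuity.

  Both cases rest on \<open>Re \<Phi>(z) \<le> - c |1 - z|\<^sup>\<alpha>\<close> with \<open>c > 0\<close>, and on \<open>|\<Phi>(z)| \<le> C |1 - z|\<^sup>\<alpha>\<close>, in the
  open disc if \<open>\<alpha> < 1\<close> and on the circle if \<open>\<alpha> > 1\<close>.

  For \<open>\<alpha> < 1\<close> the function \<open>\<Phi>\<close> is holomorphic in the unit disc, and so is \<open>F = exp (\<tau> \<Phi>)\<close>. By Hardy's
  inequality \<open>\<Sum> |c\<^sub>n|\<close> over \<open>n \<ge> 1\<close> is controlled by the \<open>L\<^sub>1\<close>-norm of \<open>F'\<close>, whose modulus is of
  the order \<open>\<tau> |1 - z|\<^sup>\<alpha>\<^sup>-\<^sup>1 exp (- c \<tau> |1 - z|\<^sup>\<alpha>)\<close> near \<open>1\<close>; the integral of this function is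
  bounded independently of \<open>\<tau>\<close>, because it is the derivative of a bounded monotone function.
  Hardy's inequality is needed only for products of two functions in the Hardy space \<open>H\<^sup>2\<close>, where
  it is Hilbert's inequality for the coefficients (\<open>Hardy_inequality_product\<close>); \<open>F'\<close> is a sum of
  two such products, since \<open>(1 - z)\<^sup>\<alpha>\<^sup>-\<^sup>1\<close>, \<open>(1 - z\<^sup>2)\<^sup>\<alpha>\<^sup>-\<^sup>1\<close> and \<open>exp (\<tau> \<Phi>)\<close> have holomorphic square
  roots.

  For \<open>\<alpha> > 1\<close> negative powers of \<open>z\<close> occur, but \<open>\<Phi>\<close> is continuously differentiable along the
  circle. Then Bernstein's inequality (\<open>Bernstein_coeff_sum_le\<close>), a weighted Cauchy-Schwarz
  estimate, bounds \<open>\<Sum> |c\<^sub>n|\<close> by the \<open>L\<^sub>2\<close>-norms of the function and its derivative; for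
  large \<open>\<tau>\<close> these are at most of order \<open>\<tau>\<close> to the powers \<open>- 1/(2 \<alpha>)\<close> and \<open>1/(2 \<alpha>)\<close>, and the
  estimate is balanced by weights that compare a frequency with \<open>\<tau>\<^sup>1\<^sup>/\<^sup>\<alpha>\<close>.
\<close>

section \<open>Convolution with discrete measures on the space of integrable functions\<close>

text \<open>
  The positive and the negative part of \<open>u\<close> have equal integrals (frequency zero); normalised to
  probability densities, they have the same characteristic function, so that Levy's uniqueness
  theorem applies.
\<close>

lemma AE_zero_if_fourier_zero_real:
  fixes u :: "real \<Rightarrow> real"
  assumes u [measurable]: "integrable lborel u"
    and zero: "\<And>k. (LINT x|lborel. exp (\<i> * of_real (k * x)) * complex_of_real (u x)) = 0"
  shows "AE x in lborel. u x = 0"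
proof -
  define p n where "p x = max (u x) 0" and "n x = max (- u x) 0" for x
  have p [measurable]: "integrable lborel p" and n [measurable]: "integrable lborel n"
    unfolding p_def n_def using u by (auto intro: integrable_max)
  have u_eq: "u x = p x - n x" and nonneg: "p x \<ge> 0" "n x \<ge> 0" for x
    by (auto simp: p_def n_def)
  have int: "integrable lborel (\<lambda>x. exp (\<i> * of_real (k * x)) * complex_of_real (g x))"
    if g: "integrable lborel g" for g :: "real \<Rightarrow> real" and k
  proof (rule Bochner_Integration.integrable_bound[OF g])
    have [measurable]: "g \<in> borel_measurable borel" using g by simp
    show "(\<lambda>x. exp (\<i> * of_real (k * x)) * complex_of_real (g x)) \<in> borel_measurable lborel"
      by measurable
  qed (simp add: norm_mult)
  have pn: "(LINT x|lborel. exp (\<i> * of_real (k * x)) * complex_of_real (p x)) =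
            (LINT x|lborel. exp (\<i> * of_real (k * x)) * complex_of_real (n x))" for k
    using zero[of k] int[OF p, of k] int[OF n, of k] by (simp add: u_eq right_diff_distrib)
  define m where "m = (LINT x|lborel. p x)"
  have m_n: "m = (LINT x|lborel. n x)"
  proof -
    have "complex_of_real m = complex_of_real (LINT x|lborel. n x)"
      using pn[of 0] by (simp add: m_def)
    then show ?thesis by (simp only: of_real_eq_iff)
  qed
  show ?thesis
  proof (cases "m = 0")
    case True
    then have "AE x in lborel. p x = 0" "AE x in lborel. n x = 0"
      using integral_nonneg_eq_0_iff_AE[OF p] integral_nonneg_eq_0_iff_AE[OF n] m_n nonneg
      by (auto simp: m_def)
    then show ?thesis by eventually_elim (simp add: u_eq)
  next
    case False
    moreover have "m \<ge> 0" unfolding m_def using nonneg by simp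
    ultimately have m: "m > 0" by simp
    have distr: "real_distribution (density lborel (\<lambda>x. ennreal (g x / m)))"
      if g: "integrable lborel g" "\<And>x. g x \<ge> 0" "(LINT x|lborel. g x) = m" for g :: "real \<Rightarrow> real"
    proof -
      have [measurable]: "g \<in> borel_measurable borel" using g by simp
      have "emeasure (density lborel (\<lambda>x. ennreal (g x / m))) UNIV = (\<integral>\<^sup>+x. ennreal (g x / m) \<partial>lborel)"
        by (simp add: emeasure_density)
      also have "\<dots> = ennreal (LINT x|lborel. g x / m)"
        using g m by (intro nn_integral_eq_integral) auto
      also have "\<dots> = 1" using g(3) m by simp
      finally have "prob_space (density lborel (\<lambda>x. ennreal (g x / m)))"
        by (intro prob_spaceI) simp
      then show ?thesis
        by (auto simp: real_distribution_def real_distribution_axioms_def)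
    qed
    have char: "char (density lborel (\<lambda>x. ennreal (g x / m))) k =
        (LINT x|lborel. exp (\<i> * of_real (k * x)) * complex_of_real (g x)) / complex_of_real m"
      if g: "integrable lborel g" "\<And>x. g x \<ge> 0" for g :: "real \<Rightarrow> real" and k
    proof -
      have [measurable]: "g \<in> borel_measurable borel" using g by simp
      have "char (density lborel (\<lambda>x. ennreal (g x / m))) k =
          (LINT x|lborel. (g x / m) *\<^sub>R exp (\<i> * of_real (k * x)))"
        unfolding char_def using g m by (subst integral_density) auto
      also have "\<dots> = (LINT x|lborel. exp (\<i> * of_real (k * x)) * complex_of_real (g x) / complex_of_real m)"
        by (intro Bochner_Integration.integral_cong refl) (simp add: scaleR_conv_of_real)
      finally show ?thesis by simp
    qed
    have "density lborel (\<lambda>x. ennreal (p x / m)) = density lborel (\<lambda>x. ennreal (n x / m))"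
    proof (intro Levy_uniqueness distr ext p n nonneg)
      show "integral\<^sup>L lborel p = m" "integral\<^sup>L lborel n = m"
        using m_n by (simp_all add: m_def)
      show "char (density lborel (\<lambda>x. ennreal (p x / m))) k =
          char (density lborel (\<lambda>x. ennreal (n x / m))) k" for k
        unfolding char[OF p nonneg(1)] char[OF n nonneg(2)] pn ..
    qed
    then have "AE x in lborel. ennreal (p x / m) = ennreal (n x / m)"
      using p n by (intro sigma_finite_measure.density_unique[OF sigma_finite_lborel]) auto
    then show ?thesis
      by eventually_elim (use m nonneg in \<open>simp add: u_eq ennreal_inj\<close>)
  qed
qed

text \<open>
  The transform of the complex conjugate of \<open>f\<close> at \<open>k\<close> is the conjugate of the transform of \<open>f\<close> at
  \<open>- k\<close>. So the real and the imaginary part of \<open>f\<close> have vanishing transforms as well.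
\<close>

lemma AE_zero_if_fourier_zero:
  fixes f :: "real \<Rightarrow> complex"
  assumes f: "integrable lborel f"
    and zero: "\<And>k. (LINT x|lborel. exp (\<i> * of_real (k * x)) * f x) = 0"
  shows "AE x in lborel. f x = 0"
proof -
  define E where "E k x = exp (\<i> * of_real (k * x))" for k x :: real
  have [measurable]: "f \<in> borel_measurable borel" using f by simp
  have int: "integrable lborel (\<lambda>x. E k x * g x)"
    if g: "integrable lborel g" for g :: "real \<Rightarrow> complex" and k
  proof (rule Bochner_Integration.integrable_bound[OF g])
    have [measurable]: "g \<in> borel_measurable borel" using g by simp
    show "(\<lambda>x. E k x * g x) \<in> borel_measurable lborel"
      unfolding E_def by measurable
  qed (simp add: norm_mult E_def)
  have cnj_f: "integrable lborel (\<lambda>x. cnj (f x))" using f by simp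
  have zero': "(LINT x|lborel. E k x * cnj (f x)) = 0" for k
  proof -
    have "(LINT x|lborel. E k x * cnj (f x)) = (LINT x|lborel. cnj (E (- k) x * f x))"
      by (simp add: E_def exp_cnj)
    also have "\<dots> = cnj (LINT x|lborel. E (- k) x * f x)" by (rule Bochner_Integration.integral_cnj)
    also have "\<dots> = 0" using zero[of "- k"] by (simp add: E_def)
    finally show ?thesis .
  qed
  have "AE x in lborel. Re (f x) = 0"
  proof (rule AE_zero_if_fourier_zero_real)
    show "integrable lborel (\<lambda>x. Re (f x))" using f by simp
    fix k
    have "(LINT x|lborel. E k x * complex_of_real (Re (f x))) =
      (LINT x|lborel. (E k x * f x + E k x * cnj (f x)) / 2)"
      by (intro Bochner_Integration.integral_cong refl)
        (simp add: complex_add_cnj flip: distrib_left)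
    also have "\<dots> = 0"
      using zero[of k] zero'[of k] int[OF f, of k] int[OF cnj_f, of k] by (simp add: E_def)
    finally show "(LINT x|lborel. exp (\<i> * of_real (k * x)) * complex_of_real (Re (f x))) = 0"
      by (simp add: E_def)
  qed
  moreover have "AE x in lborel. Im (f x) = 0"
  proof (rule AE_zero_if_fourier_zero_real)
    show "integrable lborel (\<lambda>x. Im (f x))" using f by simp
    fix k
    have "(LINT x|lborel. E k x * complex_of_real (Im (f x))) =
      (LINT x|lborel. (E k x * f x - E k x * cnj (f x)) / (2 * \<i>))"
    proof (intro Bochner_Integration.integral_cong refl)
      fix x
      have "E k x * f x - E k x * cnj (f x) = (2 * \<i>) * (E k x * complex_of_real (Im (f x)))"
        unfolding right_diff_distrib[symmetric] complex_diff_cnj by simp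
      then show "E k x * complex_of_real (Im (f x)) = (E k x * f x - E k x * cnj (f x)) / (2 * \<i>)"
        by simp
    qed
    also have "\<dots> = 0"
      using zero[of k] zero'[of k] int[OF f, of k] int[OF cnj_f, of k] by (simp add: E_def)
    finally show "(LINT x|lborel. exp (\<i> * of_real (k * x)) * complex_of_real (Im (f x))) = 0"
      by (simp add: E_def)
  qed
  ultimately show ?thesis by eventually_elim (simp add: complex_eq_iff)
qed

lemma integrable_exp_mult:
  assumes "integrable lborel f"
  shows "integrable lborel (\<lambda>x. exp (\<i> * of_real (k * x)) * f x)"
proof (rule Bochner_Integration.integrable_bound[OF assms])
  have [measurable]: "f \<in> borel_measurable borel" using assms by simp
  show "(\<lambda>x. exp (\<i> * of_real (k * x)) * f x) \<in> borel_measurable lborel"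
    by measurable
qed (simp add: norm_mult)

lemma fourier_eq_zero_imp: "(\<And>k. fourier f k = 0) \<Longrightarrow> f = 0"
proof transfer
  fix f assume "L1_eq f f" "\<And>k. (LINT x|lborel. exp (\<i> * of_real (k * x)) * f x) = 0"
  then show "L1_eq f (\<lambda>_. 0)"
    using AE_zero_if_fourier_zero[of f] by (simp add: L1_eq_def)
qed

lemma fourier_add: "fourier (f + g) k = fourier f k + fourier g k"
  by transfer (simp only: L1_eq_def distrib_left integrable_exp_mult Bochner_Integration.integral_add)

lemma fourier_diff: "fourier (f - g) k = fourier f k - fourier g k"
  by transfer (simp only: L1_eq_def right_diff_distrib integrable_exp_mult Bochner_Integration.integral_diff)

lemma fourier_scale: "fourier (scale_L1 c f) k = c * fourier f k"
proof transfer
  fix c k and f :: "real \<Rightarrow> complex"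
  have "(\<lambda>x. exp (\<i> * of_real (k * x)) * (c * f x)) =
        (\<lambda>x. c * (exp (\<i> * of_real (k * x)) * f x))"
    by (simp add: fun_eq_iff)
  then show "(LINT x|lborel. exp (\<i> * of_real (k * x)) * (c * f x)) =
      c * (LINT x|lborel. exp (\<i> * of_real (k * x)) * f x)"
    by (simp only: integral_mult_right_zero)
qed

theorem fourier_inject: "(\<And>k. fourier f k = fourier g k) \<Longrightarrow> f = g"
  using fourier_eq_zero_imp[of "f - g"] by (simp add: fourier_diff)

lemma mult_op_eqI: "(\<And>k. fourier v k = \<psi> k * fourier f k) \<Longrightarrow> mult_op \<psi> f = v"
  unfolding mult_op_def by (rule the_equality) (auto intro: fourier_inject)

lemma fourier_mult_op:
  "L1_multiplier \<psi> \<Longrightarrow> fourier (mult_op \<psi> f) k = \<psi> k * fourier f k"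
  unfolding L1_multiplier_def using mult_op_eqI by metis

text \<open>
  The symbol of the convolution with \<open>\<Sum> c\<^sub>j \<delta>\<^bsub>s j\<^esub>\<close>, a discrete measure supported in \<open>S\<close> of total
  variation at most \<open>M\<close>.
\<close>

definition translation_symbol :: "real set \<Rightarrow> real \<Rightarrow> (real \<Rightarrow> complex) \<Rightarrow> bool" where
  "translation_symbol S M \<psi> \<longleftrightarrow>
     (\<exists>c s. (\<forall>j::nat. s j \<in> S) \<and> summable (\<lambda>j. norm (c j)) \<and> (\<Sum>j. norm (c j)) \<le> M \<and>
        (\<forall>k. \<psi> k = (\<Sum>j. c j * exp (\<i> * of_real (k * s j)))))"

lemma integral_translate:
  fixes f :: "real \<Rightarrow> 'a::euclidean_space"
  shows "(LINT x|lborel. f (x - s)) = (LINT x|lborel. f x)"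
  using lborel_integral_real_affine[of 1 f "- s"] by simp

lemma integrable_translate:
  fixes f :: "real \<Rightarrow> 'a::euclidean_space"
  shows "integrable lborel f \<Longrightarrow> integrable lborel (\<lambda>x. f (x - s))"
  using lborel_integrable_real_affine[of f 1 "- s"] by simp

lemma translation_series:
  fixes f :: "real \<Rightarrow> complex" and c :: "nat \<Rightarrow> complex" and s :: "nat \<Rightarrow> real"
  assumes f: "integrable lborel f" and c: "summable (\<lambda>j. norm (c j))"
  defines "v \<equiv> \<lambda>x. \<Sum>j. c j * f (x - s j)"
  shows "integrable lborel v"
    and "(LINT x|lborel. norm (v x)) \<le> (\<Sum>j. norm (c j)) * (LINT x|lborel. norm (f x))"
    and "(LINT x|lborel. exp (\<i> * of_real (k * x)) * v x) =
          (\<Sum>j. c j * exp (\<i> * of_real (k * s j))) * (LINT x|lborel. exp (\<i> * of_real (k * x)) * f x)"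
proof -
  let ?F = "\<lambda>j x. c j * f (x - s j)"
  have [measurable]: "f \<in> borel_measurable borel" using f by simp
  have int: "integrable lborel (?F j)" for j
    using integrable_translate[OF f] by simp
  have normF: "(LINT x|lborel. norm (?F j x)) = norm (c j) * (LINT x|lborel. norm (f x))" for j
    using integral_translate[of "\<lambda>x. norm (f x)" "s j"] by (simp add: norm_mult)
  have sumF: "summable (\<lambda>j. LINT x|lborel. norm (?F j x))"
    unfolding normF by (intro summable_mult2 c)
  have AE_sum: "AE x in lborel. summable (\<lambda>j. norm (?F j x))"
  proof -
    have "(\<integral>\<^sup>+x. (\<Sum>j. ennreal (norm (?F j x))) \<partial>lborel) = (\<Sum>j. \<integral>\<^sup>+x. ennreal (norm (?F j x)) \<partial>lborel)"
      by (rule nn_integral_suminf) measurable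
    also have "\<dots> = (\<Sum>j. ennreal (LINT x|lborel. norm (?F j x)))"
      using int by (intro suminf_cong nn_integral_eq_integral) auto
    also have "\<dots> = ennreal (\<Sum>j. LINT x|lborel. norm (?F j x))"
      by (intro suminf_ennreal2 sumF) auto
    finally have "(\<integral>\<^sup>+x. (\<Sum>j. ennreal (norm (?F j x))) \<partial>lborel) \<noteq> \<infinity>" by simp
    then have "AE x in lborel. (\<Sum>j. ennreal (norm (?F j x))) \<noteq> \<infinity>"
      by (intro nn_integral_noteq_infinite) auto
    then show ?thesis
      by eventually_elim (intro summable_suminf_not_top, auto)
  qed
  show v: "integrable lborel v"
    unfolding v_def by (rule integrable_suminf[OF int AE_sum sumF])
  have "(LINT x|lborel. norm (v x)) \<le> (LINT x|lborel. (\<Sum>j. norm (?F j x)))"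
  proof (rule integral_mono_AE)
    show "integrable lborel (\<lambda>x. \<Sum>j. norm (?F j x))"
      using int AE_sum sumF by (intro integrable_suminf) auto
    show "AE x in lborel. norm (v x) \<le> (\<Sum>j. norm (?F j x))"
      using AE_sum by eventually_elim (simp add: v_def summable_norm)
  qed (use v in simp)
  also have "\<dots> = (\<Sum>j. LINT x|lborel. norm (?F j x))"
    using int AE_sum sumF by (intro integral_suminf) auto
  also have "\<dots> = (\<Sum>j. norm (c j)) * (LINT x|lborel. norm (f x))"
    unfolding normF by (intro suminf_mult2[symmetric] c)
  finally show "(LINT x|lborel. norm (v x)) \<le> (\<Sum>j. norm (c j)) * (LINT x|lborel. norm (f x))" .
  let ?E = "\<lambda>x. exp (\<i> * of_real (k * x))"
  have "(LINT x|lborel. ?E x * v x) = (LINT x|lborel. (\<Sum>j. ?E x * ?F j x))"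
  proof (rule integral_cong_AE)
    show "AE x in lborel. ?E x * v x = (\<Sum>j. ?E x * ?F j x)"
      using AE_sum by eventually_elim (simp add: v_def suminf_mult summable_norm_cancel)
  qed (auto simp: v_def)
  also have "\<dots> = (\<Sum>j. LINT x|lborel. ?E x * ?F j x)"
    using integrable_exp_mult[OF int] AE_sum sumF by (intro integral_suminf) (auto simp: norm_mult)
  also have "\<dots> = (\<Sum>j. (c j * ?E (s j)) * (LINT x|lborel. ?E x * f x))"
  proof (rule suminf_cong)
    fix j
    have "(LINT x|lborel. ?E x * ?F j x) = (LINT x|lborel. (c j * ?E (s j)) * (?E (x - s j) * f (x - s j)))"
    proof (intro Bochner_Integration.integral_cong refl)
      fix x
      have "?E x = ?E (s j) * ?E (x - s j)"
        unfolding exp_add[symmetric] by (simp add: algebra_simps)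
      then show "?E x * ?F j x = (c j * ?E (s j)) * (?E (x - s j) * f (x - s j))" by simp
    qed
    also have "\<dots> = (c j * ?E (s j)) * (LINT x|lborel. ?E (x - s j) * f (x - s j))"
      by simp
    finally show "(LINT x|lborel. ?E x * ?F j x) = (c j * ?E (s j)) * (LINT x|lborel. ?E x * f x)"
      using integral_translate[of "\<lambda>x. ?E x * f x" "s j"] by simp
  qed
  also have "\<dots> = (\<Sum>j. c j * ?E (s j)) * (LINT x|lborel. ?E x * f x)"
  proof (rule suminf_mult2[symmetric])
    show "summable (\<lambda>j. c j * ?E (s j))"
      using c by (rule_tac summable_norm_cancel) (simp add: norm_mult)
  qed
  finally show "(LINT x|lborel. ?E x * v x) = (\<Sum>j. c j * ?E (s j)) * (LINT x|lborel. ?E x * f x)" .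
qed

lemma translation_symbol_ex:
  assumes "translation_symbol S M \<psi>"
  shows "\<exists>v. (\<forall>k. fourier v k = \<psi> k * fourier f k) \<and> norm v \<le> M * norm f \<and>
     (S \<subseteq> {0..} \<longrightarrow> vanishes_on_negatives f \<longrightarrow> vanishes_on_negatives v)"
proof -
  obtain c s where s: "\<And>j::nat. s j \<in> S" and c: "summable (\<lambda>j. norm (c j))" "(\<Sum>j. norm (c j)) \<le> M"
    and \<psi>: "\<And>k. \<psi> k = (\<Sum>j. c j * exp (\<i> * of_real (k * s j)))"
    using assms unfolding translation_symbol_def by blast
  show ?thesis
  proof (transfer fixing: M S \<psi>)
    fix f assume "L1_eq f f"
    then have f: "integrable lborel f" by (simp add: L1_eq_def)
    have [measurable]: "f \<in> borel_measurable borel" using f by simp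
    define v where "v = (\<lambda>x. \<Sum>j. c j * f (x - s j))"
    note v = translation_series[OF f c(1), where s = s, folded v_def]
    have "L1_eq v v" using v(1) by (simp add: L1_eq_def)
    moreover have "(LINT x|lborel. exp (\<i> * of_real (k * x)) * v x) =
      \<psi> k * (LINT x|lborel. exp (\<i> * of_real (k * x)) * f x)" for k
      using v(3) unfolding v_def \<psi> .
    moreover have "(LINT x|lborel. norm (v x)) \<le> M * (LINT x|lborel. norm (f x))"
      using v(2) unfolding v_def by (rule order.trans) (intro mult_right_mono c(2), simp)
    moreover have "AE x in lborel. x < 0 \<longrightarrow> v x = 0"
      if S: "S \<subseteq> {0..}" and "AE x in lborel. x < 0 \<longrightarrow> f x = 0"
    proof -
      have "AE x in lborel. x - s j < 0 \<longrightarrow> f (x - s j) = 0" for j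
      proof -
        have "Measurable.pred borel (\<lambda>x. x < 0 \<longrightarrow> f x = 0)" by measurable
        then show ?thesis
          using AE_borel_affine[of 1 "\<lambda>x. x < 0 \<longrightarrow> f x = 0" "- s j"] that(2) by simp
      qed
      then have "AE x in lborel. \<forall>j. x - s j < 0 \<longrightarrow> f (x - s j) = 0"
        by (simp add: AE_all_countable)
      then show ?thesis
      proof eventually_elim
        case (elim x)
        have "f (x - s j) = 0" if "x < 0" for j
        proof -
          have "0 \<le> s j" using s S by auto
          then show ?thesis using elim that by simp
        qed
        then show ?case by (simp add: v_def)
      qed
    qed
    ultimately show "\<exists>v\<in>{f. L1_eq f f}.
      (\<forall>k. (LINT x|lborel. exp (\<i> * of_real (k * x)) * v x) =
        \<psi> k * (LINT x|lborel. exp (\<i> * of_real (k * x)) * f x)) \<and>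
      (LINT x|lborel. norm (v x)) \<le> M * (LINT x|lborel. norm (f x)) \<and>
      (S \<subseteq> {0..} \<longrightarrow> (AE x in lborel. x < 0 \<longrightarrow> f x = 0) \<longrightarrow> (AE x in lborel. x < 0 \<longrightarrow> v x = 0))"
      by blast
  qed
qed

text \<open>
  A convolution with a measure on \<open>S\<close> preserves this space, as the half-line is closed under sums.
\<close>

definition support_space :: "real set \<Rightarrow> L1R set" where
  "support_space S = (if S \<subseteq> {0..} then L1_Rplus else UNIV)"

lemma vanishes_zero: "vanishes_on_negatives 0"
  by transfer simp

lemma translation_symbol_multiplier:
  assumes "translation_symbol S M \<psi>"
  shows "L1_multiplier \<psi>"
proof -
  obtain c s where "\<psi> = (\<lambda>k. \<Sum>j::nat. c j * exp (\<i> * of_real (k * s j)))"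
    using assms unfolding translation_symbol_def by (auto simp: fun_eq_iff)
  then have "\<psi> \<in> borel_measurable borel" by simp
  then show ?thesis
    unfolding L1_multiplier_def using translation_symbol_ex[OF assms] by metis
qed

lemma norm_mult_op_le:
  assumes "translation_symbol S M \<psi>"
  shows "norm (mult_op \<psi> f) \<le> M * norm f"
  using translation_symbol_ex[OF assms, of f] mult_op_eqI by metis

lemma mult_op_support_space:
  assumes "translation_symbol S M \<psi>" "f \<in> support_space S"
  shows "mult_op \<psi> f \<in> support_space S"
proof (cases "S \<subseteq> {0..}")
  case True
  obtain v where "\<forall>k. fourier v k = \<psi> k * fourier f k"
    "vanishes_on_negatives f \<longrightarrow> vanishes_on_negatives v"
    using translation_symbol_ex[OF assms(1), of f] True by blast
  then show ?thesis
    using mult_op_eqI[of v \<psi> f] assms(2) True by (auto simp: support_space_def L1_Rplus_def)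
qed (simp add: support_space_def)

lemma bounded_operator_on_mult_op:
  assumes "translation_symbol S M \<psi>"
  shows "bounded_operator_on (support_space S) (mult_op \<psi>)"
  unfolding bounded_operator_on_def
proof (intro conjI ballI allI)
  note F = fourier_mult_op[OF translation_symbol_multiplier[OF assms]]
  show "mult_op \<psi> f \<in> support_space S" if "f \<in> support_space S" for f
    using mult_op_support_space[OF assms that] .
  show "mult_op \<psi> (f + g) = mult_op \<psi> f + mult_op \<psi> g" for f g
    by (rule mult_op_eqI) (simp add: fourier_add F distrib_left)
  show "mult_op \<psi> (scale_L1 c f) = scale_L1 c (mult_op \<psi> f)" for c f
    by (rule mult_op_eqI) (simp add: fourier_scale F)
  show "\<exists>B. \<forall>f\<in>support_space S. norm (mult_op \<psi> f) \<le> B * norm f"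
    using norm_mult_op_le[OF assms] by blast
qed

lemma onorm_on_mult_op_le:
  assumes "translation_symbol S M \<psi>" "0 \<le> M"
  shows "onorm_on (support_space S) (mult_op \<psi>) \<le> M"
  unfolding onorm_on_def
proof (rule cSUP_least)
  have "0 \<in> support_space S"
    by (simp add: support_space_def L1_Rplus_def vanishes_zero)
  then show "support_space S \<noteq> {}" by blast
  show "norm (mult_op \<psi> f) / norm f \<le> M" for f
    using norm_mult_op_le[OF assms(1), of f] assms(2)
    by (cases "norm f = 0") (auto simp: pos_divide_le_eq)
qed

lemma mult_op_mult:
  assumes "L1_multiplier \<psi>" "L1_multiplier \<psi>'"
  shows "mult_op (\<lambda>k. \<psi> k * \<psi>' k) f = mult_op \<psi> (mult_op \<psi>' f)"
  by (rule mult_op_eqI) (simp add: fourier_mult_op assms)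

lemma translation_symbol_scale:
  assumes "translation_symbol S M \<psi>"
  shows "translation_symbol S (norm b * M) (\<lambda>k. b * \<psi> k)"
proof -
  obtain c s where cs: "\<And>j::nat. s j \<in> S" "summable (\<lambda>j. norm (c j))" "(\<Sum>j. norm (c j)) \<le> M"
    "\<And>k. \<psi> k = (\<Sum>j. c j * exp (\<i> * of_real (k * s j)))"
    using assms unfolding translation_symbol_def by blast
  have sm: "summable (\<lambda>j. c j * exp (\<i> * of_real (k * s j)))" for k
    using cs(2) by (rule_tac summable_norm_cancel) (simp add: norm_mult)
  have "summable (\<lambda>j. norm (b * c j))" "(\<Sum>j. norm (b * c j)) \<le> norm b * M"
    using cs(2,3) by (auto simp: norm_mult suminf_mult intro!: summable_mult mult_left_mono)
  moreover have "b * \<psi> k = (\<Sum>j. b * c j * exp (\<i> * of_real (k * s j)))" for k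
    using sm[of k] by (simp add: cs(4) suminf_mult mult.assoc)
  ultimately show ?thesis
    unfolding translation_symbol_def using cs(1) by (intro exI[of _ "\<lambda>j. b * c j"] exI[of _ s]) simp
qed

text \<open>
  The bound \<open>L t\<close> for \<open>exp (t \<phi>) - 1\<close> together with the semigroup law makes every orbit Lipschitz
  continuous, uniformly in time. This is available since the difference operators are bounded for
  fixed \<open>h\<close>; the constant \<open>L\<close> may depend on \<open>h\<close>.
\<close>

lemma strongly_continuous_semigroup_on_mult_op:
  assumes bd: "\<And>t. 0 \<le> t \<Longrightarrow> translation_symbol S M (\<lambda>k. exp (complex_of_real t * \<phi> k))"
    and lip: "\<And>t. 0 \<le> t \<Longrightarrow> translation_symbol S (L * t) (\<lambda>k. exp (complex_of_real t * \<phi> k) - 1)"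
    and "0 \<le> M" "0 \<le> L"
  shows "strongly_continuous_semigroup_on (support_space S)
     (\<lambda>t. mult_op (\<lambda>k. exp (complex_of_real t * \<phi> k)))"
proof -
  define T where "T t = mult_op (\<lambda>k. exp (complex_of_real t * \<phi> k))" for t
  note mult = translation_symbol_multiplier[OF bd]
  have plus: "T (s + t) f = T s (T t f)" if "s \<ge> 0" "t \<ge> 0" for s t f
    unfolding T_def mult_op_mult[OF mult mult, OF that, symmetric]
    by (simp add: distrib_right exp_add)
  have diff: "norm (T t f - f) \<le> L * t * norm f" if "t \<ge> 0" for t f
  proof -
    have "mult_op (\<lambda>k. exp (complex_of_real t * \<phi> k) - 1) f = T t f - f"
      unfolding T_def by (rule mult_op_eqI) (simp add: fourier_diff fourier_mult_op[OF mult[OF that]] left_diff_distrib)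
    then show ?thesis using norm_mult_op_le[OF lip[OF that], of f] by simp
  qed
  have lips: "norm (T t f - T s f) \<le> M * L * norm f * (t - s)" if "0 \<le> s" "s \<le> t" for s t f
  proof -
    have "T t f - T s f = T s (T (t - s) f - f)"
      using plus[of s "t - s" f] that unfolding T_def
      by (intro mult_op_eqI[symmetric]) (simp add: fourier_diff fourier_mult_op[OF mult] algebra_simps)
    also have "norm \<dots> \<le> M * norm (T (t - s) f - f)"
      unfolding T_def by (rule norm_mult_op_le[OF bd[OF that(1)]])
    also have "\<dots> \<le> M * (L * (t - s) * norm f)"
      using that \<open>0 \<le> M\<close> by (intro mult_left_mono diff) auto
    finally show ?thesis by (simp add: mult_ac)
  qed
  have "continuous_on {0..} (\<lambda>t. T t f)" for f
  proof (rule lipschitz_on_continuous_on)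
    show "(M * L * norm f)-lipschitz_on {0..} (\<lambda>t. T t f)"
    proof (rule lipschitz_onI)
      fix t s :: real assume "t \<in> {0..}" "s \<in> {0..}"
      then show "dist (T t f) (T s f) \<le> M * L * norm f * dist t s"
        using lips[of s t f] lips[of t s f]
        by (cases "s \<le> t") (auto simp: dist_norm norm_minus_commute)
    qed (use assms in auto)
  qed
  moreover have "T 0 f = f" for f
    unfolding T_def by (rule mult_op_eqI) simp
  ultimately show ?thesis
    unfolding strongly_continuous_semigroup_on_def T_def[symmetric]
    using bounded_operator_on_mult_op[OF bd] plus by (auto simp: T_def)
qed

section \<open>Fourier coefficients on the circle and Bessel's inequality\<close>

text \<open>
  The circle is parametrised by the unit interval, so that the exponentials are orthonormal
  without a normalising factor.
\<close>

definition circ :: "real \<Rightarrow> complex" where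
  "circ x = cis (2 * pi * x)"

lemma norm_circ [simp]: "norm (circ x) = 1"
  by (simp add: circ_def)

lemma circ_nonzero [simp]: "circ x \<noteq> 0"
  by (simp add: circ_def)

lemma circ_0 [simp]: "circ 0 = 1"
  by (simp add: circ_def)

lemma circ_add: "circ (x + y) = circ x * circ y"
  by (simp add: circ_def cis_mult algebra_simps)

lemma cnj_circ: "cnj (circ x) = circ (- x)"
  by (simp add: circ_def cis_cnj)

lemma circ_minus: "circ (- x) = inverse (circ x)"
  by (simp add: circ_def)

lemma circ_of_int [simp]: "circ (of_int n) = 1"
  using cis_multiple_2pi[of "of_int n"] by (simp add: circ_def)

lemma circ_int_mult: "circ (of_int n * x) = circ x powi n"
  by (simp add: circ_def cis_power_int mult_ac)

lemma circ_nat_mult: "circ (of_nat n * x) = circ x ^ n"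
  by (simp add: circ_def Complex.DeMoivre mult_ac)

lemma continuous_on_circ [continuous_intros]:
  "continuous_on A f \<Longrightarrow> continuous_on A (\<lambda>x. circ (f x))"
  unfolding circ_def by (intro continuous_intros)

lemma circ_has_vector_derivative:
  "((\<lambda>x. circ (c * x)) has_vector_derivative (2 * of_real pi * \<i> * of_real c * circ (c * x))) (at x within A)"
proof -
  have "((\<lambda>x. exp (2 * of_real pi * \<i> * of_real c * of_real x)) has_vector_derivative
      (2 * of_real pi * \<i> * of_real c) * exp (2 * of_real pi * \<i> * of_real c * of_real x)) (at x within A)"
    by (rule has_vector_derivative_real_field) (auto intro!: derivative_eq_intros)
  moreover have "circ (c * x) = exp (2 * of_real pi * \<i> * of_real c * of_real x)" for x
    by (simp add: circ_def cis_conv_exp mult_ac)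
  ultimately show ?thesis by simp
qed

lemma integral_circ:
  "((\<lambda>x. circ (of_int n * x)) has_integral (if n = 0 then 1 else 0)) {0..1}"
proof (cases "n = 0")
  case True
  then show ?thesis
    using has_integral_const_real[of "1::complex" 0 1] by simp
next
  case False
  have "((\<lambda>x. circ (of_int n * x) / (2 * of_real pi * \<i> * of_real (of_int n)))
     has_vector_derivative circ (of_int n * x)) (at x within {0..1})" for x
    using False by (auto intro!: derivative_eq_intros circ_has_vector_derivative
        has_vector_derivative_divide)
  then have "((\<lambda>x. circ (of_int n * x)) has_integral
     (circ (of_int n * 1) / (2 * of_real pi * \<i> * of_real (of_int n)) -
      circ (of_int n * 0) / (2 * of_real pi * \<i> * of_real (of_int n)))) {0..1}"
    by (intro fundamental_theorem_of_calculus) auto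
  then show ?thesis using False by simp
qed

definition circ_coeff :: "(real \<Rightarrow> complex) \<Rightarrow> int \<Rightarrow> complex" where
  "circ_coeff f n = integral {0..1} (\<lambda>x. f x * circ (- (of_int n * x)))"

text \<open>
  Let \<open>p\<close> be the partial Fourier sum over \<open>F\<close>. Orthonormality gives the same value, the sum on the
  left, for the integrals of \<open>f cnj p\<close> and of \<open>|p|\<^sup>2\<close>; now integrate
  \<open>2 Re (f cnj p) - |p|\<^sup>2 \<le> |f|\<^sup>2\<close>.
\<close>

theorem Bessel_inequality:
  assumes f: "continuous_on {0..1} f" and F: "finite F"
  shows "(\<Sum>n\<in>F. (norm (circ_coeff f n))^2) \<le> integral {0..1} (\<lambda>x. (norm (f x))^2)"
proof -
  define c where "c = circ_coeff f"
  define p where "p x = (\<Sum>n\<in>F. c n * circ (of_int n * x))" for x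
  have cp: "continuous_on {0..1} p"
    unfolding p_def by (intro continuous_intros)
  have fp: "((\<lambda>x. f x * cnj (p x)) has_integral of_real (\<Sum>n\<in>F. (norm (c n))^2)) {0..1}"
  proof -
    have "((\<lambda>x. f x * circ (- (of_int n * x))) has_integral c n) {0..1}" for n
      unfolding c_def circ_coeff_def
      by (intro integrable_integral integrable_continuous_real continuous_intros f)
    then have "((\<lambda>x. \<Sum>n\<in>F. cnj (c n) * (f x * circ (- (of_int n * x)))) has_integral
        (\<Sum>n\<in>F. cnj (c n) * c n)) {0..1}"
      by (intro has_integral_sum F has_integral_mult_right)
    moreover have "(\<Sum>n\<in>F. cnj (c n) * (f x * circ (- (of_int n * x)))) = f x * cnj (p x)" for x
      by (simp add: p_def sum_distrib_left cnj_circ mult_ac)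
    moreover have "cnj (c n) * c n = of_real ((norm (c n))^2)" for n
      by (metis complex_norm_square mult.commute)
    ultimately show ?thesis by simp
  qed
  have pp: "((\<lambda>x. p x * cnj (p x)) has_integral of_real (\<Sum>n\<in>F. (norm (c n))^2)) {0..1}"
  proof -
    have "((\<lambda>x. \<Sum>n\<in>F. \<Sum>m\<in>F. c n * cnj (c m) * circ (of_int (n - m) * x)) has_integral
        (\<Sum>n\<in>F. \<Sum>m\<in>F. c n * cnj (c m) * (if n - m = 0 then 1 else 0))) {0..1}"
      by (intro has_integral_sum F has_integral_mult_right integral_circ)
    moreover have "(\<Sum>n\<in>F. \<Sum>m\<in>F. c n * cnj (c m) * circ (of_int (n - m) * x)) = p x * cnj (p x)" for x
      unfolding p_def cnj_sum sum_product
      by (intro sum.cong refl) (simp add: cnj_circ left_diff_distrib circ_add[symmetric])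
    moreover have "(\<Sum>m\<in>F. c n * cnj (c m) * (if n - m = 0 then 1 else 0))
        = (if n \<in> F then of_real ((norm (c n))^2) else 0)" for n
    proof -
      have "(\<Sum>m\<in>F. c n * cnj (c m) * (if n - m = 0 then 1 else 0))
        = (\<Sum>m\<in>F. if n = m then of_real ((norm (c n))^2) else 0)"
        by (intro sum.cong refl) (auto simp: complex_norm_square simp del: of_real_power)
      then show ?thesis using F by (simp add: sum.delta)
    qed
    ultimately show ?thesis by simp
  qed
  have "((\<lambda>x. Re (2 * (f x * cnj (p x)) - p x * cnj (p x))) has_integral
      Re (2 * of_real (\<Sum>n\<in>F. (norm (c n))^2) - of_real (\<Sum>n\<in>F. (norm (c n))^2))) {0..1}"
    by (intro has_integral_Re has_integral_diff has_integral_mult_right fp pp)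
  moreover have "((\<lambda>x. (norm (f x))^2) has_integral integral {0..1} (\<lambda>x. (norm (f x))^2)) {0..1}"
    by (intro integrable_integral integrable_continuous_real continuous_intros f)
  moreover have "Re (2 * (f x * cnj (p x)) - p x * cnj (p x)) \<le> (norm (f x))^2" for x
  proof -
    have "(norm (f x))^2 - Re (2 * (f x * cnj (p x)) - p x * cnj (p x)) = (norm (f x - p x))^2"
      unfolding cmod_power2 by (simp add: power2_eq_square algebra_simps)
    then show ?thesis by (smt (verit) zero_le_power2)
  qed
  ultimately have "Re (2 * of_real (\<Sum>n\<in>F. (norm (c n))^2) - of_real (\<Sum>n\<in>F. (norm (c n))^2))
      \<le> integral {0..1} (\<lambda>x. (norm (f x))^2)"
    by (rule has_integral_le)
  then show ?thesis by (simp add: c_def)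
qed

section \<open>Hilbert's and Hardy's inequalities\<close>

lemma sum_inverse_sqrt_le: "(\<Sum>k=1..n. 1 / sqrt (real k)) \<le> 2 * sqrt (real n)"
proof (induction n)
  case (Suc n)
  have "1 / sqrt (real (Suc n)) \<le> 2 * (sqrt (real (Suc n)) - sqrt (real n))"
  proof -
    define a b where "a = sqrt (real (Suc n))" and "b = sqrt (real n)"
    have "b \<ge> 0" "a > 0" "a^2 = b^2 + 1" "b \<le> a" by (auto simp: a_def b_def)
    then have "1 = (a - b) * (a + b)" by (simp add: power2_eq_square algebra_simps)
    also have "\<dots> \<le> (a - b) * (2 * a)" using \<open>b \<le> a\<close> by (intro mult_left_mono) auto
    finally have "1 / a \<le> 2 * (a - b)" using \<open>a > 0\<close> by (simp add: field_simps)
    then show ?thesis by (simp only: a_def b_def)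
  qed
  with Suc show ?case by (simp add: algebra_simps)
qed simp

lemma sum_inverse_3_2_le:
  assumes "0 < m"
  shows "(\<Sum>k=Suc m..m+n. 1 / (real k * sqrt (real k))) \<le> 2 / sqrt (real m) - 2 / sqrt (real (m + n))"
proof (induction n)
  case (Suc n)
  define a b where "a = sqrt (real (Suc (m + n)))" and "b = sqrt (real (m + n))"
  have ab: "b > 0" "a > 0" "a^2 = b^2 + 1" "b \<le> a" "a^2 = real (Suc (m+n))"
    using assms by (auto simp: a_def b_def)
  have "1 / (a^2 * a) \<le> 2 / b - 2 / a"
  proof -
    have "b * (a + b) \<le> a * (2 * a)" using ab by (intro mult_mono) auto
    then have "b \<le> 2 * a^2 / (a + b)"
      using ab(1,2) by (simp add: pos_le_divide_eq power2_eq_square)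
    moreover have "(a - b) * (a + b) = 1" using ab by (simp add: power2_eq_square algebra_simps)
    then have "a - b = 1 / (a + b)" using ab(1,2) by (simp add: field_simps)
    ultimately have "b \<le> 2 * a^2 * (a - b)" by simp
    then have "b / (a^2 * a * b) \<le> 2 * a^2 * (a - b) / (a^2 * a * b)"
      using ab(1,2) by (intro divide_right_mono) auto
    moreover have "b / (a^2 * a * b) = 1 / (a^2 * a)" using ab(1) by simp
    moreover have "2 * a^2 * (a - b) / (a^2 * a * b) = 2 / b - 2 / a"
      using ab(1,2) by (simp add: field_simps power2_eq_square)
    ultimately show ?thesis by simp
  qed
  moreover have "(\<Sum>k=Suc m..m + Suc n. 1 / (real k * sqrt (real k))) =
     (\<Sum>k=Suc m..m + n. 1 / (real k * sqrt (real k))) + 1 / (a^2 * a)"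
    using ab(5) by (simp add: a_def)
  ultimately show ?case using Suc by (simp add: a_def b_def)
qed simp

text \<open>
  The row sums of the Hilbert matrix with the weights of Schur's test. With \<open>J = j + 1\<close> and
  \<open>K = k + 1\<close> the denominator \<open>J + K - 1\<close> is at least \<open>max J K\<close>, and the sum is split at \<open>K = J\<close>;
  each half is at most \<open>2\<close>.
\<close>

lemma Hilbert_kernel_row_sum:
  "(\<Sum>k<N. sqrt (real (Suc j) / real (Suc k)) / real (j + k + 1)) \<le> 4"
proof -
  have *: "(\<Sum>k=1..M. sqrt (real J / real k) / real (J + k - 1)) \<le> 4" if "J > 0" "J \<le> M" for J M
  proof -
    have "(\<Sum>k=1..M. sqrt (real J / real k) / real (J + k - 1)) =
       (\<Sum>k=1..J. sqrt (real J / real k) / real (J + k - 1)) +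
       (\<Sum>k=Suc J..M. sqrt (real J / real k) / real (J + k - 1))"
      using that sum.ub_add_nat[of 1 J "\<lambda>k. sqrt (real J / real k) / real (J + k - 1)" "M - J"]
      by simp
    also have "\<dots> \<le> (\<Sum>k=1..J. (1 / sqrt (real J)) * (1 / sqrt (real k))) +
       (\<Sum>k=Suc J..M. sqrt (real J) * (1 / (real k * sqrt (real k))))"
    proof (intro add_mono sum_mono)
      fix k assume k: "k \<in> {1..J}"
      have "sqrt (real J / real k) / real (J + k - 1) \<le> sqrt (real J / real k) / real J"
        using k by (intro divide_left_mono) auto
      also have "\<dots> = (1 / sqrt (real J)) * (1 / sqrt (real k))"
        using that k real_sqrt_mult_self[of "real J"] by (simp add: real_sqrt_divide field_simps)
      finally show "sqrt (real J / real k) / real (J + k - 1) \<le> \<dots>" .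
    next
      fix k assume k: "k \<in> {Suc J..M}"
      have "sqrt (real J / real k) / real (J + k - 1) \<le> sqrt (real J / real k) / real k"
        using k that by (intro divide_left_mono) auto
      also have "\<dots> = sqrt (real J) * (1 / (real k * sqrt (real k)))"
        by (simp add: real_sqrt_divide field_simps)
      finally show "sqrt (real J / real k) / real (J + k - 1) \<le> \<dots>" .
    qed
    also have "\<dots> = (1 / sqrt (real J)) * (\<Sum>k=1..J. 1 / sqrt (real k)) +
       sqrt (real J) * (\<Sum>k=Suc J..J + (M - J). 1 / (real k * sqrt (real k)))"
      using that by (simp add: sum_distrib_left)
    also have "\<dots> \<le> (1 / sqrt (real J)) * (2 * sqrt (real J)) + sqrt (real J) * (2 / sqrt (real J))"
    proof (intro add_mono mult_left_mono sum_inverse_sqrt_le)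
      have "2 / sqrt (real J) - 2 / sqrt (real (J + (M - J))) \<le> 2 / sqrt (real J)" by simp
      then show "(\<Sum>k=Suc J..J + (M - J). 1 / (real k * sqrt (real k))) \<le> 2 / sqrt (real J)"
        using sum_inverse_3_2_le[OF that(1), of "M - J"] by linarith
    qed auto
    also have "\<dots> = 4" using that by simp
    finally show ?thesis .
  qed
  have "(\<Sum>k<N. sqrt (real (Suc j) / real (Suc k)) / real (j + k + 1)) =
     (\<Sum>k=1..N. sqrt (real (Suc j) / real k) / real (Suc j + k - 1))"
    by (rule sum.reindex_bij_witness[of _ "\<lambda>k. k - 1" Suc]) auto
  also have "\<dots> \<le> (\<Sum>k=1..max N (Suc j). sqrt (real (Suc j) / real k) / real (Suc j + k - 1))"
    by (intro sum_mono2) auto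
  also have "\<dots> \<le> 4" by (rule *) auto
  finally show ?thesis .
qed

text \<open>
  Schur's test: the arithmetic-geometric mean inequality with weights reduces the double sum to
  the row sums just computed. The constant is not optimal.
\<close>

lemma Hilbert_inequality:
  fixes a b :: "nat \<Rightarrow> real"
  shows "(\<Sum>j<N. \<Sum>k<N. a j * b k / real (j + k + 1)) \<le> 2 * ((\<Sum>j<N. (a j)^2) + (\<Sum>k<N. (b k)^2))"
proof -
  define w where "w j k = sqrt (real (Suc j) / real (Suc k)) / real (j + k + 1)" for j k
  have amgm: "a j * b k / real (j + k + 1) \<le> ((a j)^2 * w j k + (b k)^2 * w k j) / 2" for j k
  proof -
    \<comment> \<open>\<open>a b = (a s) (b / s)\<close>, and squaring turns \<open>s\<close> into the weight of the row sums\<close>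
    define s where "s = sqrt (sqrt (real (Suc j) / real (Suc k)))"
    have s: "s > 0" "s^2 = sqrt (real (Suc j) / real (Suc k))" by (simp_all add: s_def)
    have "0 \<le> (a j * s - b k / s)^2" by simp
    then have "a j * b k \<le> ((a j)^2 * s^2 + (b k)^2 * (1 / s^2)) / 2"
      using s(1) by (simp add: power2_diff power_mult_distrib power_divide)
    moreover have "1 / s^2 = sqrt (real (Suc k) / real (Suc j))"
      unfolding s(2) by (simp add: real_sqrt_divide)
    ultimately have "a j * b k / real (j + k + 1) \<le>
       (((a j)^2 * s^2 + (b k)^2 * sqrt (real (Suc k) / real (Suc j))) / 2) / real (j + k + 1)"
      by (intro divide_right_mono) simp_all
    also have "\<dots> = ((a j)^2 * w j k + (b k)^2 * w k j) / 2"
      by (simp only: w_def s(2) times_divide_eq_right add_divide_distrib divide_divide_eq_left add.commute[of k j] mult.commute)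
    finally show ?thesis .
  qed
  have row: "(\<Sum>j<N. \<Sum>k<N. (c j)^2 * w j k) \<le> 4 * (\<Sum>j<N. (c j)^2)" for c :: "nat \<Rightarrow> real"
  proof -
    have "(\<Sum>j<N. \<Sum>k<N. (c j)^2 * w j k) = (\<Sum>j<N. (c j)^2 * (\<Sum>k<N. w j k))"
      by (simp add: sum_distrib_left)
    also have "\<dots> \<le> (\<Sum>j<N. (c j)^2 * 4)"
      unfolding w_def by (intro sum_mono mult_left_mono Hilbert_kernel_row_sum) simp
    finally show ?thesis by (simp add: sum_distrib_left mult_ac)
  qed
  have "(\<Sum>j<N. \<Sum>k<N. a j * b k / real (j + k + 1)) \<le>
      (\<Sum>j<N. \<Sum>k<N. ((a j)^2 * w j k + (b k)^2 * w k j) / 2)"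
    by (intro sum_mono amgm)
  also have "\<dots> = ((\<Sum>j<N. \<Sum>k<N. (a j)^2 * w j k) + (\<Sum>j<N. \<Sum>k<N. (b k)^2 * w k j)) / 2"
    by (simp add: sum.distrib flip: sum_divide_distrib)
  also have "(\<Sum>j<N. \<Sum>k<N. (b k)^2 * w k j) = (\<Sum>k<N. \<Sum>j<N. (b k)^2 * w k j)"
    by (rule sum.swap)
  finally show ?thesis using row[of a] row[of b] by simp
qed

lemma sum_triangle_le_square:
  fixes g :: "nat \<Rightarrow> nat \<Rightarrow> real"
  assumes "\<And>j k. g j k \<ge> 0"
  shows "(\<Sum>n<N. \<Sum>j\<le>n. g j (n - j)) \<le> (\<Sum>j<N. \<Sum>k<N. g j k)"
proof -
  have "(\<Sum>n<N. \<Sum>j\<le>n. g j (n - j)) = (\<Sum>(n, j)\<in>(SIGMA n:{..<N}. {..n}). g j (n - j))"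
    by (rule sum.Sigma) auto
  also have "\<dots> = (\<Sum>(j, k)\<in>{(j, k). j + k < N}. g j k)"
    by (rule sum.reindex_bij_witness[of _ "\<lambda>(j, k). (j + k, j)" "\<lambda>(n, j). (j, n - j)"]) auto
  also have "\<dots> \<le> (\<Sum>(j, k)\<in>{..<N} \<times> {..<N}. g j k)"
    using assms by (intro sum_mono2) auto
  also have "\<dots> = (\<Sum>j<N. \<Sum>k<N. g j k)" by (rule sum.cartesian_product[symmetric])
  finally show ?thesis .
qed

text \<open>
  This is Cauchy's integral formula for the derivatives on the circle of radius \<open>r\<close>.
\<close>

lemma circ_coeff_holomorphic:
  assumes f: "f holomorphic_on ball 0 1" and r: "0 < r" "r < 1"
  shows "circ_coeff (\<lambda>x. f (of_real r * circ x)) (int n) = of_real r ^ n * fps_nth (fps_expansion f 0) n"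
proof -
  have "((\<lambda>u. f u / (u - 0)^(Suc n)) has_contour_integral (2 * of_real pi * \<i> / fact n * (deriv ^^ n) f 0)) (circlepath 0 r)"
    using Cauchy_has_contour_integral_higher_derivative_circlepath[of 0 r f 0 n] r
      holomorphic_on_imp_continuous_on[OF holomorphic_on_subset[OF f, of "cball 0 r"]]
      holomorphic_on_subset[OF f, of "ball 0 r"] by (simp add: cball_subset_ball_iff ball_subset_ball_iff)
  moreover have "circlepath 0 r = (\<lambda>x. of_real r * circ x)"
    by (auto simp: circlepath circ_def cis_conv_exp mult_ac)
  moreover have "vector_derivative (\<lambda>x. of_real r * circ x) (at x) = of_real r * (2 * of_real pi * \<i> * circ x)" for x
    using has_vector_derivative_mult_right[OF circ_has_vector_derivative[of 1 x UNIV], of "of_real r"]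
    by (simp add: vector_derivative_at)
  ultimately have "((\<lambda>x. f (of_real r * circ x) / (of_real r * circ x)^(Suc n) * (of_real r * (2 * of_real pi * \<i> * circ x)))
     has_integral (2 * of_real pi * \<i> / fact n * (deriv ^^ n) f 0)) {0..1}"
    by (simp add: has_contour_integral)
  then have "((\<lambda>x. (of_real r ^ n / (2 * of_real pi * \<i>)) *
       (f (of_real r * circ x) / (of_real r * circ x)^(Suc n) * (of_real r * (2 * of_real pi * \<i> * circ x))))
     has_integral (of_real r ^ n / (2 * of_real pi * \<i>)) * (2 * of_real pi * \<i> / fact n * (deriv ^^ n) f 0)) {0..1}"
    by (rule has_integral_mult_right)
  moreover have "(of_real r ^ n / (2 * of_real pi * \<i>)) *
       (f (of_real r * circ x) / (of_real r * circ x)^(Suc n) * (of_real r * (2 * of_real pi * \<i> * circ x)))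
     = f (of_real r * circ x) * circ (- (of_int (int n) * x))" for x
  proof -
    have "circ (- (of_int (int n) * x)) = 1 / circ x ^ n"
      by (simp add: circ_minus circ_nat_mult inverse_eq_divide)
    then show ?thesis using r by (simp add: power_mult_distrib field_simps)
  qed
  moreover have "(of_real r ^ n / (2 * of_real pi * \<i>)) * (2 * of_real pi * \<i> / fact n * (deriv ^^ n) f 0)
     = of_real r ^ n * fps_nth (fps_expansion f 0) n"
    by (simp add: fps_expansion_def field_simps)
  ultimately show ?thesis
    unfolding circ_coeff_def by (simp only: integral_unique)
qed

text \<open>
  Holomorphic functions with bounded mean squares over the circles of radius \<open>r < 1\<close> form the Hardy space
  \<open>H\<^sup>2\<close>. Bessel's inequality on each circle bounds finitely many coefficients, and \<open>r\<close> tends to \<open>1\<close>.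
\<close>

lemma sum_fps_coeff_square_le:
  assumes f: "f holomorphic_on ball 0 1"
    and B: "\<And>r. 0 < r \<Longrightarrow> r < 1 \<Longrightarrow> integral {0..1} (\<lambda>x. (norm (f (of_real r * circ x)))^2) \<le> B"
  shows "(\<Sum>n<N. (norm (fps_nth (fps_expansion f 0) n))^2) \<le> B"
proof -
  define c where "c n = norm (fps_nth (fps_expansion f 0) n)" for n
  have "(\<Sum>n<N. (r ^ n * c n)^2) \<le> B" if r: "0 < r" "r < 1" for r
  proof -
    have "continuous_on {0..1} (\<lambda>x. f (of_real r * circ x))"
      using r by (intro continuous_on_compose2[OF holomorphic_on_imp_continuous_on[OF f]] continuous_intros)
        (auto simp: norm_mult)
    then have "(\<Sum>n\<in>int ` {..<N}. (norm (circ_coeff (\<lambda>x. f (of_real r * circ x)) n))^2) \<le> B"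
      using B[OF r] by (intro order.trans[OF Bessel_inequality]) auto
    then show ?thesis using r
      by (simp add: sum.reindex circ_coeff_holomorphic[OF f r] norm_mult norm_power c_def)
  qed
  then have "eventually (\<lambda>r. (\<Sum>n<N. (r ^ n * c n)^2) \<le> B) (at_left 1)"
    using eventually_at_left_real[of 0 1] by (auto elim!: eventually_mono)
  moreover have "((\<lambda>r. \<Sum>n<N. (r ^ n * c n)^2) \<longlongrightarrow> (\<Sum>n<N. (1 ^ n * c n)^2)) (at_left 1)"
    by (intro tendsto_intros)
  ultimately have "(\<Sum>n<N. (1 ^ n * c n)^2) \<le> B"
    by (intro tendsto_upperbound) auto
  then show ?thesis by (simp add: c_def)
qed

text \<open>
  Hardy's inequality \<open>\<Sum> |c\<^sub>n| / (n + 1) \<le> C \<parallel>G\<parallel>\<^sub>1\<close> for a function \<open>G\<close> that is given as a product of two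
  functions in \<open>H\<^sup>2\<close>. The coefficients of a product are convolutions, which turns the claim into
  Hilbert's inequality.
\<close>

theorem Hardy_inequality_product:
  assumes f: "f holomorphic_on ball 0 1" and g: "g holomorphic_on ball 0 1"
    and A: "\<And>r. 0 < r \<Longrightarrow> r < 1 \<Longrightarrow> integral {0..1} (\<lambda>x. (norm (f (of_real r * circ x)))^2) \<le> A"
    and B: "\<And>r. 0 < r \<Longrightarrow> r < 1 \<Longrightarrow> integral {0..1} (\<lambda>x. (norm (g (of_real r * circ x)))^2) \<le> B"
  shows "(\<Sum>n<N. norm (fps_nth (fps_expansion f 0 * fps_expansion g 0) n) / real (n + 1)) \<le> 2 * (A + B)"
proof -
  define a where "a n = norm (fps_nth (fps_expansion f 0) n)" for n
  define b where "b n = norm (fps_nth (fps_expansion g 0) n)" for n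
  have "norm (fps_nth (fps_expansion f 0 * fps_expansion g 0) n) / real (n + 1)
      \<le> (\<Sum>j\<le>n. a j * b (n - j) / real (j + (n - j) + 1))" for n
  proof -
    have "norm (fps_nth (fps_expansion f 0 * fps_expansion g 0) n) \<le> (\<Sum>j\<le>n. a j * b (n - j))"
      unfolding fps_mult_nth a_def b_def norm_mult[symmetric] atMost_atLeast0
      by (rule norm_sum)
    then have "norm (fps_nth (fps_expansion f 0 * fps_expansion g 0) n) / real (n + 1)
        \<le> (\<Sum>j\<le>n. a j * b (n - j)) / real (n + 1)"
      by (intro divide_right_mono) auto
    also have "\<dots> = (\<Sum>j\<le>n. a j * b (n - j) / real (j + (n - j) + 1))"
      by (simp add: sum_divide_distrib)
    finally show ?thesis .
  qed
  then have "(\<Sum>n<N. norm (fps_nth (fps_expansion f 0 * fps_expansion g 0) n) / real (n + 1))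
      \<le> (\<Sum>n<N. \<Sum>j\<le>n. a j * b (n - j) / real (j + (n - j) + 1))"
    by (intro sum_mono)
  also have "\<dots> \<le> (\<Sum>j<N. \<Sum>k<N. a j * b k / real (j + k + 1))"
    by (rule sum_triangle_le_square[of "\<lambda>j k. a j * b k / real (j + k + 1)"]) (simp add: a_def b_def)
  also have "\<dots> \<le> 2 * ((\<Sum>j<N. (a j)^2) + (\<Sum>k<N. (b k)^2))"
    by (rule Hilbert_inequality)
  also have "\<dots> \<le> 2 * (A + B)"
    unfolding a_def b_def
    by (intro mult_left_mono add_mono sum_fps_coeff_square_le f g A B) auto
  finally show ?thesis .
qed

section \<open>Integrals over circles of functions of the distance to one\<close>

lemma has_integral_compose_affine:
  fixes w :: "real \<Rightarrow> real"
  assumes "(w has_integral J) {0..1}"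
  shows "((\<lambda>x. w (2 * x)) has_integral J / 2) {0..1/2}"
    and "((\<lambda>x. w (2 * x - 1)) has_integral J / 2) {1/2..1}"
    and "((\<lambda>x. w (2 - 2 * x)) has_integral J / 2) {1/2..1}"
proof -
  have w: "(w has_integral J) (cbox 0 1)" using assms by simp
  show "((\<lambda>x. w (2 * x)) has_integral J / 2) {0..1/2}"
    using has_integral_affinity[OF w, of 2 0] by (simp add: image_affinity_atLeastAtMost)
  show "((\<lambda>x. w (2 * x - 1)) has_integral J / 2) {1/2..1}"
    using has_integral_affinity[OF w, of 2 "- 1"]
    by (simp add: image_affinity_atLeastAtMost[of "1/2" "1/2" 0 1, simplified])
  show "((\<lambda>x. w (2 - 2 * x)) has_integral J / 2) {1/2..1}"
    using has_integral_affinity[OF w, of "- 2" 2]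
    by (simp add: image_affinity_atLeastAtMost[of "- (1/2)" "1" 0 1, simplified])
qed

lemma has_integral_two_halves:
  fixes f g :: "real \<Rightarrow> real"
  assumes "(f has_integral J / 2) {0..1/2}" "(g has_integral J / 2) {1/2..1}"
  shows "((\<lambda>x. if x \<le> 1/2 then f x else g x) has_integral J) {0..1}"
proof -
  have "((\<lambda>x. if x \<le> 1/2 then f x else g x) has_integral J / 2) {0..1/2}"
    by (rule has_integral_spike_finite[OF _ _ assms(1), of "{}"]) auto
  moreover have "((\<lambda>x. if x \<le> 1/2 then f x else g x) has_integral J / 2) {1/2..1}"
    by (rule has_integral_spike_finite[OF _ _ assms(2), of "{1/2}"]) auto
  ultimately show ?thesis
    using has_integral_combine[of 0 "1/2" 1 _ "J/2" "J/2"] by simp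
qed

lemma Jordan_sin_inequality:
  fixes x :: real
  assumes "0 \<le> x" "x \<le> pi / 2"
  shows "2 / pi * x \<le> sin x"
proof -
  have "concave_on {0..pi/2} (sin :: real \<Rightarrow> real)"
  proof (rule f''_le0_imp_concave)
    show "DERIV sin y :> cos y" "DERIV cos y :> - sin y" for y :: real
      by (auto intro!: derivative_eq_intros)
    show "- sin y \<le> 0" if "y \<in> {0..pi/2}" for y :: real
      using that sin_ge_zero[of y] by auto
  qed simp
  then have "(1 - 2 * x / pi) * sin 0 + (2 * x / pi) * sin (pi / 2)
      \<le> sin ((1 - 2 * x / pi) *\<^sub>R 0 + (2 * x / pi) *\<^sub>R (pi / 2))"
    using assms by (intro concave_onD[of _ _ "2 * x / pi" 0 "pi / 2"]) (auto simp: field_simps)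
  then show ?thesis by simp
qed

text \<open>
  For acute angles the distance is at least that of \<open>1\<close> to the line through the point and the origin,
  which is the sine of the angle; for obtuse angles the real part alone suffices. The bound is
  piecewise linear so that integrals of decreasing functions of the distance reduce to integrals
  over the unit interval.
\<close>

lemma norm_one_minus_circ_ge:
  assumes r: "0 \<le> r" "r \<le> 1" and x: "0 \<le> x" "x \<le> 1"
  shows "norm (1 - of_real r * circ x) \<ge> (if x \<le> 1/2 then 2 * x else 2 - 2 * x)"
proof -
  have *: "2 * x \<le> norm (1 - of_real r * circ x)" if "0 \<le> x" "x \<le> 1/2" for x
  proof (cases "x \<le> 1/4")
    case True
    have "2 * x \<le> 2 / pi * (2 * pi * x)" using that by simp
    also have "\<dots> \<le> sin (2 * pi * x)"
      using that True by (intro Jordan_sin_inequality) auto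
    also have "sin (2 * pi * x) = \<bar>Im (circ x)\<bar>"
      using that sin_ge_zero[of "2 * pi * x"] by (simp add: circ_def)
    also have "\<dots> = \<bar>Im (cnj (circ x) * (of_real r * circ x - 1))\<bar>"
    proof -
      have "cnj (circ x) * circ x = 1"
        by (simp add: circ_def cis_cnj cis_mult)
      then have "cnj (circ x) * (of_real r * circ x - 1) = of_real r - cnj (circ x)"
        by (simp add: algebra_simps)
      then show ?thesis by simp
    qed
    also have "\<dots> \<le> norm (cnj (circ x) * (of_real r * circ x - 1))"
      by (rule abs_Im_le_cmod)
    also have "\<dots> = norm (1 - of_real r * circ x)"
      by (simp add: norm_mult norm_minus_commute)
    finally show ?thesis .
  next
    case False
    have "cos (2 * pi * x) \<le> cos (pi / 2)"
      using that False by (intro cos_monotone_0_pi_le) auto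
    then have "1 \<le> Re (1 - of_real r * circ x)"
      using r by (simp add: circ_def mult_nonneg_nonpos)
    also have "\<dots> \<le> norm (1 - of_real r * circ x)" by (rule complex_Re_le_cmod)
    finally show ?thesis using that by simp
  qed
  show ?thesis
  proof (cases "x \<le> 1/2")
    case False
    have "1 - of_real r * circ x = cnj (1 - of_real r * circ (1 - x))"
      using circ_add[of 1 "- x"] circ_of_int[of 1] by (simp add: cnj_circ)
    then have "norm (1 - of_real r * circ x) = norm (1 - of_real r * circ (1 - x))"
      by (simp only: complex_mod_cnj)
    then show ?thesis using *[of "1 - x"] False x by simp
  qed (use * x in simp)
qed

lemma integral_circle_le:
  fixes h :: "real \<Rightarrow> real" and w :: "real \<Rightarrow> real"
  assumes w: "(w has_integral J) {0..1}" and h: "continuous_on {0..1} h" and r: "0 \<le> r" "r \<le> 1"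
    and anti: "\<And>x y. 0 < x \<Longrightarrow> x \<le> y \<Longrightarrow> w y \<le> w x"
    and le: "\<And>x. 0 < x \<Longrightarrow> x < 1 \<Longrightarrow> h x \<le> K * w (norm (1 - of_real r * circ x))"
    and K: "0 \<le> K"
  shows "integral {0..1} h \<le> K * J"
proof -
  define v where "v x = (if x \<le> 1/2 then w (2 * x) else w (2 - 2 * x))" for x
  have "(v has_integral J) {0..1}"
    unfolding v_def by (intro has_integral_two_halves has_integral_compose_affine w)
  then have "((\<lambda>x. K * v x) has_integral K * J) {0..1}"
    by (rule has_integral_mult_right)
  \<comment> \<open>\<open>w\<close> may have an integrable singularity at \<open>0\<close>, where the comparison fails\<close>
  then have v: "((\<lambda>x. if x \<in> {0, 1} then h x else K * v x) has_integral K * J) {0..1}"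
    by (rule has_integral_spike_finite[rotated 2, of _ _ _ "{0, 1}"]) auto
  have "(h has_integral integral {0..1} h) {0..1}"
    by (intro integrable_integral integrable_continuous_real h)
  then show ?thesis
  proof (rule has_integral_le[OF _ v])
    fix x :: real assume x: "x \<in> {0..1}"
    show "h x \<le> (if x \<in> {0, 1} then h x else K * v x)"
    proof (cases "x \<in> {0, 1}")
      case False
      then have x: "0 < x" "x < 1" using x by auto
      note le[OF x]
      also have "K * w (norm (1 - of_real r * circ x)) \<le> K * v x"
        using norm_one_minus_circ_ge[OF r, of x] x
        by (intro mult_left_mono K) (auto simp: v_def intro!: anti)
      finally show ?thesis using False by simp
    qed simp
  qed
qed

text \<open>
  The same for the distance of \<open>z\<^sup>2\<close> to \<open>1\<close>: as \<open>z\<close> runs once through its circle, \<open>z\<^sup>2\<close> runs twice through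
  the circle of radius \<open>r\<^sup>2\<close>.
\<close>

lemma integral_circle_double_le:
  fixes h :: "real \<Rightarrow> real" and w :: "real \<Rightarrow> real"
  assumes w: "(w has_integral J) {0..1}" and h: "continuous_on {0..1} h" and r: "0 \<le> r" "r \<le> 1"
    and anti: "\<And>x y. 0 < x \<Longrightarrow> x \<le> y \<Longrightarrow> w y \<le> w x"
    and le: "\<And>x. 0 < x \<Longrightarrow> x < 1 \<Longrightarrow> x \<noteq> 1/2 \<Longrightarrow> h x \<le> K * w (norm (1 - (of_real r * circ x)^2))"
    and K: "0 \<le> K"
  shows "integral {0..1} h \<le> K * J"
proof -
  define v where "v x = (if x \<le> 1/2 then w (2 * x) else w (2 - 2 * x))" for x
  define v2 where "v2 x = (if x \<le> 1/2 then v (2 * x) else v (2 * x - 1))" for x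
  have "(v has_integral J) {0..1}"
    unfolding v_def by (intro has_integral_two_halves has_integral_compose_affine w)
  then have "(v2 has_integral J) {0..1}"
    unfolding v2_def by (intro has_integral_two_halves has_integral_compose_affine)
  then have "((\<lambda>x. K * v2 x) has_integral K * J) {0..1}"
    by (rule has_integral_mult_right)
  then have v: "((\<lambda>x. if x \<in> {0, 1/2, 1} then h x else K * v2 x) has_integral K * J) {0..1}"
    by (rule has_integral_spike_finite[rotated 2, of _ _ _ "{0, 1/2, 1}"]) auto
  have r2: "0 \<le> r^2" "r^2 \<le> 1" using r by (auto simp: power_le_one)
  have v_ge: "w (norm (1 - of_real (r^2) * circ y)) \<le> v y" if "0 < y" "y < 1" for y
    using norm_one_minus_circ_ge[OF r2, of y] that by (auto simp: v_def intro!: anti)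
  have "(h has_integral integral {0..1} h) {0..1}"
    by (intro integrable_integral integrable_continuous_real h)
  then show ?thesis
  proof (rule has_integral_le[OF _ v])
    fix x :: real assume x: "x \<in> {0..1}"
    show "h x \<le> (if x \<in> {0, 1/2, 1} then h x else K * v2 x)"
    proof (cases "x \<in> {0, 1/2, 1}")
      case False
      then have x: "0 < x" "x < 1" "x \<noteq> 1/2" using x by auto
      have sq: "(of_real r * circ x)^2 = of_real (r^2) * circ (2 * x)"
        using circ_nat_mult[of 2 x] by (simp add: power_mult_distrib)
      have per: "circ (2 * x) = circ (2 * x - 1)"
        using circ_add[of "2 * x" "- 1"] circ_of_int[of "-1"] by simp
      have "w (norm (1 - (of_real r * circ x)^2)) \<le> v2 x"
      proof (cases "x \<le> 1/2")
        case True
        then show ?thesis using v_ge[of "2 * x"] x unfolding sq v2_def by auto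
      next
        case False
        then show ?thesis using v_ge[of "2 * x - 1"] x unfolding sq per v2_def by auto
      qed
      then have "K * w (norm (1 - (of_real r * circ x)^2)) \<le> K * v2 x"
        by (intro mult_left_mono K)
      then show ?thesis using False le[OF x] by auto
    qed simp
  qed
qed

lemma stretched_exp_integral:
  fixes \<alpha> s :: real
  assumes "0 < \<alpha>" "0 < s"
  shows "((\<lambda>y. y powr (\<alpha> - 1) * exp (- s * y powr \<alpha>)) has_integral (1 - exp (- s)) / (\<alpha> * s)) {0..1}"
proof -
  define F where "F y = - exp (- s * y powr \<alpha>) / (\<alpha> * s)" for y
  have "((\<lambda>y. y powr (\<alpha> - 1) * exp (- s * y powr \<alpha>)) has_integral F 1 - F 0) {0..1}"
  proof (rule fundamental_theorem_of_calculus_interior)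
    show "continuous_on {0..1} F"
      unfolding F_def using assms by (intro continuous_intros continuous_on_powr') auto
    fix y :: real assume "y \<in> {0<..<1}"
    then have "(F has_real_derivative y powr (\<alpha> - 1) * exp (- s * y powr \<alpha>)) (at y)"
      unfolding F_def using assms by (auto intro!: derivative_eq_intros)
    then show "(F has_vector_derivative y powr (\<alpha> - 1) * exp (- s * y powr \<alpha>)) (at y)"
      by (simp add: has_real_derivative_iff_has_vector_derivative)
  qed simp
  moreover have "F 1 - F 0 = (1 - exp (- s)) / (\<alpha> * s)"
    using assms by (simp add: F_def field_simps)
  ultimately show ?thesis by simp
qed

lemma stretched_exp_antimono:
  fixes \<alpha> s x y :: real
  assumes "\<alpha> \<le> 1" "0 \<le> \<alpha>" "0 \<le> s" "0 < x" "x \<le> y"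
  shows "y powr (\<alpha> - 1) * exp (- s * y powr \<alpha>) \<le> x powr (\<alpha> - 1) * exp (- s * x powr \<alpha>)"
  using assms by (intro mult_mono powr_mono2') (auto intro!: mult_left_mono powr_mono2)

section \<open>Holomorphic symbols: orders below one\<close>

lemma powr_of_real_polar:
  assumes "0 \<le> \<rho>" "- pi < \<beta>" "\<beta> \<le> pi"
  shows "(of_real \<rho> * cis \<beta>) powr of_real \<alpha> = of_real (\<rho> powr \<alpha>) * cis (\<alpha> * \<beta>)"
proof (cases "\<rho> = 0")
  case False
  then have \<rho>: "\<rho> > 0" using assms by simp
  have "Ln (of_real \<rho> * cis \<beta>) = Complex (ln \<rho>) \<beta>"
    using \<rho> assms by (intro Ln_unique) (auto simp: exp_eq_polar exp_of_real)
  then show ?thesis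
    using \<rho> by (simp add: powr_def exp_eq_polar exp_of_real)
qed simp

lemma abs_less_pi_half_if_cos_pos:
  assumes "\<bar>x\<bar> < pi" "0 < cos x"
  shows "\<bar>x\<bar> < pi / 2"
proof (rule ccontr)
  assume "\<not> ?thesis"
  then have "cos \<bar>x\<bar> \<le> cos (pi / 2)" using assms by (intro cos_monotone_0_pi_le) auto
  then show False using assms by simp
qed

text \<open>
  For \<open>\<kappa> = 0\<close> this is \<open>exp w\<close>, the semigroup; for \<open>\<kappa> = 1\<close> it is \<open>w exp w\<close>, which gives the analyticity
  estimate. The derivative is \<open>(1 + \<kappa> w) exp w\<close> in both cases, so that one estimate serves for both.
\<close>

definition expk :: "complex \<Rightarrow> complex \<Rightarrow> complex" where
  "expk \<kappa> w = (1 - \<kappa> + \<kappa> * w) * exp w"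

lemma expk_has_field_derivative [derivative_intros]:
  assumes "(u has_field_derivative u') (at z within S)"
  shows "((\<lambda>z. expk \<kappa> (u z)) has_field_derivative ((1 + \<kappa> * u z) * exp (u z)) * u') (at z within S)"
  unfolding expk_def
  by (rule derivative_eq_intros assms refl | simp add: algebra_simps)+

lemma continuous_on_expk [continuous_intros]:
  "continuous_on S u \<Longrightarrow> continuous_on S (\<lambda>z. expk \<kappa> (u z))"
  unfolding expk_def by (intro continuous_intros)

text \<open>
  Half of the available exponential decay absorbs the linear factor, since \<open>x \<le> exp x\<close>.
\<close>

lemma norm_linear_times_exp_half_le:
  assumes "Re w \<le> - (c * \<tau>)" "norm w \<le> L * \<tau>" "0 \<le> \<tau>" "0 < c" "0 \<le> L" "norm a \<le> 1" "norm \<kappa> \<le> 1"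
  shows "norm ((a + \<kappa> * w) * exp (w / 2)) \<le> (1 + 4 * L / c) * exp (- (c * \<tau> / 4))"
proof -
  have "norm (a + \<kappa> * w) \<le> norm a + norm \<kappa> * norm w"
    by (metis norm_triangle_ineq norm_mult)
  also have "\<dots> \<le> 1 + 1 * (L * \<tau>)"
    using assms by (intro add_mono mult_mono) auto
  also have "\<dots> = 1 + (4 * L / c) * (c * \<tau> / 4)"
    using assms by simp
  also have "\<dots> \<le> 1 * exp (c * \<tau> / 4) + (4 * L / c) * exp (c * \<tau> / 4)"
  proof (intro add_mono mult_left_mono)
    have "0 \<le> c * \<tau> / 4" using assms by simp
    then show "1 \<le> 1 * exp (c * \<tau> / 4)" "c * \<tau> / 4 \<le> exp (c * \<tau> / 4)"
      using exp_ge_add_one_self[of "c * \<tau> / 4"] by linarith+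
  qed (use assms in auto)
  finally have 1: "norm (a + \<kappa> * w) \<le> (1 + 4 * L / c) * exp (c * \<tau> / 4)"
    by (simp add: distrib_right)
  have "norm (exp (w / 2)) \<le> exp (- (c * \<tau> / 2))"
    using assms(1) by simp
  with 1 have "norm ((a + \<kappa> * w) * exp (w / 2)) \<le> ((1 + 4 * L / c) * exp (c * \<tau> / 4)) * exp (- (c * \<tau> / 2))"
    unfolding norm_mult using assms by (intro mult_mono) auto
  also have "\<dots> = (1 + 4 * L / c) * exp (- (c * \<tau> / 4))"
    by (simp add: mult.assoc flip: exp_add)
  finally show ?thesis .
qed

text \<open>
  The function \<open>\<Phi>\<close> with \<open>\<phi>\<^sub>h(k) = h\<^sup>-\<^sup>\<alpha> \<Phi>(exp (\<i> k h))\<close> for \<open>\<alpha> < 1\<close>.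
\<close>

definition symbol_lt1 :: "real \<Rightarrow> complex \<Rightarrow> complex" where
  "symbol_lt1 \<alpha> z = of_real (2 powr - \<alpha>) * (1 - z^2) powr of_real \<alpha> - 2 * (1 - z) powr of_real \<alpha>"

lemma Re_one_minus_pos:
  assumes "norm z < 1" shows "0 < Re (1 - z)" "0 < Re (1 + z)" "0 < Re (1 - z^2)"
proof -
  have *: "0 < Re (1 - w)" if "norm w < 1" for w
    using abs_Re_le_cmod[of w] that by simp
  show "0 < Re (1 - z)" "0 < Re (1 + z)" "0 < Re (1 - z^2)"
    using *[of z] *[of "- z"] *[of "z^2"] assms
    by (auto simp: norm_power power_less_one_iff abs_square_less_1)
qed

text \<open>
  Let \<open>\<beta>\<close> and \<open>\<gamma>\<close> be the arguments of \<open>1 - z\<close> and \<open>1 + z\<close>. Because \<open>|1 + z| \<le> 2\<close>, the claim reduces to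
  \<open>cos (\<alpha> \<pi>/2) \<le> 2 cos (\<alpha> \<beta>) - cos (\<alpha> (\<beta> + \<gamma>))\<close>. The addition theorem bounds the right-hand side
  below by \<open>cos (\<alpha> (\<beta> - \<gamma>))\<close>, and \<open>\<beta> - \<gamma>\<close> is the argument of \<open>(1 - z) / (1 + z)\<close>, a point of the
  right half-plane.
\<close>

lemma Re_symbol_lt1_le:
  assumes \<alpha>: "0 < \<alpha>" "\<alpha> < 1" and z: "norm z < 1"
  shows "Re (symbol_lt1 \<alpha> z) \<le> - (cos (\<alpha> * pi / 2) * norm (1 - z) powr \<alpha>)"
proof -
  define \<rho> \<beta> where "\<rho> = norm (1 - z)" and "\<beta> = Im (Ln (1 - z))"
  define \<sigma> \<gamma> where "\<sigma> = norm (1 + z)" and "\<gamma> = Im (Ln (1 + z))"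
  note pos = Re_one_minus_pos[OF z]
  have polar: "w = of_real (norm w) * cis (Im (Ln w))" if "0 < Re w" for w
  proof -
    have "w \<noteq> 0" using that by auto
    moreover have "exp (Ln w) = of_real (exp (Re (Ln w))) * cis (Im (Ln w))"
      by (simp only: exp_eq_polar exp_of_real)
    ultimately show ?thesis by simp
  qed
  have \<rho>\<beta>: "1 - z = of_real \<rho> * cis \<beta>" and \<sigma>\<gamma>: "1 + z = of_real \<sigma> * cis \<gamma>"
    unfolding \<rho>_def \<beta>_def \<sigma>_def \<gamma>_def by (intro polar pos)+
  have "1 - z \<noteq> 0" "1 + z \<noteq> 0" using pos by (metis less_irrefl zero_complex.simps(1))+
  then have "\<rho> > 0" "\<sigma> > 0" by (simp_all add: \<rho>_def \<sigma>_def)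
  have small: "\<bar>\<beta>\<bar> < pi / 2" "\<bar>\<gamma>\<bar> < pi / 2"
    unfolding \<beta>_def \<gamma>_def by (intro Re_Ln_pos_lt_imp pos)+
  \<comment> \<open>no branch is crossed: \<open>\<beta> + \<gamma>\<close> is the principal argument of \<open>1 - z\<^sup>2\<close>, which has positive real part\<close>
  have sq: "1 - z^2 = of_real (\<rho> * \<sigma>) * cis (\<beta> + \<gamma>)"
  proof -
    have "1 - z^2 = (1 - z) * (1 + z)" by algebra
    then show ?thesis unfolding \<rho>\<beta> \<sigma>\<gamma> by (simp add: cis_mult[symmetric])
  qed
  have plus: "\<bar>\<beta> + \<gamma>\<bar> < pi / 2"
  proof (rule abs_less_pi_half_if_cos_pos)
    have "0 < (\<rho> * \<sigma>) * cos (\<beta> + \<gamma>)" using pos(3) unfolding sq by simp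
    then show "0 < cos (\<beta> + \<gamma>)"
      by (rule zero_less_mult_pos) (use \<open>\<rho> > 0\<close> \<open>\<sigma> > 0\<close> in simp)
  qed (use small in auto)
  have minus: "\<bar>\<beta> - \<gamma>\<bar> < pi / 2"
  proof (rule abs_less_pi_half_if_cos_pos)
    have "(1 - z) * cnj (1 + z) = of_real (\<rho> * \<sigma>) * cis (\<beta> - \<gamma>)"
      unfolding \<rho>\<beta> \<sigma>\<gamma> by (simp add: cis_cnj cis_mult)
    moreover have "Re ((1 - z) * cnj (1 + z)) = 1 - (norm z)^2"
      unfolding cmod_power2 by (simp add: power2_eq_square algebra_simps)
    ultimately have "(\<rho> * \<sigma>) * cos (\<beta> - \<gamma>) = 1 - (norm z)^2" by simp
    moreover have "(norm z)^2 < 1" using z by (simp add: abs_square_less_1)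
    ultimately have "0 < (\<rho> * \<sigma>) * cos (\<beta> - \<gamma>)" by simp
    then show "0 < cos (\<beta> - \<gamma>)"
      by (rule zero_less_mult_pos) (use \<open>\<rho> > 0\<close> \<open>\<sigma> > 0\<close> in simp)
  qed (use small in auto)
  have "Re (symbol_lt1 \<alpha> z) = 2 powr - \<alpha> * (\<rho> * \<sigma>) powr \<alpha> * cos (\<alpha> * (\<beta> + \<gamma>)) - 2 * (\<rho> powr \<alpha> * cos (\<alpha> * \<beta>))"
    unfolding symbol_lt1_def sq unfolding \<rho>\<beta>
    using small plus \<open>\<rho> > 0\<close> \<open>\<sigma> > 0\<close> by (simp add: powr_of_real_polar del: of_real_mult)
  also have "2 powr - \<alpha> * (\<rho> * \<sigma>) powr \<alpha> = \<rho> powr \<alpha> * (\<sigma> / 2) powr \<alpha>"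
    using \<open>\<rho> > 0\<close> \<open>\<sigma> > 0\<close> by (simp add: powr_mult powr_divide powr_minus field_simps)
  also have "\<rho> powr \<alpha> * (\<sigma> / 2) powr \<alpha> * cos (\<alpha> * (\<beta> + \<gamma>)) \<le> \<rho> powr \<alpha> * 1 * cos (\<alpha> * (\<beta> + \<gamma>))"
  proof (intro mult_right_mono mult_left_mono)
    have "\<sigma> \<le> 2" unfolding \<sigma>_def using norm_triangle_ineq[of 1 z] z by simp
    then show "(\<sigma> / 2) powr \<alpha> \<le> 1" using \<open>\<sigma> > 0\<close> \<alpha> by (simp add: powr_le1)
    have "\<bar>\<alpha> * (\<beta> + \<gamma>)\<bar> \<le> 1 * (pi / 2)"
      unfolding abs_mult using \<alpha> plus by (intro mult_mono) auto
    then show "0 \<le> cos (\<alpha> * (\<beta> + \<gamma>))" by (intro cos_ge_zero) auto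
  qed auto
  also have "\<rho> powr \<alpha> * 1 * cos (\<alpha> * (\<beta> + \<gamma>)) - 2 * (\<rho> powr \<alpha> * cos (\<alpha> * \<beta>))
      = - (\<rho> powr \<alpha> * (2 * cos (\<alpha> * \<beta>) - cos (\<alpha> * (\<beta> + \<gamma>))))"
    by (simp add: algebra_simps)
  also have "\<dots> \<le> - (\<rho> powr \<alpha> * cos (\<alpha> * (pi / 2)))"
  proof -
    have "cos (\<alpha> * (pi / 2)) \<le> cos \<bar>\<alpha> * (\<beta> - \<gamma>)\<bar>"
    proof (intro cos_monotone_0_pi_le)
      show "\<bar>\<alpha> * (\<beta> - \<gamma>)\<bar> \<le> \<alpha> * (pi / 2)"
        unfolding abs_mult using \<alpha> minus by (simp add: mult_left_mono)
      have "\<alpha> * (pi / 2) \<le> 1 * (pi / 2)" using \<alpha> by (intro mult_right_mono) auto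
      then show "\<alpha> * (pi / 2) \<le> pi" using pi_gt_zero by linarith
    qed auto
    moreover have "cos (\<alpha> * (\<beta> - \<gamma>)) + cos (\<alpha> * (\<beta> + \<gamma>)) \<le> 2 * cos (\<alpha> * \<beta>)"
    proof -
      have "\<bar>\<alpha> * \<beta>\<bar> \<le> 1 * (pi / 2)"
        unfolding abs_mult using \<alpha> small by (intro mult_mono) auto
      then have "0 \<le> cos (\<alpha> * \<beta>)" by (intro cos_ge_zero) auto
      then have "cos (\<alpha> * \<beta>) * cos (\<alpha> * \<gamma>) \<le> cos (\<alpha> * \<beta>) * 1"
        by (intro mult_left_mono) auto
      then show ?thesis by (simp add: distrib_left right_diff_distrib cos_add cos_diff)
    qed
    ultimately have "cos (\<alpha> * (pi / 2)) \<le> 2 * cos (\<alpha> * \<beta>) - cos (\<alpha> * (\<beta> + \<gamma>))" by simp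
    then show ?thesis by (simp add: mult_left_mono)
  qed
  finally show ?thesis by (simp add: \<rho>_def mult_ac)
qed

lemma norm_one_minus_square_le:
  fixes z :: complex
  assumes "norm z \<le> 1" shows "norm (1 - z^2) \<le> 2 * norm (1 - z)"
proof -
  have "1 - z^2 = (1 + z) * (1 - z)" by algebra
  moreover have "norm (1 + z) \<le> 2" using norm_triangle_ineq[of 1 z] assms by simp
  ultimately show ?thesis by (simp add: norm_mult mult_right_mono)
qed

lemma powr_norm_one_minus_square_le:
  fixes z :: complex
  assumes "norm z \<le> 1" "0 \<le> p"
  shows "2 powr - p * norm (1 - z^2) powr p \<le> norm (1 - z) powr p"
proof -
  have "norm (1 - z^2) powr p \<le> (2 * norm (1 - z)) powr p"
    using assms norm_one_minus_square_le[of z] by (intro powr_mono2) auto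
  then show ?thesis by (simp add: powr_mult powr_minus field_simps)
qed

lemma norm_powr_of_real: "norm (w powr of_real p) = norm w powr p" for w :: complex
  by (simp add: norm_powr_real_powr')

lemma norm_symbol_lt1_le:
  assumes "0 < \<alpha>" "norm z \<le> 1"
  shows "norm (symbol_lt1 \<alpha> z) \<le> 3 * norm (1 - z) powr \<alpha>"
proof -
  have "norm (symbol_lt1 \<alpha> z) \<le> 2 powr - \<alpha> * norm (1 - z^2) powr \<alpha> + 2 * norm (1 - z) powr \<alpha>"
    unfolding symbol_lt1_def
    by (rule order.trans[OF norm_triangle_ineq4]) (simp add: norm_mult norm_powr_of_real)
  then show ?thesis using powr_norm_one_minus_square_le[of z \<alpha>] assms by simp
qed

lemma not_nonpos_if_Re_pos: "0 < Re w \<Longrightarrow> w \<notin> \<real>\<^sub>\<le>\<^sub>0"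
  by (auto simp: complex_nonpos_Reals_iff)

lemma one_minus_powr_has_field_derivative:
  fixes z :: complex
  shows "1 - z \<notin> \<real>\<^sub>\<le>\<^sub>0 \<Longrightarrow> ((\<lambda>z. (1 - z) powr p) has_field_derivative
      p * (1 - z) powr (p - 1) * (- 1)) (at z)" (is "_ \<Longrightarrow> ?A")
    and "1 - z^2 \<notin> \<real>\<^sub>\<le>\<^sub>0 \<Longrightarrow> ((\<lambda>z. (1 - z^2) powr p) has_field_derivative
      p * (1 - z^2) powr (p - 1) * (- (2 * z))) (at z)" (is "_ \<Longrightarrow> ?B")
proof -
  show ?A if "1 - z \<notin> \<real>\<^sub>\<le>\<^sub>0"
    by (rule DERIV_chain2[where g = "\<lambda>z. 1 - z", OF has_field_derivative_powr[OF that]])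
      (auto intro!: derivative_eq_intros)
  show ?B if "1 - z^2 \<notin> \<real>\<^sub>\<le>\<^sub>0"
    by (rule DERIV_chain2[where g = "\<lambda>z. 1 - z^2", OF has_field_derivative_powr[OF that]])
      (auto intro!: derivative_eq_intros)
qed

lemma symbol_lt1_has_field_derivative:
  assumes "norm z < 1"
  shows "(symbol_lt1 \<alpha> has_field_derivative
     2 * of_real \<alpha> * (1 - z) powr of_real (\<alpha> - 1) -
     of_real (2 powr (1 - \<alpha>) * \<alpha>) * (z * (1 - z^2) powr of_real (\<alpha> - 1))) (at z)"
proof -
  note pos = Re_one_minus_pos[OF assms, THEN not_nonpos_if_Re_pos]
  have "(2::real) powr (1 - \<alpha>) = 2 * 2 powr - \<alpha>"
    by (simp add: powr_diff powr_minus field_simps)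
  then have 2: "complex_of_real (2 powr (1 - \<alpha>) * \<alpha>) = 2 * of_real (2 powr - \<alpha>) * of_real \<alpha>"
    by simp
  show ?thesis
    unfolding symbol_lt1_def[abs_def] 2
    by (rule derivative_eq_intros one_minus_powr_has_field_derivative pos refl | simp add: algebra_simps)+
qed

lemma powr_half_square: "(w powr of_real (p / 2))^2 = w powr of_real p" for w :: complex
  by (simp add: power2_eq_square flip: powr_add of_real_add)

lemma continuous_on_symbol_lt1:
  assumes "0 < \<alpha>" shows "continuous_on (cball 0 1) (symbol_lt1 \<alpha>)"
proof -
  have *: "0 \<le> Re (1 - w)" if "norm w \<le> 1" for w :: complex
    using complex_Re_le_cmod[of w] that by simp
  have sq: "norm (w^2) \<le> 1" if "norm w \<le> 1" for w :: complex
    using that by (simp add: norm_power power_le_one)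
  show ?thesis
    unfolding symbol_lt1_def[abs_def] using assms *[OF sq] *
    by (intro continuous_intros) (auto simp del: minus_complex.simps)
qed

text \<open>
  The derivative of \<open>F = expk \<kappa> (t \<Phi>)\<close> is a combination of \<open>P1 Q1\<close> and \<open>P2 Q2\<close>: the factor
  \<open>(1 - z)\<^sup>\<alpha>\<^sup>-\<^sup>1\<close>, respectively \<open>(1 - z\<^sup>2)\<^sup>\<alpha>\<^sup>-\<^sup>1\<close>, is split into its square roots \<open>g1\<close>, respectively \<open>g2\<close>,
  and the exponential is split evenly. All four functions have mean squares over
  circles bounded by a multiple of \<open>(1 - exp (- s)) / s\<close>, with \<open>s\<close> a multiple of \<open>t\<close>. Since the coefficients of \<open>F'\<close> are
  \<open>n c\<^sub>n\<close>, Hardy's inequality yields \<open>\<Sum> |c\<^sub>n|\<close> over \<open>n \<ge> 1\<close>. The factor \<open>t\<close> in \<open>F'\<close> makes the bound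
  \<open>1 - exp (- s)\<close>, which is at most \<open>min 1 t\<close>: constant for large \<open>t\<close> and linear for small \<open>t\<close>.
\<close>

theorem symbol_lt1_semigroup_coeffs:
  assumes \<alpha>: "0 < \<alpha>" "\<alpha> < 1"
  obtains C where "0 \<le> C"
    "\<And>t \<kappa> N. 0 < t \<Longrightarrow> \<kappa> \<in> {0, 1} \<Longrightarrow>
      (\<Sum>n<N. norm (fps_nth (fps_expansion (\<lambda>z. expk \<kappa> (of_real t * symbol_lt1 \<alpha> z)) 0) (Suc n))) \<le> C * min 1 t"
proof -
  define c0 where "c0 = cos (\<alpha> * pi / 2)"
  have "0 < \<alpha> * pi" "\<alpha> * pi < 1 * pi"
    using \<alpha> by (simp_all del: mult_1)
  then have "- (pi / 2) < \<alpha> * pi / 2" "\<alpha> * pi / 2 < pi / 2"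
    using pi_gt_zero by linarith+
  then have c0: "0 < c0" "c0 \<le> 1"
    unfolding c0_def by (auto intro: cos_gt_zero_pi)
  define K where "K = 1 + 4 * 3 / c0"
  have K: "K \<ge> 0" using c0 by (simp add: K_def)
  show ?thesis
  proof (rule that[of "64 * K^2 / c0"])
    show "0 \<le> 64 * K^2 / c0" using c0 by simp
    fix t :: real and \<kappa> :: complex and N :: nat
    assume t: "0 < t" and \<kappa>: "\<kappa> \<in> {0, 1}"
    define u where "u z = of_real t * symbol_lt1 \<alpha> z" for z :: complex
    define A where "A z = exp (u z / 2)" for z :: complex
    define B where "B z = (1 + \<kappa> * u z) * exp (u z / 2)" for z :: complex
    define g1 where "g1 z = (1 - z) powr of_real ((\<alpha> - 1) / 2)" for z :: complex
    define g2 where "g2 z = (1 - z^2) powr of_real ((\<alpha> - 1) / 2)" for z :: complex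
    define P1 where "P1 z = g1 z * A z" for z :: complex
    define Q1 where "Q1 z = g1 z * B z" for z :: complex
    define P2 where "P2 z = z * g2 z * A z" for z :: complex
    define Q2 where "Q2 z = g2 z * B z" for z :: complex
    define F where "F = (\<lambda>z. expk \<kappa> (u z))"
    have hol_u: "u holomorphic_on ball 0 1"
      unfolding u_def
      by (intro holomorphic_intros holomorphic_onI)
        (use symbol_lt1_has_field_derivative in \<open>auto simp: field_differentiable_def intro: has_field_derivative_at_within\<close>)
    have hol: "P1 holomorphic_on ball 0 1" "Q1 holomorphic_on ball 0 1"
      "P2 holomorphic_on ball 0 1" "Q2 holomorphic_on ball 0 1" "F holomorphic_on ball 0 1"
      unfolding P1_def Q1_def P2_def Q2_def F_def A_def B_def g1_def g2_def expk_def
      by (intro holomorphic_intros hol_u;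
          use Re_one_minus_pos[THEN not_nonpos_if_Re_pos] in simp)+
    have DF: "(F has_field_derivative of_real (2 * \<alpha> * t) * (P1 z * Q1 z) -
        of_real (2 powr (1 - \<alpha>) * \<alpha> * t) * (P2 z * Q2 z)) (at z)" if z: "z \<in> ball 0 1" for z
    proof -
      have g_sq: "(g1 z)^2 = (1 - z) powr of_real (\<alpha> - 1)" "(g2 z)^2 = (1 - z^2) powr of_real (\<alpha> - 1)"
        unfolding g1_def g2_def by (rule powr_half_square)+
      have AB: "A z * B z = (1 + \<kappa> * u z) * exp (u z)"
        unfolding A_def B_def by (simp add: mult_ac flip: exp_add)
      have "(F has_field_derivative ((1 + \<kappa> * u z) * exp (u z)) * (of_real t *
         (2 * of_real \<alpha> * (1 - z) powr of_real (\<alpha> - 1) -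
          of_real (2 powr (1 - \<alpha>) * \<alpha>) * (z * (1 - z^2) powr of_real (\<alpha> - 1))))) (at z)"
        unfolding F_def u_def using z
        by (intro expk_has_field_derivative DERIV_cmult symbol_lt1_has_field_derivative) simp
      also have "((1 + \<kappa> * u z) * exp (u z)) * (of_real t *
         (2 * of_real \<alpha> * (1 - z) powr of_real (\<alpha> - 1) -
          of_real (2 powr (1 - \<alpha>) * \<alpha>) * (z * (1 - z^2) powr of_real (\<alpha> - 1)))) =
        of_real (2 * \<alpha> * t) * (P1 z * Q1 z) - of_real (2 powr (1 - \<alpha>) * \<alpha> * t) * (P2 z * Q2 z)"
        unfolding AB[symmetric] P1_def Q1_def P2_def Q2_def g_sq[symmetric]
        by (simp add: algebra_simps power2_eq_square)
      finally show ?thesis .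
    qed
    \<comment> \<open>the decay that remains in both kernels: a factor \<open>2\<close> is lost in \<open>expk\<close>, another one in passing
      from \<open>|1 - z|\<^sup>\<alpha>\<close> to \<open>|1 - z\<^sup>2|\<^sup>\<alpha>\<close>\<close>
    define s where "s = c0 * t / 4"
    have s: "0 < s" "s \<le> t" using c0 t by (auto simp: s_def field_simps intro: mult_mono)
    define w where "w y = y powr (\<alpha> - 1) * exp (- s * y powr \<alpha>)" for y
    define J where "J = (1 - exp (- s)) / (\<alpha> * s)"
    have w_int: "(w has_integral J) {0..1}"
      unfolding w_def[abs_def] J_def by (rule stretched_exp_integral[OF \<alpha>(1) s(1)])
    have w_anti: "w y \<le> w x" if "0 < x" "x \<le> y" for x y
      unfolding w_def using that s \<alpha> by (intro stretched_exp_antimono) auto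
    have AB_le: "(norm (A z))^2 \<le> K^2 * exp (- (2 * s * norm (1 - z) powr \<alpha>))"
       "(norm (B z))^2 \<le> K^2 * exp (- (2 * s * norm (1 - z) powr \<alpha>))" if z: "norm z < 1" for z
    proof -
      define \<tau> where "\<tau> = t * norm (1 - z) powr \<alpha>"
      have u_le: "Re (u z) \<le> - (c0 * \<tau>)" "norm (u z) \<le> 3 * \<tau>"
        using mult_left_mono[OF Re_symbol_lt1_le[OF \<alpha> z], of t] mult_left_mono[OF norm_symbol_lt1_le[OF \<alpha>(1), of z], of t] t z
        by (auto simp: u_def \<tau>_def c0_def norm_mult mult_ac)
      have *: "norm ((1 + k * u z) * exp (u z / 2)) \<le> K * exp (- (c0 * \<tau> / 4))" if "norm k \<le> 1" for k
        unfolding K_def using u_le c0 t that by (intro norm_linear_times_exp_half_le) (auto simp: \<tau>_def)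
      have "(norm ((1 + k * u z) * exp (u z / 2)))^2 \<le> K^2 * exp (- (2 * s * norm (1 - z) powr \<alpha>))"
        if "norm k \<le> 1" for k
      proof -
        have "(norm ((1 + k * u z) * exp (u z / 2)))^2 \<le> (K * exp (- (c0 * \<tau> / 4)))^2"
          by (intro power_mono *[OF that]) auto
        also have "\<dots> = K^2 * exp (- (2 * s * norm (1 - z) powr \<alpha>))"
          by (simp add: power_mult_distrib s_def \<tau>_def mult_ac flip: exp_of_nat_mult)
        finally show ?thesis .
      qed
      from this[of 0] this[of \<kappa>] \<kappa> show
        "(norm (A z))^2 \<le> K^2 * exp (- (2 * s * norm (1 - z) powr \<alpha>))"
        "(norm (B z))^2 \<le> K^2 * exp (- (2 * s * norm (1 - z) powr \<alpha>))"
        by (auto simp: A_def B_def)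
    qed
    have cont: "continuous_on {0..1} (\<lambda>x. (norm (f (of_real r * circ x)))^2)"
      if f: "f holomorphic_on ball 0 1" and r: "0 < r" "r < 1" for f r
      using r by (intro continuous_intros continuous_on_compose2[OF holomorphic_on_imp_continuous_on[OF f]])
        (auto simp: norm_mult)
    have sq1: "(norm (g1 z))^2 = norm (1 - z) powr (\<alpha> - 1)"
      and sq2: "(norm (g2 z))^2 = norm (1 - z^2) powr (\<alpha> - 1)" for z
      unfolding g1_def g2_def norm_power[symmetric] powr_half_square by (rule norm_powr_of_real)+
    have int1: "integral {0..1} (\<lambda>x. (norm (g1 (of_real r * circ x) * D (of_real r * circ x)))^2) \<le> K^2 * J"
      if r: "0 < r" "r < 1" and f: "(\<lambda>z. g1 z * D z) holomorphic_on ball 0 1"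
        and D: "\<And>z. norm z < 1 \<Longrightarrow> (norm (D z))^2 \<le> K^2 * exp (- (2 * s * norm (1 - z) powr \<alpha>))" for D r
    proof (rule integral_circle_le[OF w_int cont[OF f r] _ _ w_anti])
      fix x :: real
      define z where "z = of_real r * circ x"
      have z: "norm z < 1" using r by (simp add: z_def norm_mult)
      have "(norm (g1 z * D z))^2 \<le> norm (1 - z) powr (\<alpha> - 1) * (K^2 * exp (- (2 * s * norm (1 - z) powr \<alpha>)))"
        unfolding norm_mult power_mult_distrib sq1 by (intro mult_left_mono D z) simp
      also have "\<dots> \<le> norm (1 - z) powr (\<alpha> - 1) * (K^2 * exp (- s * norm (1 - z) powr \<alpha>))"
        using s by (intro mult_left_mono) auto
      finally show "(norm (g1 (of_real r * circ x) * D (of_real r * circ x)))^2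
          \<le> K^2 * w (norm (1 - of_real r * circ x))"
        by (simp add: w_def z_def mult_ac)
    qed (use r in auto)
    have int2: "integral {0..1} (\<lambda>x. (norm (g2 (of_real r * circ x) * D (of_real r * circ x)))^2) \<le> K^2 * J"
      if r: "0 < r" "r < 1" and f: "(\<lambda>z. g2 z * D z) holomorphic_on ball 0 1"
        and D: "\<And>z. norm z < 1 \<Longrightarrow> (norm (D z))^2 \<le> K^2 * exp (- (2 * s * norm (1 - z) powr \<alpha>))" for D r
    proof (rule integral_circle_double_le[OF w_int cont[OF f r] _ _ w_anti])
      fix x :: real
      define z where "z = of_real r * circ x"
      have z: "norm z < 1" using r by (simp add: z_def norm_mult)
      have "(norm (g2 z * D z))^2 \<le> norm (1 - z^2) powr (\<alpha> - 1) * (K^2 * exp (- (2 * s * norm (1 - z) powr \<alpha>)))"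
        unfolding norm_mult power_mult_distrib sq2 by (intro mult_left_mono D z) simp
      also have "\<dots> \<le> norm (1 - z^2) powr (\<alpha> - 1) * (K^2 * exp (- s * norm (1 - z^2) powr \<alpha>))"
      proof -
        have "2 powr - 1 * norm (1 - z^2) powr \<alpha> \<le> 2 powr - \<alpha> * norm (1 - z^2) powr \<alpha>"
          using \<alpha> by (intro mult_right_mono powr_mono) auto
        also have "\<dots> \<le> norm (1 - z) powr \<alpha>"
          using powr_norm_one_minus_square_le[of z \<alpha>] z \<alpha> by simp
        finally have "s * norm (1 - z^2) powr \<alpha> \<le> 2 * s * norm (1 - z) powr \<alpha>"
          using s by (simp add: powr_minus)
        then show ?thesis by (intro mult_left_mono) auto
      qed
      finally show "(norm (g2 (of_real r * circ x) * D (of_real r * circ x)))^2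
          \<le> K^2 * w (norm (1 - (of_real r * circ x)^2))"
        by (simp add: w_def z_def mult_ac)
    qed (use r in auto)
    have P1_eq: "P1 = (\<lambda>z. g1 z * A z)" and Q1_eq: "Q1 = (\<lambda>z. g1 z * B z)"
      and P2_eq: "P2 = (\<lambda>z. g2 z * (z * A z))" and Q2_eq: "Q2 = (\<lambda>z. g2 z * B z)"
      by (auto simp: P1_def Q1_def P2_def Q2_def fun_eq_iff)
    have zA: "(norm (z * A z))^2 \<le> K^2 * exp (- (2 * s * norm (1 - z) powr \<alpha>))" if "norm z < 1" for z
    proof -
      have "(norm (z * A z))^2 \<le> 1 * (norm (A z))^2"
        unfolding norm_mult power_mult_distrib using that
        by (intro mult_right_mono) (auto simp: abs_square_le_1)
      also have "1 * (norm (A z))^2 = (norm (A z))^2" by simp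
      also note AB_le(1)[OF that]
      finally show ?thesis .
    qed
    have H1: "(\<Sum>n<N. norm (fps_nth (fps_expansion P1 0 * fps_expansion Q1 0) n) / real (n + 1)) \<le> 2 * (K^2 * J + K^2 * J)"
      by (rule Hardy_inequality_product[OF hol(1,2)], unfold P1_eq Q1_eq)
        (rule int1[OF _ _ hol(1)[unfolded P1_eq] AB_le(1)] int1[OF _ _ hol(2)[unfolded Q1_eq] AB_le(2)]; assumption)+
    have H2: "(\<Sum>n<N. norm (fps_nth (fps_expansion P2 0 * fps_expansion Q2 0) n) / real (n + 1)) \<le> 2 * (K^2 * J + K^2 * J)"
      by (rule Hardy_inequality_product[OF hol(3,4)], unfold P2_eq Q2_eq)
        (rule int2[OF _ _ hol(3)[unfolded P2_eq] zA] int2[OF _ _ hol(4)[unfolded Q2_eq] AB_le(2)]; assumption)+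
    have ball: "open (ball (0::complex) 1)" "(0::complex) \<in> ball 0 1" by auto
    define G where "G = fps_const (of_real (2 * \<alpha> * t)) * (fps_expansion P1 0 * fps_expansion Q1 0) -
        fps_const (of_real (2 powr (1 - \<alpha>) * \<alpha> * t)) * (fps_expansion P2 0 * fps_expansion Q2 0)"
    have fps: "fps_deriv (fps_expansion F 0) = G"
    proof (rule fps_expansion_unique_complex)
      show "deriv F has_fps_expansion fps_deriv (fps_expansion F 0)"
        by (intro has_fps_expansion_deriv has_fps_expansion_fps_expansion[OF ball] hol)
      have "(\<lambda>z. of_real (2 * \<alpha> * t) * (P1 z * Q1 z) -
          of_real (2 powr (1 - \<alpha>) * \<alpha> * t) * (P2 z * Q2 z)) has_fps_expansion G"
        unfolding G_def by (intro fps_expansion_intros has_fps_expansion_fps_expansion[OF ball] hol)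
      moreover have "eventually (\<lambda>z. z \<in> ball 0 1) (nhds (0::complex))"
        by (intro eventually_nhds_in_open) auto
      then have "eventually (\<lambda>z. of_real (2 * \<alpha> * t) * (P1 z * Q1 z) -
          of_real (2 powr (1 - \<alpha>) * \<alpha> * t) * (P2 z * Q2 z) = deriv F z) (nhds 0)"
        by eventually_elim (rule DERIV_imp_deriv[OF DF, symmetric])
      ultimately show "deriv F has_fps_expansion G"
        by (subst (asm) has_fps_expansion_cong) auto
    qed
    define a where "a n = norm (fps_nth (fps_expansion P1 0 * fps_expansion Q1 0) n) / real (n + 1)" for n
    define b where "b n = norm (fps_nth (fps_expansion P2 0 * fps_expansion Q2 0) n) / real (n + 1)" for n
    have coeff: "norm (fps_nth (fps_expansion F 0) (Suc n)) \<le> 2 * \<alpha> * t * a n + 2 * \<alpha> * t * b n" for n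
    proof -
      have two: "(2::real) powr (1 - \<alpha>) \<le> 2 powr 1" using \<alpha> by (intro powr_mono) auto
      have "real (n + 1) * norm (fps_nth (fps_expansion F 0) (Suc n)) = norm (fps_nth (fps_deriv (fps_expansion F 0)) n)"
        by (simp add: norm_mult del: of_nat_add flip: of_nat_Suc)
      also have "\<dots> \<le> norm (of_real (2 * \<alpha> * t) * fps_nth (fps_expansion P1 0 * fps_expansion Q1 0) n)
         + norm (of_real (2 powr (1 - \<alpha>) * \<alpha> * t) * fps_nth (fps_expansion P2 0 * fps_expansion Q2 0) n)"
        unfolding fps G_def by (simp only: fps_sub_nth fps_mult_left_const_nth norm_triangle_ineq4)
      also have "\<dots> = 2 * \<alpha> * t * (real (n + 1) * a n) + 2 powr (1 - \<alpha>) * \<alpha> * t * (real (n + 1) * b n)"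
        using \<alpha> t by (simp add: norm_mult a_def b_def del: of_real_mult)
      also have "\<dots> \<le> 2 * \<alpha> * t * (real (n + 1) * a n) + 2 * \<alpha> * t * (real (n + 1) * b n)"
        using two \<alpha> t by (intro add_left_mono mult_right_mono) (auto simp: b_def)
      also have "\<dots> = real (n + 1) * (2 * \<alpha> * t * a n + 2 * \<alpha> * t * b n)"
        by (simp add: algebra_simps)
      finally show ?thesis by (rule mult_left_le_imp_le) simp
    qed
    have "(\<Sum>n<N. norm (fps_nth (fps_expansion F 0) (Suc n))) \<le> (\<Sum>n<N. 2 * \<alpha> * t * a n + 2 * \<alpha> * t * b n)"
      by (intro sum_mono coeff)
    also have "\<dots> = 2 * \<alpha> * t * (\<Sum>n<N. a n) + 2 * \<alpha> * t * (\<Sum>n<N. b n)"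
      by (simp add: sum.distrib sum_distrib_left)
    also have "\<dots> \<le> 2 * \<alpha> * t * (2 * (K^2 * J + K^2 * J)) + 2 * \<alpha> * t * (2 * (K^2 * J + K^2 * J))"
      using H1 H2 \<alpha> t by (intro add_mono mult_left_mono) (auto simp: a_def b_def)
    also have "\<dots> = 64 * K^2 / c0 * (1 - exp (- s))"
      using \<alpha> t c0 by (simp add: J_def s_def field_simps)
    also have "\<dots> \<le> 64 * K^2 / c0 * min 1 t"
      using c0 s exp_ge_add_one_self[of "- s"] by (intro mult_left_mono) auto
    finally show "(\<Sum>n<N. norm (fps_nth (fps_expansion (\<lambda>z. expk \<kappa> (of_real t * symbol_lt1 \<alpha> z)) 0) (Suc n)))
        \<le> 64 * K^2 / c0 * min 1 t"
      unfolding F_def u_def .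
  qed
qed

text \<open>
  Both sides are continuous on the closed disc and agree inside.
\<close>

lemma closed_disc_power_series:
  assumes cont: "continuous_on (cball 0 1) f" and hol: "f holomorphic_on ball 0 1"
    and sm: "summable (\<lambda>n. norm (fps_nth (fps_expansion f 0) n))" and z: "norm z \<le> 1"
  shows "(\<lambda>n. fps_nth (fps_expansion f 0) n * z ^ n) sums f z"
proof -
  define c where "c = fps_nth (fps_expansion f 0)"
  have le: "norm (c n * z ^ n) \<le> norm (c n)" if "norm z \<le> 1" for n z
    using that by (simp add: norm_mult norm_power power_le_one mult_left_le)
  define g where "g z = (\<Sum>n. c n * z ^ n)" for z
  have lim: "uniform_limit (cball 0 1) (\<lambda>N z. \<Sum>n<N. c n * z ^ n) g sequentially"
    unfolding g_def by (rule Weierstrass_m_test[OF _ sm]) (use le in \<open>auto simp: c_def\<close>)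
  have "continuous_on (cball 0 1) g"
    by (rule uniform_limit_theorem[OF _ lim]) (auto intro!: always_eventually continuous_intros)
  then have "continuous_on (closure (ball 0 1)) (\<lambda>z. f z - g z)"
    using cont by (auto intro!: continuous_intros)
  moreover have "f z - g z = 0" if "z \<in> ball 0 1" for z
    using holomorphic_power_series[OF hol that]
    by (simp add: g_def c_def fps_expansion_def sums_iff)
  ultimately have "f z - g z = 0"
    using z by (intro continuous_constant_on_closure[of "ball 0 1" "\<lambda>z. f z - g z" 0 z]) auto
  moreover have "summable (\<lambda>n. c n * z ^ n)"
    using le[OF z] by (intro summable_norm_cancel[OF summable_comparison_test'[OF sm, of 0]]) (simp add: c_def)
  ultimately show ?thesis
    by (simp add: g_def sums_iff c_def)
qed

section \<open>Absolutely convergent Fourier series\<close>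

definition coeffs_vanish :: "(complex \<Rightarrow> complex) \<Rightarrow> bool" where
  "coeffs_vanish \<Phi> \<longleftrightarrow> continuous_on (sphere 0 1) \<Phi> \<and>
     (\<forall>n::int. ((\<lambda>x. \<Phi> (circ x) * circ (- (of_int n * x))) has_integral 0) {0..1})"

lemma coeffs_vanishD:
  assumes "coeffs_vanish \<Phi>"
  shows "continuous_on (sphere 0 1) \<Phi>"
    and "((\<lambda>x. \<Phi> (circ x) * circ (- (of_int n * x))) has_integral 0) {0..1}"
  using assms unfolding coeffs_vanish_def by blast+

lemma coeffs_vanish_add:
  assumes "coeffs_vanish \<Phi>" "coeffs_vanish \<Psi>"
  shows "coeffs_vanish (\<lambda>z. \<Phi> z + \<Psi> z)"
  unfolding coeffs_vanish_def
proof (intro conjI allI)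
  show "((\<lambda>x. (\<Phi> (circ x) + \<Psi> (circ x)) * circ (- (of_int n * x))) has_integral 0) {0..1}" for n :: int
    using has_integral_add[OF coeffs_vanishD(2)[OF assms(1), of n] coeffs_vanishD(2)[OF assms(2), of n]]
    by (simp add: distrib_right)
qed (intro continuous_intros coeffs_vanishD assms)

lemma coeffs_vanish_cmult:
  assumes "coeffs_vanish \<Phi>"
  shows "coeffs_vanish (\<lambda>z. c * \<Phi> z)"
  unfolding coeffs_vanish_def
proof (intro conjI allI)
  show "((\<lambda>x. c * \<Phi> (circ x) * circ (- (of_int n * x))) has_integral 0) {0..1}" for n :: int
    using has_integral_mult_right[OF coeffs_vanishD(2)[OF assms, of n], of c]
    by (simp add: mult.assoc)
qed (intro continuous_intros coeffs_vanishD assms)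

lemma coeffs_vanish_shift:
  assumes "coeffs_vanish \<Phi>"
  shows "coeffs_vanish (\<lambda>z. z * \<Phi> z)" "coeffs_vanish (\<lambda>z. cnj z * \<Phi> z)"
proof -
  have eq1: "circ x * \<Phi> (circ x) * circ (- (of_int n * x)) = \<Phi> (circ x) * circ (- (of_int (n - 1) * x))" for n :: int and x
  proof -
    have "circ x * circ (- (of_int n * x)) = circ (- (of_int (n - 1) * x))"
      unfolding circ_add[symmetric] by (simp add: algebra_simps)
    then show ?thesis by (simp only: mult.assoc mult.left_commute[of "\<Phi> (circ x)"] mult.commute[of "circ x"])
  qed
  show "coeffs_vanish (\<lambda>z. z * \<Phi> z)"
    unfolding coeffs_vanish_def eq1
    by (intro conjI allI continuous_intros coeffs_vanishD assms)
  have eq2: "cnj (circ x) * \<Phi> (circ x) * circ (- (of_int n * x)) = \<Phi> (circ x) * circ (- (of_int (n + 1) * x))" for n :: int and x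
  proof -
    have "circ (- x) * circ (- (of_int n * x)) = circ (- (of_int (n + 1) * x))"
      unfolding circ_add[symmetric] by (simp add: algebra_simps)
    then show ?thesis by (simp only: cnj_circ mult.assoc mult.left_commute[of "\<Phi> (circ x)"] mult.commute[of "circ (- x)"])
  qed
  show "coeffs_vanish (\<lambda>z. cnj z * \<Phi> z)"
    unfolding coeffs_vanish_def eq2
    by (intro conjI allI continuous_intros coeffs_vanishD assms)
qed

text \<open>
  Multiplication by \<open>z\<close> or its conjugate only shifts the Fourier coefficients, and every real
  polynomial in the coordinates is a polynomial in these two.
\<close>

lemma coeffs_vanish_mult_polynomial:
  assumes "real_polynomial_function p" "coeffs_vanish \<Phi>"
  shows "coeffs_vanish (\<lambda>z. of_real (p z) * \<Phi> z)"
  using assms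
proof (induction arbitrary: \<Phi>)
  case (linear f)
  have f: "f z = Re z * f 1 + Im z * f \<i>" for z
  proof -
    have "z = Re z *\<^sub>R 1 + Im z *\<^sub>R \<i>" by (simp add: complex_eq_iff)
    then have "f z = f (Re z *\<^sub>R 1 + Im z *\<^sub>R \<i>)" by simp
    also have "\<dots> = Re z * f 1 + Im z * f \<i>"
      using linear(1) by (simp add: bounded_linear.linear linear_add linear_scale)
    finally show ?thesis .
  qed
  have "coeffs_vanish (\<lambda>z. ((of_real (f 1) - \<i> * of_real (f \<i>)) / 2) * (z * \<Phi> z) +
      ((of_real (f 1) + \<i> * of_real (f \<i>)) / 2) * (cnj z * \<Phi> z))"
    by (intro coeffs_vanish_add coeffs_vanish_cmult coeffs_vanish_shift linear)
  moreover have "((of_real (f 1) - \<i> * of_real (f \<i>)) / 2) * (z * \<Phi> z) +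
      ((of_real (f 1) + \<i> * of_real (f \<i>)) / 2) * (cnj z * \<Phi> z) = of_real (f z) * \<Phi> z" for z
    unfolding f[of z] by (simp add: complex_eq_iff algebra_simps) (simp add: field_simps)
  ultimately show ?case by simp
next
  case (const c)
  then show ?case by (rule coeffs_vanish_cmult)
next
  case (add f g)
  then show ?case using coeffs_vanish_add[OF add(3)[OF add(5)] add(4)[OF add(5)]]
    by (simp add: distrib_right)
next
  case (mult f g)
  then show ?case using mult(3)[OF mult(4)[OF mult(5)]] by (simp add: mult.assoc)
qed

lemma circ_surj:
  assumes "norm z = 1"
  obtains x where "0 \<le> x" "x \<le> 1" "circ x = z"
proof -
  have "circ (Arg2pi z / (2 * pi)) = z"
    using Arg2pi[of z] assms by (simp add: circ_def is_Arg_def cis_conv_exp)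
  moreover have "0 \<le> Arg2pi z / (2 * pi)" "Arg2pi z / (2 * pi) \<le> 1"
    using Arg2pi[of z] by simp_all
  ultimately show ?thesis using that by blast
qed

lemma continuous_on_compose_circ:
  "continuous_on (sphere 0 1) \<Phi> \<Longrightarrow> continuous_on A (\<lambda>x. \<Phi> (circ x))"
  by (rule continuous_on_compose2[of "sphere 0 1" \<Phi>]) (auto intro!: continuous_intros)

text \<open>
  By Stone-Weierstrass the conjugate of \<open>\<Phi>\<close> is uniformly close to \<open>p - \<i> q\<close> with real polynomials
  \<open>p\<close> and \<open>q\<close>. As \<open>\<Phi> (p - \<i> q)\<close> has integral zero, the integral of \<open>|\<Phi>|\<^sup>2\<close> is arbitrarily small.
\<close>

theorem coeffs_vanish_imp_zero:
  assumes \<Phi>: "coeffs_vanish \<Phi>" and z: "norm z = 1"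
  shows "\<Phi> z = 0"
proof -
  have cont: "continuous_on (sphere 0 1) \<Phi>" using \<Phi> by (simp add: coeffs_vanish_def)
  have "bounded (\<Phi> ` sphere 0 1)"
    by (intro compact_imp_bounded compact_continuous_image cont compact_sphere)
  then obtain B where "B > 0" and "\<forall>w\<in>\<Phi> ` sphere 0 1. norm w \<le> B"
    unfolding bounded_pos by blast
  then have B: "norm (\<Phi> z) \<le> B" if "norm z = 1" for z using that by simp
  let ?I = "integral {0..1} (\<lambda>x. (norm (\<Phi> (circ x)))^2)"
  have cn: "continuous_on {0..1} (\<lambda>x. (norm (\<Phi> (circ x)))^2)"
    by (intro continuous_intros continuous_on_compose_circ cont)
  have "?I \<le> e" if "e > 0" for e
  proof -
    define d where "d = e / (2 * B)"
    have d: "d > 0" using that \<open>B > 0\<close> by (simp add: d_def)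
    obtain p where p: "real_polynomial_function p" "\<And>z. z \<in> sphere 0 1 \<Longrightarrow> \<bar>Re (\<Phi> z) - p z\<bar> < d"
      by (rule Stone_Weierstrass_real_polynomial_function[of "sphere 0 1" "\<lambda>z. Re (\<Phi> z)" d])
        (auto intro!: continuous_intros cont d)
    obtain q where q: "real_polynomial_function q" "\<And>z. z \<in> sphere 0 1 \<Longrightarrow> \<bar>Im (\<Phi> z) - q z\<bar> < d"
      by (rule Stone_Weierstrass_real_polynomial_function[of "sphere 0 1" "\<lambda>z. Im (\<Phi> z)" d])
        (auto intro!: continuous_intros cont d)
    have "coeffs_vanish (\<lambda>z. of_real (p z) * \<Phi> z + (- \<i>) * (of_real (q z) * \<Phi> z))"
      by (intro coeffs_vanish_add coeffs_vanish_cmult coeffs_vanish_mult_polynomial p q \<Phi>)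
    then have "((\<lambda>x. (of_real (p (circ x)) * \<Phi> (circ x) + (- \<i>) * (of_real (q (circ x)) * \<Phi> (circ x))) * circ (- (of_int 0 * x))) has_integral 0) {0..1}"
      unfolding coeffs_vanish_def by blast
    then have 0: "((\<lambda>x. Re (of_real (p (circ x)) * \<Phi> (circ x) + (- \<i>) * (of_real (q (circ x)) * \<Phi> (circ x)))) has_integral Re 0) {0..1}"
      by (intro has_integral_Re) simp
    have "((\<lambda>x. (norm (\<Phi> (circ x)))^2 - Re (of_real (p (circ x)) * \<Phi> (circ x) + (- \<i>) * (of_real (q (circ x)) * \<Phi> (circ x)))) has_integral (?I - Re 0)) {0..1}"
      by (intro has_integral_diff 0 integrable_integral integrable_continuous_real cn)
    then have "?I - Re 0 \<le> e"
    proof (rule has_integral_le)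
      show "((\<lambda>x. e) has_integral e) {0..1::real}"
        using has_integral_const_real[of e 0 1] by simp
      fix x :: real
      define w where "w = \<Phi> (circ x)"
      have w: "\<bar>Re w - p (circ x)\<bar> < d" "\<bar>Im w - q (circ x)\<bar> < d" "norm w \<le> B"
        using p(2)[of "circ x"] q(2)[of "circ x"] B[of "circ x"] by (auto simp: w_def)
      have "(norm w)^2 - Re (of_real (p (circ x)) * w + (- \<i>) * (of_real (q (circ x)) * w))
          = (Re w - p (circ x)) * Re w + (Im w - q (circ x)) * Im w"
        unfolding cmod_power2 by (simp add: power2_eq_square algebra_simps)
      also have "\<dots> \<le> \<bar>Re w - p (circ x)\<bar> * \<bar>Re w\<bar> + \<bar>Im w - q (circ x)\<bar> * \<bar>Im w\<bar>"
        unfolding abs_mult[symmetric] by (intro add_mono abs_ge_self)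
      also have "\<dots> \<le> d * B + d * B"
        using w abs_Re_le_cmod[of w] abs_Im_le_cmod[of w] d by (intro add_mono mult_mono) linarith+
      also have "\<dots> = e" using \<open>B > 0\<close> by (simp add: d_def)
      finally show "(norm (\<Phi> (circ x)))^2 - Re (of_real (p (circ x)) * \<Phi> (circ x) + (- \<i>) * (of_real (q (circ x)) * \<Phi> (circ x))) \<le> e"
        by (simp add: w_def)
    qed
    then show ?thesis by simp
  qed
  then have "?I \<le> 0" by (rule field_le_epsilon[of _ 0, simplified])
  moreover have "?I \<ge> 0" by (intro integral_nonneg integrable_continuous_real cn) simp
  ultimately have "?I = 0" by simp
  then have "\<forall>x\<in>{0..1}. (norm (\<Phi> (circ x)))^2 = 0"
    using cn by (subst (asm) integral_eq_0_iff) auto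
  then show ?thesis using circ_surj[OF z] by (metis atLeastAtMost_iff norm_eq_zero zero_eq_power2)
qed

text \<open>
  The series converges uniformly to a continuous function with the same Fourier coefficients as
  \<open>\<Phi>\<close>, and so it is \<open>\<Phi>\<close>.
\<close>

theorem circle_Fourier_series:
  assumes cont: "continuous_on (sphere 0 1) \<Phi>"
    and bound: "\<And>F. finite F \<Longrightarrow> (\<Sum>n\<in>F. norm (circ_coeff (\<lambda>x. \<Phi> (circ x)) n)) \<le> M"
  defines "c \<equiv> \<lambda>j. circ_coeff (\<lambda>x. \<Phi> (circ x)) (int_decode j)"
  shows "summable (\<lambda>j. norm (c j))" "(\<Sum>j. norm (c j)) \<le> M"
    and "norm z = 1 \<Longrightarrow> \<Phi> z = (\<Sum>j. c j * z powi int_decode j)"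
proof -
  have le: "(\<Sum>j<N. norm (c j)) \<le> M" for N
  proof -
    have "(\<Sum>j<N. norm (c j)) = (\<Sum>n\<in>int_decode ` {..<N}. norm (circ_coeff (\<lambda>x. \<Phi> (circ x)) n))"
      unfolding c_def by (simp add: sum.reindex inj_int_decode)
    then show ?thesis using bound[of "int_decode ` {..<N}"] by simp
  qed
  show sm: "summable (\<lambda>j. norm (c j))"
    by (rule bounded_imp_summable[of _ M]) (use le[of "Suc n" for n] in \<open>simp_all only: norm_ge_zero lessThan_Suc_atMost\<close>)
  show "(\<Sum>j. norm (c j)) \<le> M" by (rule suminf_le_const[OF sm le])
  define G where "G z = (\<Sum>j. c j * z powi int_decode j)" for z
  have lim: "uniform_limit (sphere 0 1) (\<lambda>N z. \<Sum>j<N. c j * z powi int_decode j) G sequentially"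
    unfolding G_def
    by (rule Weierstrass_m_test[OF _ sm]) (auto simp: norm_mult norm_power_int)
  have contG: "continuous_on (sphere 0 1) G"
    by (rule uniform_limit_theorem[OF _ lim]) (auto intro!: always_eventually continuous_intros)
  have intG: "((\<lambda>x. G (circ x) * circ (- (of_int n * x))) has_integral circ_coeff (\<lambda>x. \<Phi> (circ x)) n) {0..1}" for n
  proof -
    have term_eq: "c j * circ x powi int_decode j * circ (- (of_int n * x)) = c j * circ (of_int (int_decode j - n) * x)" for j x
    proof -
      have "circ x powi int_decode j * circ (- (of_int n * x)) = circ (of_int (int_decode j - n) * x)"
        unfolding circ_int_mult[symmetric] circ_add[symmetric] by (simp add: left_diff_distrib)
      then show ?thesis by (simp add: mult.assoc)
    qed
    have G_eq: "G (circ x) * circ (- (of_int n * x)) = (\<Sum>j. c j * circ (of_int (int_decode j - n) * x))" for x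
    proof -
      have "summable (\<lambda>j. c j * circ x powi int_decode j)"
        by (rule summable_norm_cancel) (use sm in \<open>simp add: norm_mult norm_power_int\<close>)
      then show ?thesis unfolding G_def by (simp add: suminf_mult2 term_eq)
    qed
    have ul: "uniform_limit {0..1} (\<lambda>N x. \<Sum>j<N. c j * circ (of_int (int_decode j - n) * x))
        (\<lambda>x. G (circ x) * circ (- (of_int n * x))) sequentially"
      unfolding G_eq by (rule Weierstrass_m_test[OF _ sm]) (simp add: norm_mult)
    obtain I J where I: "\<And>N. ((\<lambda>x. \<Sum>j<N. c j * circ (of_int (int_decode j - n) * x)) has_integral I N) {0..1}"
      and J: "((\<lambda>x. G (circ x) * circ (- (of_int n * x))) has_integral J) {0..1}" and IJ: "I \<longlonglongrightarrow> J"
      by (rule uniform_limit_integral[OF ul]) (auto intro!: continuous_intros)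
    have "I N = (\<Sum>j<N. c j * (if int_decode j - n = 0 then 1 else 0))" for N
      by (rule has_integral_unique[OF I]) (intro has_integral_sum has_integral_mult_right integral_circ; simp)
    also have "\<dots> N = (if int_encode n < N then c (int_encode n) else 0)" for N
    proof -
      have "(\<Sum>j<N. c j * (if int_decode j - n = 0 then 1 else 0)) = (\<Sum>j<N. if j = int_encode n then c j else 0)"
        by (intro sum.cong refl) auto
      then show ?thesis by (simp add: sum.delta)
    qed
    finally have "eventually (\<lambda>N. I N = c (int_encode n)) sequentially"
      by (intro eventually_mono[OF eventually_gt_at_top[of "int_encode n"]]) simp
    then have "I \<longlonglongrightarrow> c (int_encode n)" by (rule tendsto_eventually)
    then have "J = c (int_encode n)" using IJ LIMSEQ_unique by blast
    then show ?thesis using J by (simp add: c_def)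
  qed
  have "coeffs_vanish (\<lambda>z. \<Phi> z - G z)"
    unfolding coeffs_vanish_def
  proof (intro conjI allI)
    fix n :: int
    have "((\<lambda>x. \<Phi> (circ x) * circ (- (of_int n * x))) has_integral circ_coeff (\<lambda>x. \<Phi> (circ x)) n) {0..1}"
      unfolding circ_coeff_def
      by (intro integrable_integral integrable_continuous_real continuous_intros continuous_on_compose_circ cont)
    from has_integral_diff[OF this intG[of n]]
    show "((\<lambda>x. (\<Phi> (circ x) - G (circ x)) * circ (- (of_int n * x))) has_integral 0) {0..1}"
      by (simp add: left_diff_distrib)
  qed (intro continuous_intros cont contG)
  then show "\<Phi> z = (\<Sum>j. c j * z powi int_decode j)" if "norm z = 1"
    using coeffs_vanish_imp_zero[OF _ that] by (fastforce simp: G_def)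
qed

text \<open>
  Since \<open>(\<mu> + n)\<^sup>2 \<le> 2 (\<mu>\<^sup>2 + n\<^sup>2)\<close>, the terms with \<open>n \<ge> 1\<close> are at most
  \<open>2 \<mu>\<^sup>2 (1 / (\<mu> + n - 1) - 1 / (\<mu> + n))\<close>, which telescopes.
\<close>

lemma sum_Bernstein_weights_le:
  fixes \<mu> :: real
  assumes "0 < \<mu>" "finite (F :: int set)"
  shows "(\<Sum>n\<in>F. \<mu>^2 / (\<mu>^2 + (of_int n)^2)) \<le> 1 + 4 * \<mu>"
proof -
  define w where "w x = \<mu>^2 / (\<mu>^2 + x^2)" for x :: real
  have half: "(\<Sum>n=1..N. w (real n)) \<le> 2 * \<mu>" for N
  proof -
    have "(\<Sum>n=1..N. w (real n)) \<le> 2 * \<mu>^2 * (1 / \<mu> - 1 / (\<mu> + real N))"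
    proof (induction N)
      case (Suc N)
      define b where "b = \<mu> + real N"
      have b: "0 < b" using assms by (simp add: b_def)
      have "0 \<le> (\<mu> - real (Suc N))^2" by simp
      then have "(b + 1)^2 \<le> 2 * (\<mu>^2 + (real (Suc N))^2)"
        by (simp add: b_def power2_eq_square algebra_simps)
      then have "b * (b + 1) \<le> 2 * (\<mu>^2 + (real (Suc N))^2)"
        using b by (simp add: power2_eq_square algebra_simps)
      then have "w (real (Suc N)) \<le> \<mu>^2 / (b * (b + 1) / 2)"
        unfolding w_def using b assms(1) by (intro divide_left_mono) (auto intro!: mult_pos_pos add_pos_nonneg)
      also have "\<dots> = 2 * \<mu>^2 * (1 / b - 1 / (b + 1))"
        using b by (simp add: field_simps)
      finally show ?case using Suc by (simp add: b_def algebra_simps)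
    qed (use assms in simp)
    also have "\<dots> \<le> 2 * \<mu>^2 * (1 / \<mu>)"
      using assms by (intro mult_left_mono) auto
    also have "\<dots> = 2 * \<mu>" using assms by (simp add: power2_eq_square)
    finally show ?thesis .
  qed
  obtain N where N: "F \<subseteq> {- int N..int N}"
  proof -
    have "F \<subseteq> {- int (nat (Max (insert 0 (abs ` F))))..int (nat (Max (insert 0 (abs ` F))))}"
    proof
      fix n assume "n \<in> F"
      then have "\<bar>n\<bar> \<le> Max (insert 0 (abs ` F))" using assms by (intro Max_ge) auto
      then show "n \<in> {- int (nat (Max (insert 0 (abs ` F))))..int (nat (Max (insert 0 (abs ` F))))}" by auto
    qed
    then show ?thesis using that by blast
  qed
  have "(\<Sum>n\<in>F. w (of_int n)) \<le> (\<Sum>n\<in>{- int N..int N}. w (of_int n))"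
    using N by (intro sum_mono2) (auto simp: w_def)
  also have "{- int N..int N} = insert 0 (int ` {1..N} \<union> (\<lambda>n. - int n) ` {1..N})"
  proof (intro equalityI subsetI)
    fix n assume "n \<in> {- int N..int N}"
    then show "n \<in> insert 0 (int ` {1..N} \<union> (\<lambda>n. - int n) ` {1..N})"
      by (cases n rule: int_cases2) (auto intro!: image_eqI)
  qed auto
  also have "(\<Sum>n\<in>insert 0 (int ` {1..N} \<union> (\<lambda>n. - int n) ` {1..N}). w (of_int n))
      = w 0 + ((\<Sum>n=1..N. w (real n)) + (\<Sum>n=1..N. w (real n)))"
    by (subst sum.insert, simp, force, subst sum.union_disjoint)
      (auto simp: sum.reindex inj_on_def w_def)
  also have "\<dots> \<le> 1 + (2 * \<mu> + 2 * \<mu>)"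
    using half[of N] assms by (intro add_mono) (auto simp: w_def)
  finally show ?thesis by (simp add: w_def)
qed

text \<open>
  Cauchy-Schwarz with the weights \<open>1 + n\<^sup>2 / \<mu>\<^sup>2\<close>: the weighted sum of the \<open>|c\<^sub>n|\<^sup>2\<close> is controlled by
  Bessel's inequality for \<open>f\<close> and for its derivative \<open>g\<close>. The parameter \<open>\<mu>\<close> is the frequency at which
  the two contributions balance.
\<close>

theorem Bernstein_coeff_sum_le:
  assumes f: "continuous_on {0..1} f" and g: "continuous_on {0..1} g"
    and fg: "\<And>n. circ_coeff g n = 2 * of_real pi * \<i> * of_int n * circ_coeff f n"
    and A: "integral {0..1} (\<lambda>x. (norm (f x))^2) \<le> A"
    and B: "integral {0..1} (\<lambda>x. (norm (g x))^2) \<le> B"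
    and \<mu>: "0 < \<mu>" and F: "finite F"
  shows "(\<Sum>n\<in>F. norm (circ_coeff f n)) \<le> sqrt ((1 + 4 * \<mu>) * (A + B / \<mu>^2))"
proof (rule real_le_rsqrt)
  define a where "a n = sqrt (\<mu>^2 / (\<mu>^2 + (of_int n)^2))" for n :: int
  define b where "b n = sqrt ((\<mu>^2 + (of_int n)^2) / \<mu>^2) * norm (circ_coeff f n)" for n :: int
  have pos: "0 < \<mu>^2 + (of_int n)^2" for n :: int
    using \<mu> by (simp add: add_pos_nonneg)
  have "norm (circ_coeff f n) = a n * b n" for n
    using pos[of n] \<mu> by (simp add: a_def b_def flip: mult.assoc real_sqrt_mult)
  then have "(\<Sum>n\<in>F. norm (circ_coeff f n))^2 \<le> (\<Sum>n\<in>F. (a n)^2) * (\<Sum>n\<in>F. (b n)^2)"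
    using Cauchy_Schwarz_ineq_sum[of a b F] by simp
  also have "\<dots> \<le> (1 + 4 * \<mu>) * (A + B / \<mu>^2)"
  proof (rule mult_mono)
    have "(a n)^2 = \<mu>^2 / (\<mu>^2 + (of_int n)^2)" for n
      using pos[of n] by (simp add: a_def)
    then show "(\<Sum>n\<in>F. (a n)^2) \<le> 1 + 4 * \<mu>"
      using sum_Bernstein_weights_le[OF \<mu> F] by simp
    have "(b n)^2 \<le> (norm (circ_coeff f n))^2 + (norm (circ_coeff g n))^2 / \<mu>^2" for n
    proof -
      have "(b n)^2 = (norm (circ_coeff f n))^2 + (\<bar>of_int n\<bar> * norm (circ_coeff f n))^2 / \<mu>^2"
        using pos[of n] \<mu> by (simp add: b_def power_mult_distrib field_simps)
      moreover have "\<bar>of_int n\<bar> * norm (circ_coeff f n) \<le> norm (circ_coeff g n)"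
      proof -
        have "1 * (\<bar>of_int n\<bar> * norm (circ_coeff f n)) \<le> (2 * pi) * (\<bar>of_int n\<bar> * norm (circ_coeff f n))"
          using pi_gt3 by (intro mult_right_mono) auto
        then show ?thesis by (simp add: fg norm_mult)
      qed
      then have "(\<bar>of_int n\<bar> * norm (circ_coeff f n))^2 / \<mu>^2 \<le> (norm (circ_coeff g n))^2 / \<mu>^2"
        by (intro divide_right_mono power_mono) auto
      ultimately show ?thesis by linarith
    qed
    then have "(\<Sum>n\<in>F. (b n)^2) \<le> (\<Sum>n\<in>F. (norm (circ_coeff f n))^2) + (\<Sum>n\<in>F. (norm (circ_coeff g n))^2) / \<mu>^2"
      by (simp add: sum_divide_distrib sum_mono flip: sum.distrib)
    also have "\<dots> \<le> A + B / \<mu>^2"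
      using Bessel_inequality[OF f F] Bessel_inequality[OF g F] A B
      by (intro add_mono divide_right_mono) auto
    finally show "(\<Sum>n\<in>F. (b n)^2) \<le> A + B / \<mu>^2" .
  qed (use \<mu> in \<open>auto intro!: sum_nonneg\<close>)
  finally show "(\<Sum>n\<in>F. norm (circ_coeff f n))^2 \<le> (1 + 4 * \<mu>) * (A + B / \<mu>^2)" .
qed

text \<open>
  Integration by parts; finitely many points without a derivative do no harm.
\<close>

lemma circ_coeff_derivative:
  assumes f: "continuous_on {0..1} f" and per: "f 1 = f 0" and S: "finite S"
    and g: "continuous_on {0..1} g"
    and D: "\<And>x. x \<in> {0<..<1} - S \<Longrightarrow> (f has_vector_derivative g x) (at x)"
  shows "circ_coeff g n = 2 * of_real pi * \<i> * of_int n * circ_coeff f n"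
proof -
  define e where "e x = circ (- (of_int n * x))" for x
  have e: "(e has_vector_derivative (- (2 * of_real pi * \<i> * of_int n) * e x)) (at x)" for x
    using circ_has_vector_derivative[of "- of_int n" x UNIV] by (simp add: e_def[abs_def])
  have I1: "((\<lambda>x. f x * (- (2 * of_real pi * \<i> * of_int n) * e x) + g x * e x) has_integral
      f 1 * e 1 - f 0 * e 0) {0..1}"
  proof (rule fundamental_theorem_of_calculus_interior_strong[OF S])
    show "continuous_on {0..1} (\<lambda>x. f x * e x)"
      unfolding e_def by (intro continuous_intros f)
    show "((\<lambda>x. f x * e x) has_vector_derivative f x * (- (2 * of_real pi * \<i> * of_int n) * e x) + g x * e x) (at x)"
      if "x \<in> {0<..<1} - S" for x
      by (intro has_vector_derivative_mult D[OF that] e)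
  qed auto
  have I0: "f 1 * e 1 - f 0 * e 0 = 0"
    using per circ_of_int[of "- n"] by (simp add: e_def)
  have I2: "((\<lambda>x. f x * (- (2 * of_real pi * \<i> * of_int n) * e x) + g x * e x) has_integral
      - (2 * of_real pi * \<i> * of_int n) * circ_coeff f n + circ_coeff g n) {0..1}"
  proof -
    have "((\<lambda>x. f x * e x) has_integral circ_coeff f n) {0..1}" "((\<lambda>x. g x * e x) has_integral circ_coeff g n) {0..1}"
      unfolding circ_coeff_def e_def
      by (intro integrable_integral integrable_continuous_real continuous_intros f g)+
    then have "((\<lambda>x. - (2 * of_real pi * \<i> * of_int n) * (f x * e x) + g x * e x) has_integral
      - (2 * of_real pi * \<i> * of_int n) * circ_coeff f n + circ_coeff g n) {0..1}"
      by (intro has_integral_add has_integral_mult_right)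
    moreover have "f x * (- (2 * of_real pi * \<i> * of_int n) * e x) = - (2 * of_real pi * \<i> * of_int n) * (f x * e x)" for x
      by simp
    ultimately show ?thesis by (simp only:)
  qed
  have "- (2 * of_real pi * \<i> * of_int n) * circ_coeff f n + circ_coeff g n = 0"
    using has_integral_unique[OF I2 I1] unfolding I0 .
  then show ?thesis by (simp add: add_eq_0_iff)
qed

section \<open>Differentiable symbols: orders above one\<close>

lemma one_minus_cis: "1 - cis \<theta> = of_real (2 * sin (\<theta> / 2)) * cis ((\<theta> - pi) / 2)"
proof -
  have 1: "cos ((\<theta> - pi) / 2) = sin (\<theta> / 2)" "sin ((\<theta> - pi) / 2) = - cos (\<theta> / 2)"
    by (simp_all add: diff_divide_distrib cos_diff sin_diff)
  have 2: "cos \<theta> = 1 - 2 * (sin (\<theta> / 2))^2" "sin \<theta> = 2 * sin (\<theta> / 2) * cos (\<theta> / 2)"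
    using cos_double_sin[of "\<theta> / 2"] sin_double[of "\<theta> / 2"] by simp_all
  show ?thesis
    unfolding complex_eq_iff by (simp add: 1 2 power2_eq_square)
qed

text \<open>
  The function \<open>\<Phi>\<close> with \<open>\<phi>\<^sub>h(k) = h\<^sup>-\<^sup>\<alpha> \<Phi>(exp (\<i> k h))\<close> for \<open>\<alpha> > 1\<close>. The shifts \<open>p\<^sub>1 = 1\<close> with step \<open>h\<close> and
  \<open>p\<^sub>2 = 1/2\<close> with step \<open>2 h\<close> produce the same factor \<open>1 / z\<close>.
\<close>

definition symbol_gt1 :: "real \<Rightarrow> complex \<Rightarrow> complex" where
  "symbol_gt1 \<alpha> z = inverse z * (of_real (2 - 2 / \<alpha>) * (1 - z) powr of_real \<alpha> +
     of_real ((2 / \<alpha> - 1) * 2 powr - \<alpha>) * (1 - z^2) powr of_real \<alpha>)"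

text \<open>
  Write \<open>A\<close> and \<open>B\<close> for the two angles; the constant \<open>c\<close> stands for \<open>cos (\<theta>/2)\<^sup>\<alpha>\<close>. Always
  \<open>0 \<le> A \<le> \<pi>/2\<close>, so \<open>sin A \<ge> 2 A / \<pi>\<close>. For \<open>\<theta> \<le> \<pi>/2\<close> the second term helps, as \<open>B \<le> 0\<close>. Otherwise
  \<open>c sin B \<le> B\<close>, and the claim becomes linear in \<open>\<theta>\<close>; both terms carry a factor \<open>\<alpha> - 1\<close>, and what
  remains is \<open>\<theta> - \<pi>/2 \<le> 2 \<theta> / \<pi>\<close> on \<open>[0, \<pi>]\<close>.
\<close>

lemma symbol_gt1_trig_inequality:
  assumes \<alpha>: "1 < \<alpha>" "\<alpha> < 2" and \<theta>: "0 \<le> \<theta>" "\<theta> \<le> pi" and c: "0 \<le> c" "c \<le> 1"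
  shows "2 * (\<alpha> - 1)^2 / \<alpha> \<le> (2 - 2 / \<alpha>) * sin ((\<alpha> - 1) * pi / 2 + (1 - \<alpha> / 2) * \<theta>)
     - (2 / \<alpha> - 1) * c * sin ((\<alpha> - 1) * (\<theta> - pi / 2))"
proof -
  define A where "A = (\<alpha> - 1) * pi / 2 + (1 - \<alpha> / 2) * \<theta>"
  define B where "B = (\<alpha> - 1) * (\<theta> - pi / 2)"
  have a: "2 - 2 / \<alpha> = 2 * (\<alpha> - 1) / \<alpha>" "2 / \<alpha> - 1 = (2 - \<alpha>) / \<alpha>"
    using \<alpha> by (simp_all add: field_simps)
  have "(1 - \<alpha> / 2) * \<theta> \<le> (1 - \<alpha> / 2) * pi"
    using \<alpha> \<theta> by (intro mult_left_mono) auto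
  then have "A \<le> pi / 2" by (simp add: A_def field_simps)
  moreover have "0 \<le> A" using \<alpha> \<theta> by (simp add: A_def)
  ultimately have sinA: "2 / pi * A \<le> sin A" by (intro Jordan_sin_inequality)
  have A_eq: "2 / pi * A = (\<alpha> - 1) + (2 - \<alpha>) * \<theta> / pi"
    by (simp add: A_def field_simps)
  have "2 * (\<alpha> - 1)^2 / \<alpha> \<le> 2 * (\<alpha> - 1) / \<alpha> * sin A - (2 - \<alpha>) / \<alpha> * c * sin B"
  proof (cases "\<theta> \<le> pi / 2")
    case True
    have "\<bar>B\<bar> \<le> 1 * (pi / 2)"
      unfolding B_def abs_mult using \<alpha> True \<theta> by (intro mult_mono) auto
    moreover have "B \<le> 0" unfolding B_def using \<alpha> True by (intro mult_nonneg_nonpos) auto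
    ultimately have "sin B \<le> 0" using sin_ge_zero[of "- B"] by simp
    then have "(2 - \<alpha>) / \<alpha> * c * sin B \<le> 0"
      using \<alpha> c by (intro mult_nonneg_nonpos) auto
    moreover have "2 * (\<alpha> - 1) / \<alpha> * (\<alpha> - 1) \<le> 2 * (\<alpha> - 1) / \<alpha> * sin A"
    proof (rule mult_left_mono)
      have "0 \<le> (2 - \<alpha>) * \<theta> / pi" using \<alpha> \<theta> by simp
      then show "\<alpha> - 1 \<le> sin A" using sinA A_eq by linarith
    qed (use \<alpha> in simp)
    moreover have "2 * (\<alpha> - 1)^2 / \<alpha> = 2 * (\<alpha> - 1) / \<alpha> * (\<alpha> - 1)" by (simp add: power2_eq_square)
    ultimately show ?thesis by linarith
  next
    case False
    have B0: "0 \<le> B" unfolding B_def using \<alpha> False by simp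
    have "c * sin B \<le> 1 * B"
    proof (cases "0 \<le> sin B")
      case True
      then show ?thesis using c B0 sin_x_le_x[of B] by (intro mult_mono) auto
    next
      case False
      then have "c * sin B \<le> 0" using c by (intro mult_nonneg_nonpos) auto
      then show ?thesis using B0 by simp
    qed
    then have "(2 - \<alpha>) / \<alpha> * (c * sin B) \<le> (2 - \<alpha>) / \<alpha> * B"
      using \<alpha> by (intro mult_left_mono) auto
    moreover have "2 * (\<alpha> - 1) / \<alpha> * (2 / pi * A) \<le> 2 * (\<alpha> - 1) / \<alpha> * sin A"
      using \<alpha> sinA by (intro mult_left_mono) auto
    moreover have "2 * (\<alpha> - 1)^2 / \<alpha> \<le> 2 * (\<alpha> - 1) / \<alpha> * (2 / pi * A) - (2 - \<alpha>) / \<alpha> * B"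
    proof -
      have "\<theta> - pi / 2 \<le> 2 * \<theta> / pi"
      proof -
        have "\<theta> * (1 - 2 / pi) \<le> pi * (1 - 2 / pi)"
          using \<theta> pi_gt3 by (intro mult_right_mono) (auto simp: field_simps)
        then have "\<theta> - 2 * \<theta> / pi \<le> pi - 2" by (simp add: right_diff_distrib mult.commute)
        then show ?thesis using pi_less_4 by linarith
      qed
      then have "(\<alpha> - 1) / \<alpha> * (2 - \<alpha>) * (\<theta> - pi / 2) \<le> (\<alpha> - 1) / \<alpha> * (2 - \<alpha>) * (2 * \<theta> / pi)"
        using \<alpha> by (intro mult_left_mono) auto
      moreover have "2 * (\<alpha> - 1) / \<alpha> * (2 / pi * A) = 2 * (\<alpha> - 1)^2 / \<alpha> + (\<alpha> - 1) / \<alpha> * (2 - \<alpha>) * (2 * \<theta> / pi)"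
        unfolding A_eq using \<alpha> by (simp add: power2_eq_square field_simps)
      moreover have "(2 - \<alpha>) / \<alpha> * B = (\<alpha> - 1) / \<alpha> * (2 - \<alpha>) * (\<theta> - pi / 2)"
        by (simp add: B_def)
      ultimately show ?thesis by linarith
    qed
    ultimately show ?thesis unfolding mult.assoc[symmetric] by linarith
  qed
  then show ?thesis unfolding a A_def B_def .
qed

text \<open>
  In polar form \<open>1 - z = 2 sin (\<theta>/2) exp (\<i> (\<theta> - \<pi>)/2)\<close> and \<open>1 - z\<^sup>2 = 2 sin \<theta> exp (\<i> (\<theta> - \<pi>/2))\<close>
  with principal arguments for \<open>0 \<le> \<theta> \<le> \<pi>\<close>. Taking out the factor \<open>|1 - z|\<^sup>\<alpha>\<close> leaves the
  trigonometric inequality above.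
\<close>

lemma Re_symbol_gt1_cis_le:
  assumes \<alpha>: "1 < \<alpha>" "\<alpha> < 2" and \<theta>: "0 \<le> \<theta>" "\<theta> \<le> pi"
  shows "Re (symbol_gt1 \<alpha> (cis \<theta>)) \<le> - (2 * (\<alpha> - 1)^2 / \<alpha> * norm (1 - cis \<theta>) powr \<alpha>)"
proof -
  define \<rho> where "\<rho> = 2 * sin (\<theta> / 2)"
  define c where "c = cos (\<theta> / 2)"
  have \<rho>: "0 \<le> \<rho>" unfolding \<rho>_def using \<theta> by (intro mult_nonneg_nonneg sin_ge_zero) auto
  have c: "0 \<le> c" "c \<le> 1" unfolding c_def using \<theta> by (auto intro!: cos_ge_zero)
  have n: "norm (1 - cis \<theta>) = \<rho>"
    using \<rho> by (simp add: one_minus_cis \<rho>_def[symmetric] norm_mult del: of_real_mult)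
  have ang: "- pi < (\<theta> - pi) / 2" "(\<theta> - pi) / 2 \<le> pi"
    using less_le_trans[of "- pi" 0 \<theta>] \<theta> by simp_all
  have ang': "- pi < \<theta> - pi / 2" using \<theta> pi_gt_zero by linarith
  have ang'': "\<theta> - pi / 2 \<le> pi" using \<theta> pi_gt_zero by linarith
  have 1: "(1 - cis \<theta>) powr of_real \<alpha> = of_real (\<rho> powr \<alpha>) * cis (\<alpha> * ((\<theta> - pi) / 2))"
    unfolding one_minus_cis \<rho>_def[symmetric] by (intro powr_of_real_polar ang \<rho>)
  have "sin \<theta> = 2 * sin (\<theta> / 2) * cos (\<theta> / 2)" using sin_double[of "\<theta> / 2"] by simp
  then have "2 * sin (2 * \<theta> / 2) = \<rho> * (2 * c)" by (simp add: \<rho>_def c_def)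
  then have "1 - (cis \<theta>)^2 = of_real (\<rho> * (2 * c)) * cis (\<theta> - pi / 2)"
    using one_minus_cis[of "2 * \<theta>"] by (simp add: Complex.DeMoivre diff_divide_distrib)
  then have "(1 - (cis \<theta>)^2) powr of_real \<alpha> = of_real ((\<rho> * (2 * c)) powr \<alpha>) * cis (\<alpha> * (\<theta> - pi / 2))"
    by (simp only:) (intro powr_of_real_polar ang' ang'' mult_nonneg_nonneg \<rho> c; simp)
  also have "(\<rho> * (2 * c)) powr \<alpha> = 2 powr \<alpha> * (\<rho> powr \<alpha> * c powr \<alpha>)"
    using \<rho> c by (simp add: powr_mult)
  finally have 2: "(1 - (cis \<theta>)^2) powr of_real \<alpha> =
     of_real (2 powr \<alpha> * (\<rho> powr \<alpha> * c powr \<alpha>)) * cis (\<alpha> * (\<theta> - pi / 2))" .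
  have "symbol_gt1 \<alpha> (cis \<theta>) = of_real ((2 - 2 / \<alpha>) * \<rho> powr \<alpha>) * (cis (- \<theta>) * cis (\<alpha> * ((\<theta> - pi) / 2)))
     + of_real ((2 / \<alpha> - 1) * (2 powr - \<alpha> * 2 powr \<alpha>) * (\<rho> powr \<alpha> * c powr \<alpha>)) * (cis (- \<theta>) * cis (\<alpha> * (\<theta> - pi / 2)))"
    unfolding symbol_gt1_def 1 2 cis_inverse by (simp add: algebra_simps)
  also have "(2::real) powr - \<alpha> * 2 powr \<alpha> = 1" by (simp flip: powr_add)
  finally have "Re (symbol_gt1 \<alpha> (cis \<theta>)) =
     (2 - 2 / \<alpha>) * \<rho> powr \<alpha> * cos (- \<theta> + \<alpha> * ((\<theta> - pi) / 2)) +
     (2 / \<alpha> - 1) * (\<rho> powr \<alpha> * c powr \<alpha>) * cos (- \<theta> + \<alpha> * (\<theta> - pi / 2))"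
    by (simp add: cis_mult)
  also have "cos (- \<theta> + \<alpha> * ((\<theta> - pi) / 2)) = - sin ((\<alpha> - 1) * pi / 2 + (1 - \<alpha> / 2) * \<theta>)"
  proof -
    have "- \<theta> + \<alpha> * ((\<theta> - pi) / 2) = - (((\<alpha> - 1) * pi / 2 + (1 - \<alpha> / 2) * \<theta>) + pi / 2)"
      by (simp add: field_simps)
    then show ?thesis by (simp only: cos_minus) (simp add: cos_add)
  qed
  also have "cos (- \<theta> + \<alpha> * (\<theta> - pi / 2)) = sin ((\<alpha> - 1) * (\<theta> - pi / 2))"
  proof -
    have "- \<theta> + \<alpha> * (\<theta> - pi / 2) = (\<alpha> - 1) * (\<theta> - pi / 2) - pi / 2"
      by (simp add: field_simps)
    then show ?thesis by (simp only:) (simp add: cos_diff)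
  qed
  also have "(2 - 2 / \<alpha>) * \<rho> powr \<alpha> * - sin ((\<alpha> - 1) * pi / 2 + (1 - \<alpha> / 2) * \<theta>) +
     (2 / \<alpha> - 1) * (\<rho> powr \<alpha> * c powr \<alpha>) * sin ((\<alpha> - 1) * (\<theta> - pi / 2)) =
     - (((2 - 2 / \<alpha>) * sin ((\<alpha> - 1) * pi / 2 + (1 - \<alpha> / 2) * \<theta>)
     - (2 / \<alpha> - 1) * c powr \<alpha> * sin ((\<alpha> - 1) * (\<theta> - pi / 2))) * \<rho> powr \<alpha>)"
    by (simp add: algebra_simps)
  also have "\<dots> \<le> - (2 * (\<alpha> - 1)^2 / \<alpha> * \<rho> powr \<alpha>)"
    using \<alpha> c by (intro le_imp_neg_le mult_right_mono symbol_gt1_trig_inequality \<theta>) (auto intro: powr_le1)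
  finally show ?thesis unfolding n .
qed

text \<open>
  The lower half of the circle follows from the upper half by complex conjugation.
\<close>

lemma Re_symbol_gt1_le:
  assumes \<alpha>: "1 < \<alpha>" "\<alpha> < 2" and z: "norm z = 1"
  shows "Re (symbol_gt1 \<alpha> z) \<le> - (2 * (\<alpha> - 1)^2 / \<alpha> * norm (1 - z) powr \<alpha>)"
proof -
  have upper: "Re (symbol_gt1 \<alpha> z) \<le> - (2 * (\<alpha> - 1)^2 / \<alpha> * norm (1 - z) powr \<alpha>)"
    if "norm z = 1" "0 \<le> Im z" for z
  proof -
    have "z = cis (Arg2pi z)"
      using Arg2pi[of z] that by (simp add: is_Arg_def cis_conv_exp)
    moreover have "Arg2pi z \<le> pi" using that by (simp add: Arg2pi_le_pi)
    ultimately show ?thesis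
      using Re_symbol_gt1_cis_le[OF \<alpha>, of "Arg2pi z"] Arg2pi_ge_0[of z] by simp
  qed
  show ?thesis
  proof (cases "0 \<le> Im z")
    case False
    have *: "0 \<le> Re (1 - w)" if "norm w = 1" for w
      using complex_Re_le_cmod[of w] that by simp
    have "symbol_gt1 \<alpha> (cnj z) = cnj (symbol_gt1 \<alpha> z)"
      using *[of z] *[of "z^2"] z by (simp add: symbol_gt1_def cnj_powr norm_power)
    moreover have "norm (1 - cnj z) = norm (1 - z)"
      using complex_mod_cnj[of "1 - z"] by simp
    ultimately show ?thesis using upper[of "cnj z"] False z by simp
  qed (use upper z in blast)
qed

lemma norm_symbol_gt1_le:
  assumes \<alpha>: "1 < \<alpha>" "\<alpha> < 2" and z: "norm z = 1"
  shows "norm (symbol_gt1 \<alpha> z) \<le> norm (1 - z) powr \<alpha>"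
proof -
  have ab: "0 \<le> 2 - 2 / \<alpha>" "0 \<le> 2 / \<alpha> - 1" using \<alpha> by (simp_all add: field_simps)
  have "norm (symbol_gt1 \<alpha> z) \<le> (2 - 2 / \<alpha>) * norm (1 - z) powr \<alpha> + (2 / \<alpha> - 1) * (2 powr - \<alpha> * norm (1 - z^2) powr \<alpha>)"
  proof -
    have "norm (symbol_gt1 \<alpha> z) = norm (of_real (2 - 2 / \<alpha>) * (1 - z) powr of_real \<alpha> +
        of_real ((2 / \<alpha> - 1) * 2 powr - \<alpha>) * (1 - z^2) powr of_real \<alpha>)"
      unfolding symbol_gt1_def norm_mult norm_inverse z by simp
    also have "\<dots> \<le> norm (of_real (2 - 2 / \<alpha>) * (1 - z) powr of_real \<alpha>) +
        norm (of_real ((2 / \<alpha> - 1) * 2 powr - \<alpha>) * (1 - z^2) powr of_real \<alpha>)"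
      by (rule norm_triangle_ineq)
    finally show ?thesis
      using ab by (simp add: norm_mult norm_powr_of_real del: of_real_diff of_real_mult of_real_divide)
  qed
  also have "\<dots> \<le> (2 - 2 / \<alpha>) * norm (1 - z) powr \<alpha> + (2 / \<alpha> - 1) * norm (1 - z) powr \<alpha>"
    using ab \<alpha> z by (intro add_left_mono mult_left_mono powr_norm_one_minus_square_le) auto
  also have "\<dots> = norm (1 - z) powr \<alpha>" by (simp add: algebra_simps)
  finally show ?thesis .
qed

lemma continuous_on_one_minus_powr:
  assumes "0 < p"
  shows "continuous_on (sphere 0 1) (\<lambda>z::complex. (1 - z) powr of_real p)"
    and "continuous_on (sphere 0 1) (\<lambda>z::complex. (1 - z^2) powr of_real p)"
proof -
  have *: "0 \<le> Re (1 - w)" if "norm w \<le> 1" for w :: complex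
    using complex_Re_le_cmod[of w] that by simp
  have sq: "norm (w^2) \<le> 1" if "norm w = 1" for w :: complex
    using that by (simp add: norm_power)
  show "continuous_on (sphere 0 1) (\<lambda>z::complex. (1 - z) powr of_real p)"
    using assms * by (intro continuous_intros) (auto simp del: minus_complex.simps)
  show "continuous_on (sphere 0 1) (\<lambda>z::complex. (1 - z^2) powr of_real p)"
    using assms *[OF sq] by (intro continuous_intros) (auto simp del: minus_complex.simps)
qed

lemma continuous_on_symbol_gt1:
  assumes "0 < \<alpha>" shows "continuous_on (sphere 0 1) (symbol_gt1 \<alpha>)"
  unfolding symbol_gt1_def[abs_def]
  by (intro continuous_on_mult continuous_on_add continuous_on_const
      continuous_on_one_minus_powr assms continuous_on_inverse continuous_on_id) auto

text \<open>
  The derivative of \<open>x \<mapsto> \<Phi>(circ x)\<close>. Since \<open>\<alpha> > 1\<close>, the formula is continuous also at the points where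
  \<open>z\<^sup>2 = 1\<close>.
\<close>

definition symbol_gt1_deriv :: "real \<Rightarrow> real \<Rightarrow> complex" where
  "symbol_gt1_deriv \<alpha> x = - (2 * of_real pi * \<i>) * symbol_gt1 \<alpha> (circ x)
     - 2 * of_real pi * \<i> * of_real \<alpha> * (of_real (2 - 2 / \<alpha>) * (1 - circ x) powr of_real (\<alpha> - 1) +
        2 * of_real ((2 / \<alpha> - 1) * 2 powr - \<alpha>) * circ x * (1 - (circ x)^2) powr of_real (\<alpha> - 1))"

lemma circ_neq_one: "0 < x \<Longrightarrow> x < 1 \<Longrightarrow> circ x \<noteq> 1"
proof
  assume x: "0 < x" "x < 1" "circ x = 1"
  then have "Re (circ x) = 1" by simp
  then have "cos (2 * pi * x) = 1" by (simp add: circ_def)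
  then obtain n :: int where "2 * pi * x = of_int n * 2 * pi" unfolding cos_one_2pi_int by blast
  then have "x = of_int n" by simp
  then show False using x by simp
qed

lemma not_nonpos_one_minus:
  fixes w :: complex
  assumes "norm w = 1" "w \<noteq> 1" shows "1 - w \<notin> \<real>\<^sub>\<le>\<^sub>0"
proof -
  have "Re w \<noteq> 1"
  proof
    assume "Re w = 1"
    then have "(Im w)^2 = 0" using cmod_power2[of w] assms by simp
    then show False using \<open>Re w = 1\<close> assms(2) by (simp add: complex_eq_iff)
  qed
  then have "0 < Re (1 - w)" using complex_Re_le_cmod[of w] assms by simp
  then show ?thesis by (rule not_nonpos_if_Re_pos)
qed

lemma symbol_gt1_has_vector_derivative:
  assumes "0 < x" "x < 1" "x \<noteq> 1/2"
  shows "((\<lambda>x. symbol_gt1 \<alpha> (circ x)) has_vector_derivative symbol_gt1_deriv \<alpha> x) (at x)"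
proof -
  define z where "z = circ x"
  have z: "z \<noteq> 0" "norm z = 1" by (simp_all add: z_def)
  have z1: "z \<noteq> 1" using circ_neq_one assms by (simp add: z_def)
  have z2: "z^2 \<noteq> 1"
  proof (cases "x < 1/2")
    case True
    then show ?thesis using circ_neq_one[of "2 * x"] circ_nat_mult[of 2 x] assms by (simp add: z_def)
  next
    case False
    have "circ (2 * x - 1) = circ (2 * x)"
      using circ_add[of "2 * x" "- 1"] circ_of_int[of "-1"] by simp
    then show ?thesis using False circ_neq_one[of "2 * x - 1"] circ_nat_mult[of 2 x] assms by (simp add: z_def)
  qed
  have np: "1 - z \<notin> \<real>\<^sub>\<le>\<^sub>0" "1 - z^2 \<notin> \<real>\<^sub>\<le>\<^sub>0"
    using not_nonpos_one_minus[of z] not_nonpos_one_minus[of "z^2"] z z1 z2 by (auto simp: norm_power)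
  define a b where "a = complex_of_real (2 - 2 / \<alpha>)" and "b = complex_of_real ((2 / \<alpha> - 1) * 2 powr - \<alpha>)"
  define p q p' q' where "p = (1 - z) powr of_real \<alpha>" and "q = (1 - z^2) powr of_real \<alpha>"
    and "p' = (1 - z) powr (of_real \<alpha> - 1)" and "q' = (1 - z^2) powr (of_real \<alpha> - 1)"
  define Y where "Y = a * (of_real \<alpha> * p' * (- 1)) + b * (of_real \<alpha> * q' * (- (2 * z)))"
  have D: "(symbol_gt1 \<alpha> has_field_derivative
      - (inverse z * inverse z) * (a * p + b * q) + inverse z * Y) (at (circ x))"
    unfolding symbol_gt1_def[abs_def] a_def[symmetric] b_def[symmetric] p_def q_def p'_def q'_def Y_def z_def[symmetric]
    by (rule derivative_eq_intros one_minus_powr_has_field_derivative np refl z | simp add: algebra_simps power2_eq_square)+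
  have "(circ has_vector_derivative (2 * of_real pi * \<i>) * z) (at x)"
    using circ_has_vector_derivative[of 1 x UNIV] by (simp add: z_def)
  from field_vector_diff_chain_at[OF this D]
  have "((\<lambda>x. symbol_gt1 \<alpha> (circ x)) has_vector_derivative (2 * of_real pi * \<i>) * z *
      (- (inverse z * inverse z) * (a * p + b * q) + inverse z * Y)) (at x)"
    by (simp only: o_def)
  also have "(2 * of_real pi * \<i>) * z * (- (inverse z * inverse z) * (a * p + b * q) + inverse z * Y)
      = symbol_gt1_deriv \<alpha> x"
  proof -
    have *: "c * z * (- (w * w) * X + w * Y) = - c * (w * X) + c * Y" if "z * w = 1" for c w X Y
    proof -
      have "c * z * (- (w * w) * X + w * Y) = c * (z * w) * (- (w * X) + Y)"
        by (simp add: algebra_simps)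
      then show ?thesis using that by (simp add: algebra_simps)
    qed
    have Y: "Y = - (of_real \<alpha> * (a * p' + 2 * b * z * q'))"
      by (simp add: Y_def algebra_simps)
    have "z * inverse z = 1" using z by simp
    then show ?thesis
      unfolding symbol_gt1_deriv_def symbol_gt1_def z_def[symmetric] a_def[symmetric] b_def[symmetric]
      unfolding of_real_diff of_real_1
        p_def[symmetric] q_def[symmetric] p'_def[symmetric] q'_def[symmetric] *[OF \<open>z * inverse z = 1\<close>] Y
      by (simp add: mult.assoc)
  qed
  finally show ?thesis .
qed

lemma continuous_on_symbol_gt1_deriv:
  assumes "1 < \<alpha>" shows "continuous_on A (symbol_gt1_deriv \<alpha>)"
proof -
  have "continuous_on A (\<lambda>x. symbol_gt1 \<alpha> (circ x))"
    using assms by (intro continuous_on_compose_circ continuous_on_symbol_gt1) simp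
  moreover have "continuous_on A (\<lambda>x. (1 - circ x) powr of_real (\<alpha> - 1))"
    "continuous_on A (\<lambda>x. (1 - (circ x)^2) powr of_real (\<alpha> - 1))"
    using continuous_on_compose_circ[OF continuous_on_one_minus_powr(1)[of "\<alpha> - 1"]]
      continuous_on_compose_circ[OF continuous_on_one_minus_powr(2)[of "\<alpha> - 1"]] assms by simp_all
  ultimately show ?thesis
    unfolding symbol_gt1_deriv_def[abs_def]
    by (intro continuous_on_add continuous_on_diff continuous_on_mult continuous_on_circ
        continuous_on_const continuous_on_id)
qed

lemma norm_symbol_gt1_deriv_le:
  assumes \<alpha>: "1 < \<alpha>" "\<alpha> < 2"
  shows "norm (symbol_gt1_deriv \<alpha> x) \<le> 8 * pi * norm (1 - circ x) powr (\<alpha> - 1)"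
proof -
  define z where "z = circ x"
  have z: "norm z = 1" by (simp add: z_def)
  define m where "m = norm (1 - z) powr (\<alpha> - 1)"
  have m: "0 \<le> m" by (simp add: m_def)
  have ab: "0 \<le> 2 - 2 / \<alpha>" "0 \<le> 2 / \<alpha> - 1" using \<alpha> by (simp_all add: field_simps)
  have "norm (symbol_gt1_deriv \<alpha> x) \<le> 2 * pi * norm (symbol_gt1 \<alpha> z) + 2 * pi * \<alpha> *
      ((2 - 2 / \<alpha>) * m + 2 * ((2 / \<alpha> - 1) * 2 powr - \<alpha>) * norm (1 - z^2) powr (\<alpha> - 1))"
  proof -
    have "norm (symbol_gt1_deriv \<alpha> x) \<le> norm (- (2 * of_real pi * \<i>) * symbol_gt1 \<alpha> z) +
       norm (2 * of_real pi * \<i> * of_real \<alpha> * (of_real (2 - 2 / \<alpha>) * (1 - z) powr of_real (\<alpha> - 1) +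
        2 * of_real ((2 / \<alpha> - 1) * 2 powr - \<alpha>) * z * (1 - z^2) powr of_real (\<alpha> - 1)))"
      unfolding symbol_gt1_deriv_def z_def by (rule norm_triangle_ineq4)
    also have "\<dots> = 2 * pi * norm (symbol_gt1 \<alpha> z) + 2 * pi * \<alpha> * norm (of_real (2 - 2 / \<alpha>) * (1 - z) powr of_real (\<alpha> - 1) +
        2 * of_real ((2 / \<alpha> - 1) * 2 powr - \<alpha>) * z * (1 - z^2) powr of_real (\<alpha> - 1))"
      using \<alpha> by (simp add: norm_mult del: of_real_diff of_real_mult of_real_divide)
    also have "\<dots> \<le> 2 * pi * norm (symbol_gt1 \<alpha> z) + 2 * pi * \<alpha> * (norm (of_real (2 - 2 / \<alpha>) * (1 - z) powr of_real (\<alpha> - 1)) +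
        norm (2 * of_real ((2 / \<alpha> - 1) * 2 powr - \<alpha>) * z * (1 - z^2) powr of_real (\<alpha> - 1)))"
      using \<alpha> by (intro add_left_mono mult_left_mono norm_triangle_ineq) auto
    also have "\<dots> = 2 * pi * norm (symbol_gt1 \<alpha> z) + 2 * pi * \<alpha> *
      ((2 - 2 / \<alpha>) * m + 2 * ((2 / \<alpha> - 1) * 2 powr - \<alpha>) * norm (1 - z^2) powr (\<alpha> - 1))"
      using \<alpha> ab z by (simp add: norm_mult norm_powr_of_real m_def del: of_real_diff of_real_mult of_real_divide)
    finally show ?thesis .
  qed
  also have "\<dots> \<le> 2 * pi * (2 * m) + 2 * pi * \<alpha> * ((2 - 2 / \<alpha>) * m + (2 / \<alpha> - 1) * m)"
  proof (intro add_mono mult_left_mono)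
    have "norm (1 - z) \<le> 2" using norm_triangle_ineq4[of 1 z] z by simp
    then have "norm (1 - z) * m \<le> 2 * m" using m by (intro mult_right_mono)
    moreover have "norm (1 - z) powr \<alpha> = norm (1 - z) * m"
      unfolding m_def using powr_mult_base[of "norm (1 - z)" "\<alpha> - 1"] by simp
    ultimately show "norm (symbol_gt1 \<alpha> z) \<le> 2 * m"
      using norm_symbol_gt1_le[OF \<alpha> z] by linarith
    have "(2::real) powr - (\<alpha> - 1) = 2 * 2 powr - \<alpha>"
      by (simp add: powr_diff powr_minus field_simps)
    then have "2 * 2 powr - \<alpha> * norm (1 - z^2) powr (\<alpha> - 1) \<le> m"
      using powr_norm_one_minus_square_le[of z "\<alpha> - 1"] z \<alpha> by (simp add: m_def)
    then have "(2 / \<alpha> - 1) * (2 * 2 powr - \<alpha> * norm (1 - z^2) powr (\<alpha> - 1)) \<le> (2 / \<alpha> - 1) * m"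
      using ab by (intro mult_left_mono)
    then show "2 * ((2 / \<alpha> - 1) * 2 powr - \<alpha>) * norm (1 - z^2) powr (\<alpha> - 1) \<le> (2 / \<alpha> - 1) * m"
      by (simp only: mult_ac)
  qed (use \<alpha> ab in auto)
  also have "\<dots> = 2 * pi * (2 + \<alpha>) * m" by (simp add: algebra_simps)
  also have "\<dots> \<le> 2 * pi * 4 * m" using \<alpha> m by (intro mult_right_mono mult_left_mono) auto
  finally show ?thesis by (simp add: m_def z_def mult_ac)
qed

lemma norm_exp_minus_one_le:
  assumes "Re w \<le> 0" shows "norm (exp w - 1) \<le> norm w"
proof -
  have "norm (exp w - exp 0) \<le> 1 * norm (w - 0)"
  proof (rule field_differentiable_bound[of "{z. Re z \<le> 0}"])
    show "convex {z. Re z \<le> 0}" by (rule convex_halfspace_Re_le)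
    show "(exp has_field_derivative exp z) (at z within {z. Re z \<le> 0})" for z :: complex
      by (rule DERIV_subset[OF DERIV_exp]) simp
  qed (use assms in auto)
  then show ?thesis by simp
qed

text \<open>
  Comparison with a plain exponential avoids the Gamma integral: \<open>v \<le> 1 + v\<^sup>\<alpha>\<close> for \<open>v \<ge> 0\<close>.
\<close>

lemma exp_powr_le_exp_linear:
  fixes y s \<alpha> :: real
  assumes "0 < s" "1 < \<alpha>" "0 \<le> y"
  shows "exp (- s * y powr \<alpha>) \<le> exp 1 * exp (- (s powr (1 / \<alpha>) * y))"
proof -
  define v where "v = s powr (1 / \<alpha>) * y"
  have v: "0 \<le> v" using assms by (simp add: v_def)
  have "v powr \<alpha> = s * y powr \<alpha>"
    using assms by (simp add: v_def powr_mult powr_powr)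
  moreover have "v \<le> 1 + v powr \<alpha>"
  proof (cases "v \<le> 1")
    case False
    then have "v powr 1 \<le> v powr \<alpha>" using assms by (intro powr_mono) auto
    then show ?thesis using v by simp
  qed (simp add: add_increasing2)
  ultimately show ?thesis by (simp add: v_def flip: exp_add)
qed

lemma exp_linear_integral:
  fixes m :: real
  assumes "0 < m"
  shows "((\<lambda>y. exp (- (m * y))) has_integral (1 - exp (- m)) / m) {0..1}"
proof -
  have "((\<lambda>y. exp (- (m * y))) has_integral (- exp (- (m * 1)) / m) - (- exp (- (m * 0)) / m)) {0..1}"
    using assms by (intro fundamental_theorem_of_calculus)
      (auto intro!: derivative_eq_intros simp flip: has_real_derivative_iff_has_vector_derivative)
  moreover have "(- exp (- (m * 1)) / m) - (- exp (- (m * 0)) / m) = (1 - exp (- m)) / m"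
    using assms by (simp add: field_simps)
  ultimately show ?thesis by simp
qed

lemma integral_circle_stretched_exp_le:
  fixes h :: "real \<Rightarrow> real"
  assumes h: "continuous_on {0..1} h" and \<alpha>: "1 < \<alpha>" and s: "0 < s" and K: "0 \<le> K"
    and le: "\<And>x. h x \<le> K * exp (- s * norm (1 - circ x) powr \<alpha>)"
  shows "integral {0..1} h \<le> K * exp 1 / s powr (1 / \<alpha>)"
proof -
  define m where "m = s powr (1 / \<alpha>)"
  have m: "0 < m" using s by (simp add: m_def)
  have "integral {0..1} h \<le> (K * exp 1) * ((1 - exp (- m)) / m)"
  proof (rule integral_circle_le[OF exp_linear_integral[OF m] h, of 1])
    fix x :: real
    have "h x \<le> K * (exp 1 * exp (- (m * norm (1 - circ x))))"
      unfolding m_def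
      by (rule order.trans[OF le]) (intro mult_left_mono exp_powr_le_exp_linear s \<alpha> K norm_ge_zero)
    then show "h x \<le> K * exp 1 * exp (- (m * norm (1 - of_real 1 * circ x)))" by (simp add: mult.assoc)
  qed (use m K in auto)
  also have "\<dots> \<le> (K * exp 1) * (1 / m)"
    using m K by (intro mult_left_mono divide_right_mono) auto
  finally show ?thesis by (simp add: m_def)
qed

lemma integral_unit_interval_le:
  fixes h :: "real \<Rightarrow> real"
  assumes "continuous_on {0..1} h" "\<And>x. h x \<le> K"
  shows "integral {0..1} h \<le> K"
proof -
  have "(h has_integral integral {0..1} h) {0..1}"
    by (intro integrable_integral integrable_continuous_real assms)
  moreover have "((\<lambda>x. K) has_integral K) {0..1::real}"
    using has_integral_const_real[of K 0 1] by simp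
  ultimately show ?thesis by (rule has_integral_le) (use assms in auto)
qed

text \<open>
  The constant \<open>d\<close> does not change the derivative; it is \<open>1\<close> in the estimate of
  \<open>exp (t \<Phi>) - 1\<close>.
\<close>

lemma symbol_gt1_expk_coeff_derivative:
  fixes t :: real
  assumes \<alpha>: "1 < \<alpha>"
  defines "u \<equiv> \<lambda>x. of_real t * symbol_gt1 \<alpha> (circ x)"
  shows "circ_coeff (\<lambda>x. of_real t * symbol_gt1_deriv \<alpha> x * ((1 + \<kappa> * u x) * exp (u x))) n
     = 2 * of_real pi * \<i> * of_int n * circ_coeff (\<lambda>x. expk \<kappa> (u x) - d) n"
proof (rule circ_coeff_derivative[of _ "{1/2}"])
  have cu: "continuous_on {0..1} u"
    unfolding u_def using \<alpha> by (intro continuous_intros continuous_on_compose_circ continuous_on_symbol_gt1) auto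
  show "continuous_on {0..1} (\<lambda>x. expk \<kappa> (u x) - d)"
    by (intro continuous_intros cu)
  show "continuous_on {0..1} (\<lambda>x. of_real t * symbol_gt1_deriv \<alpha> x * ((1 + \<kappa> * u x) * exp (u x)))"
    by (intro continuous_intros continuous_on_symbol_gt1_deriv cu \<alpha>)
  show "expk \<kappa> (u 1) - d = expk \<kappa> (u 0) - d"
    using circ_of_int[of 1] by (simp add: u_def)
  fix x :: real assume x: "x \<in> {0<..<1} - {1/2}"
  have "(u has_vector_derivative of_real t * symbol_gt1_deriv \<alpha> x) (at x)"
    unfolding u_def using x by (intro has_vector_derivative_mult_right symbol_gt1_has_vector_derivative) auto
  moreover have "(expk \<kappa> has_field_derivative (1 + \<kappa> * u x) * exp (u x) * 1) (at (u x))"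
    by (rule expk_has_field_derivative[of "\<lambda>z. z"]) (rule DERIV_ident)
  ultimately have "(expk \<kappa> \<circ> u has_vector_derivative
      of_real t * symbol_gt1_deriv \<alpha> x * ((1 + \<kappa> * u x) * exp (u x) * 1)) (at x)"
    by (rule field_vector_diff_chain_at)
  then have "((\<lambda>x. expk \<kappa> (u x) - d) has_vector_derivative
      of_real t * symbol_gt1_deriv \<alpha> x * ((1 + \<kappa> * u x) * exp (u x) * 1) - 0) (at x)"
    unfolding o_def by (intro has_vector_derivative_diff has_vector_derivative_const)
  then show "((\<lambda>x. expk \<kappa> (u x) - d) has_vector_derivative
      of_real t * symbol_gt1_deriv \<alpha> x * ((1 + \<kappa> * u x) * exp (u x))) (at x)" by simp
qed simp

text \<open>
  Let \<open>\<mu> = t\<^sup>1\<^sup>/\<^sup>\<alpha>\<close>. For \<open>t \<ge> 1\<close> the mean square of the function is \<open>O(1 / \<mu>)\<close>, and that of its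
  derivative is \<open>O(\<mu>)\<close>: the square of \<open>t |1 - z|\<^sup>\<alpha>\<^sup>-\<^sup>1\<close> equals \<open>\<mu>\<^sup>2\<close> times a power with exponent
  \<open>2 - 2/\<alpha> < 1\<close> of \<open>t |1 - z|\<^sup>\<alpha>\<close>, and this power is absorbed by the exponential. Bernstein's
  inequality with parameter \<open>\<mu>\<close> is then independent of \<open>t\<close>. For \<open>t \<le> 1\<close>, and for \<open>exp (t \<Phi>) - 1\<close>,
  uniform bounds suffice, with parameter \<open>1\<close>.
\<close>

theorem symbol_gt1_semigroup_coeffs:
  assumes \<alpha>: "1 < \<alpha>" "\<alpha> < 2"
  obtains C where "0 \<le> C"
    "\<And>t \<kappa> F. 0 < t \<Longrightarrow> \<kappa> \<in> {0, 1} \<Longrightarrow> finite F \<Longrightarrow>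
      (\<Sum>n\<in>F. norm (circ_coeff (\<lambda>x. expk \<kappa> (of_real t * symbol_gt1 \<alpha> (circ x))) n)) \<le> C"
    "\<And>t F. 0 < t \<Longrightarrow> finite F \<Longrightarrow>
      (\<Sum>n\<in>F. norm (circ_coeff (\<lambda>x. exp (of_real t * symbol_gt1 \<alpha> (circ x)) - 1) n)) \<le> C * t"
proof -
  define \<delta> where "\<delta> = 2 * (\<alpha> - 1)^2 / \<alpha>"
  have \<delta>: "0 < \<delta>" using \<alpha> by (simp add: \<delta>_def)
  define K where "K = 1 + 4 * 1 / \<delta>"
  have K: "1 \<le> K" using \<delta> by (simp add: K_def)
  define c where "c = (\<delta> / 4) powr (1 / \<alpha>)"
  have c: "0 < c" using \<delta> by (simp add: c_def)
  define C1 where "C1 = K^2 * exp 1 / c"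
  define C2 where "C2 = (8 * pi * K)^2 * K * exp 1 / c"
  define S1 where "S1 = sqrt (5 * (C1 + C2))"
  define S2 where "S2 = sqrt (5 * (K^2 + (16 * pi * K)^2))"
  define S3 where "S3 = sqrt (5 * (16 + (16 * pi * K)^2))"
  define C where "C = S1 + S2 + S3"
  have C12: "0 \<le> C1" "0 \<le> C2" using c K by (auto simp: C1_def C2_def)
  define u where "u t x = of_real t * symbol_gt1 \<alpha> (circ x)" for t x
  define D where "D t \<kappa> x = of_real t * symbol_gt1_deriv \<alpha> x * ((1 + \<kappa> * u t x) * exp (u t x))" for t \<kappa> x
  define \<rho> where "\<rho> x = norm (1 - circ x) powr \<alpha>" for x
  have \<rho>: "0 \<le> \<rho> x" for x by (simp add: \<rho>_def)
  have le2: "norm (1 - circ x) \<le> 2" for x using norm_triangle_ineq4[of 1 "circ x"] by simp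
  define d where "d t x = exp (- (\<delta> * (t * \<rho> x) / 4))" for t x
  have cu: "continuous_on {0..1} (u t)" for t
    unfolding u_def using \<alpha> by (intro continuous_intros continuous_on_compose_circ continuous_on_symbol_gt1) auto
  have cf: "continuous_on {0..1} (\<lambda>x. expk \<kappa> (u t x) - d)" for t \<kappa> d
    by (intro continuous_intros cu)
  have cD: "continuous_on {0..1} (D t \<kappa>)" for t \<kappa>
    unfolding D_def by (intro continuous_intros continuous_on_symbol_gt1_deriv cu \<alpha>)
  have coeff: "circ_coeff (D t \<kappa>) n = 2 * of_real pi * \<i> * of_int n * circ_coeff (\<lambda>x. expk \<kappa> (u t x) - d) n" for t \<kappa> d n
    unfolding D_def u_def by (rule symbol_gt1_expk_coeff_derivative[OF \<alpha>(1)])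
  have u_le: "Re (u t x) \<le> - (\<delta> * (t * \<rho> x))" "norm (u t x) \<le> 1 * (t * \<rho> x)" if "0 < t" for t x
    using mult_left_mono[OF Re_symbol_gt1_le[OF \<alpha>, of "circ x"], of t]
      mult_left_mono[OF norm_symbol_gt1_le[OF \<alpha>, of "circ x"], of t] that
    by (auto simp: u_def \<rho>_def \<delta>_def norm_mult mult_ac)
  have d_le1: "d t x \<le> 1" if "0 < t" for t x
    using \<delta> that \<rho>[of x] by (simp add: d_def)
  have d0: "0 \<le> d t x" for t x by (simp add: d_def)
  have lin: "norm ((a + k * u t x) * exp (u t x)) \<le> K * d t x"
    if "0 < t" "norm a \<le> 1" "norm k \<le> 1" for t a k x
  proof -
    have "norm ((a + k * u t x) * exp (u t x)) = norm ((a + k * u t x) * exp (u t x / 2)) * norm (exp (u t x / 2))"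
      by (simp add: norm_mult mult.assoc flip: exp_add)
    also have "\<dots> \<le> (K * d t x) * 1"
    proof (rule mult_mono)
      show "norm ((a + k * u t x) * exp (u t x / 2)) \<le> K * d t x"
        unfolding K_def d_def using u_le[OF that(1), of x] \<delta> that \<rho>
        by (intro norm_linear_times_exp_half_le) auto
      have "0 \<le> \<delta> * (t * \<rho> x)" using \<delta> that \<rho>[of x] by simp
      then have "Re (u t x) \<le> 0" using u_le(1)[OF that(1), of x] by linarith
      then show "norm (exp (u t x / 2)) \<le> 1" by simp
    qed (use K d0 in auto)
    finally show ?thesis by simp
  qed
  have f_le: "norm (expk \<kappa> (u t x)) \<le> K * d t x" if "0 < t" "\<kappa> \<in> {0, 1}" for t \<kappa> x
    unfolding expk_def using that by (intro lin) auto
  have D_le: "norm (D t \<kappa> x) \<le> t * (8 * pi * norm (1 - circ x) powr (\<alpha> - 1)) * (K * d t x)"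
    if "0 < t" "\<kappa> \<in> {0, 1}" for t \<kappa> x
    unfolding D_def norm_mult[of "of_real t * symbol_gt1_deriv \<alpha> x"] norm_mult[of "of_real t"]
    using that norm_symbol_gt1_deriv_le[OF \<alpha>, of x] K by (intro mult_mono lin) auto
  have D_le2: "norm (D t \<kappa> x) \<le> 16 * pi * K * t" if "0 < t" "\<kappa> \<in> {0, 1}" for t \<kappa> x
  proof -
    have "norm (1 - circ x) powr (\<alpha> - 1) \<le> 2 powr (\<alpha> - 1)"
      using \<alpha> le2 by (intro powr_mono2) auto
    also have "\<dots> \<le> 2 powr 1" using \<alpha> by (intro powr_mono) auto
    finally have "norm (1 - circ x) powr (\<alpha> - 1) \<le> 2" by simp
    then have "t * (8 * pi * norm (1 - circ x) powr (\<alpha> - 1)) * (K * d t x)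
        \<le> t * (8 * pi * 2) * (K * 1)"
      using that K d0 by (intro mult_mono d_le1) auto
    with D_le[OF that, of x] show ?thesis by (simp add: mult_ac)
  qed
  have large: "(\<Sum>n\<in>F. norm (circ_coeff (\<lambda>x. expk \<kappa> (u t x)) n)) \<le> S1"
    if t: "1 \<le> t" and \<kappa>: "\<kappa> \<in> {0, 1}" and F: "finite F" for t \<kappa> F
  proof -
    have t0: "0 < t" using t by simp
    define \<mu> where "\<mu> = t powr (1 / \<alpha>)"
    have \<mu>: "1 \<le> \<mu>" unfolding \<mu>_def using t \<alpha> by (intro ge_one_powr_ge_zero) auto
    have s: "0 < \<delta> * t / 4" "(\<delta> * t / 4) powr (1 / \<alpha>) = c * \<mu>"
      using \<delta> t0 by (auto simp: c_def \<mu>_def simp flip: powr_mult)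
    have A: "integral {0..1} (\<lambda>x. (norm (expk \<kappa> (u t x)))^2) \<le> C1 / \<mu>"
    proof -
      have "integral {0..1} (\<lambda>x. (norm (expk \<kappa> (u t x)))^2) \<le> K^2 * exp 1 / (\<delta> * t / 4) powr (1 / \<alpha>)"
      proof (rule integral_circle_stretched_exp_le[OF _ \<alpha>(1) s(1)])
        fix x
        have "(norm (expk \<kappa> (u t x)))^2 \<le> (K * d t x)^2"
          by (intro power_mono f_le t0 \<kappa>) auto
        also have "\<dots> \<le> K^2 * (d t x * 1)"
          unfolding power_mult_distrib power2_eq_square[of "d t x"] using d0 by (intro mult_left_mono d_le1 t0) auto
        finally show "(norm (expk \<kappa> (u t x)))^2 \<le> K^2 * exp (- (\<delta> * t / 4) * norm (1 - circ x) powr \<alpha>)"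
          by (simp add: d_def \<rho>_def mult_ac)
      qed (intro continuous_intros cu, simp)
      then show ?thesis unfolding s by (simp add: C1_def)
    qed
    have B: "integral {0..1} (\<lambda>x. (norm (D t \<kappa> x))^2) \<le> C2 * \<mu>"
    proof -
      have "integral {0..1} (\<lambda>x. (norm (D t \<kappa> x))^2) \<le> ((8 * pi * K)^2 * K * \<mu>^2) * exp 1 / (\<delta> * t / 4) powr (1 / \<alpha>)"
      proof (rule integral_circle_stretched_exp_le[OF _ \<alpha>(1) s(1)])
        fix x
        define \<tau> where "\<tau> = t * \<rho> x"
        have \<tau>: "0 \<le> \<tau>" using t0 \<rho>[of x] by (simp add: \<tau>_def)
        have "t powr (2 / \<alpha>) * t powr (2 - 2 / \<alpha>) = t^2"
          using t0 by (simp flip: powr_add)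
        moreover have "\<mu>^2 = t powr (2 / \<alpha>)"
          using t0 by (simp add: \<mu>_def powr_power)
        moreover have "(norm (1 - circ x) powr (\<alpha> - 1))^2 = \<rho> x powr (2 - 2 / \<alpha>)"
          using \<alpha> by (simp add: \<rho>_def powr_powr power2_eq_square algebra_simps flip: powr_add)
        ultimately have "(t * norm (1 - circ x) powr (\<alpha> - 1))^2 = \<mu>^2 * \<tau> powr (2 - 2 / \<alpha>)"
          using t0 by (simp add: \<tau>_def power_mult_distrib powr_mult \<rho> mult_ac)
        also have "\<tau> powr (2 - 2 / \<alpha>) \<le> 1 + \<tau>"
        proof (cases "\<tau> \<le> 1")
          case True
          then have "\<tau> powr (2 - 2 / \<alpha>) \<le> 1" using \<alpha> \<tau> by (intro powr_le1) (auto simp: field_simps)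
          then show ?thesis using \<tau> by simp
        next
          case False
          then have "\<tau> powr (2 - 2 / \<alpha>) \<le> \<tau> powr 1" using \<alpha> by (intro powr_mono) (auto simp: field_simps)
          then show ?thesis using \<tau> by simp
        qed
        finally have 1: "(t * norm (1 - circ x) powr (\<alpha> - 1))^2 \<le> \<mu>^2 * (1 + \<tau>)" by (simp add: mult_left_mono)
        have 2: "(1 + \<tau>) * exp (- (\<delta> * \<tau> / 4)) \<le> K"
        proof -
          have pos: "0 \<le> \<delta> * \<tau> / 4" using \<delta> \<tau> by simp
          have "1 + \<tau> = 1 * 1 + (4 / \<delta>) * (\<delta> * \<tau> / 4)" using \<delta> by simp
          also have "\<dots> \<le> 1 * exp (\<delta> * \<tau> / 4) + (4 / \<delta>) * exp (\<delta> * \<tau> / 4)"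
          proof (intro add_mono mult_left_mono)
            show "1 \<le> exp (\<delta> * \<tau> / 4)" using pos by simp
            show "\<delta> * \<tau> / 4 \<le> exp (\<delta> * \<tau> / 4)"
              using exp_ge_add_one_self[of "\<delta> * \<tau> / 4"] by linarith
          qed (use \<delta> in auto)
          also have "\<dots> = K * exp (\<delta> * \<tau> / 4)" by (simp add: K_def distrib_right)
          finally show ?thesis by (simp add: exp_minus divide_simps)
        qed
        have "(norm (D t \<kappa> x))^2 \<le> (t * (8 * pi * norm (1 - circ x) powr (\<alpha> - 1)) * (K * exp (- (\<delta> * \<tau> / 4))))^2"
          using D_le[OF t0 \<kappa>, of x] unfolding \<tau>_def d_def by (intro power_mono) auto
        also have "\<dots> = (8 * pi * K)^2 * ((t * norm (1 - circ x) powr (\<alpha> - 1))^2 * exp (- (\<delta> * \<tau> / 4))) * exp (- (\<delta> * \<tau> / 4))"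
          by (simp add: power2_eq_square mult_ac)
        also have "\<dots> \<le> (8 * pi * K)^2 * (\<mu>^2 * (1 + \<tau>) * exp (- (\<delta> * \<tau> / 4))) * exp (- (\<delta> * \<tau> / 4))"
          by (intro mult_right_mono mult_left_mono 1) auto
        also have "\<dots> = (8 * pi * K)^2 * \<mu>^2 * ((1 + \<tau>) * exp (- (\<delta> * \<tau> / 4))) * exp (- (\<delta> * \<tau> / 4))"
          by (simp add: mult_ac)
        also have "\<dots> \<le> (8 * pi * K)^2 * \<mu>^2 * K * exp (- (\<delta> * \<tau> / 4))"
          by (intro mult_right_mono mult_left_mono 2) auto
        finally show "(norm (D t \<kappa> x))^2 \<le> ((8 * pi * K)^2 * K * \<mu>^2) * exp (- (\<delta> * t / 4) * norm (1 - circ x) powr \<alpha>)"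
          by (simp add: \<tau>_def \<rho>_def mult_ac)
      qed (intro continuous_intros cD, use K in simp)
      also have "\<dots> = C2 * \<mu>"
        unfolding s using \<mu> c by (simp add: C2_def power2_eq_square field_simps)
      finally show ?thesis .
    qed
    have "(\<Sum>n\<in>F. norm (circ_coeff (\<lambda>x. expk \<kappa> (u t x)) n)) \<le> sqrt ((1 + 4 * \<mu>) * (C1 / \<mu> + C2 * \<mu> / \<mu>^2))"
      using coeff[of t \<kappa> _ 0] cf[of \<kappa> t 0] \<mu> by (intro Bernstein_coeff_sum_le[OF _ cD _ A B _ F]) auto
    also have "\<dots> \<le> sqrt ((5 * \<mu>) * (C1 / \<mu> + C2 * \<mu> / \<mu>^2))"
      using \<mu> C12 by (intro real_sqrt_le_mono mult_right_mono) auto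
    also have "(5 * \<mu>) * (C1 / \<mu> + C2 * \<mu> / \<mu>^2) = 5 * (C1 + C2)"
      using \<mu> by (simp add: power2_eq_square field_simps)
    finally show ?thesis unfolding S1_def .
  qed
  have small: "(\<Sum>n\<in>F. norm (circ_coeff (\<lambda>x. expk \<kappa> (u t x)) n)) \<le> S2"
    if t: "0 < t" "t \<le> 1" and \<kappa>: "\<kappa> \<in> {0, 1}" and F: "finite F" for t \<kappa> F
  proof -
    have A: "integral {0..1} (\<lambda>x. (norm (expk \<kappa> (u t x)))^2) \<le> K^2"
    proof (rule integral_unit_interval_le)
      fix x
      have "norm (expk \<kappa> (u t x)) \<le> K * 1"
        by (rule order.trans[OF f_le[OF t(1) \<kappa>]]) (use K t in \<open>intro mult_left_mono d_le1; simp\<close>)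
      then show "(norm (expk \<kappa> (u t x)))^2 \<le> K^2" by (intro power_mono) auto
    qed (intro continuous_intros cu)
    have B: "integral {0..1} (\<lambda>x. (norm (D t \<kappa> x))^2) \<le> (16 * pi * K)^2"
    proof (rule integral_unit_interval_le)
      fix x
      have "norm (D t \<kappa> x) \<le> 16 * pi * K * 1"
        by (rule order.trans[OF D_le2[OF t(1) \<kappa>]]) (use K t in \<open>intro mult_left_mono; simp\<close>)
      then show "(norm (D t \<kappa> x))^2 \<le> (16 * pi * K)^2" by (intro power_mono) auto
    qed (intro continuous_intros cD)
    have "(\<Sum>n\<in>F. norm (circ_coeff (\<lambda>x. expk \<kappa> (u t x)) n)) \<le> sqrt ((1 + 4 * 1) * (K^2 + (16 * pi * K)^2 / 1^2))"
      using coeff[of t \<kappa> _ 0] cf[of \<kappa> t 0] by (intro Bernstein_coeff_sum_le[OF _ cD _ A B _ F]) auto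
    then show ?thesis by (simp add: S2_def)
  qed
  have diff: "(\<Sum>n\<in>F. norm (circ_coeff (\<lambda>x. exp (u t x) - 1) n)) \<le> S3 * t"
    if t: "0 < t" and F: "finite F" for t F
  proof -
    have A: "integral {0..1} (\<lambda>x. (norm (exp (u t x) - 1))^2) \<le> (4 * t)^2"
    proof (rule integral_unit_interval_le)
      fix x
      have "0 \<le> \<delta> * (t * \<rho> x)" using \<delta> t \<rho>[of x] by simp
      then have "Re (u t x) \<le> 0" using u_le(1)[OF t, of x] by linarith
      then have "norm (exp (u t x) - 1) \<le> norm (u t x)" by (rule norm_exp_minus_one_le)
      also have "\<dots> \<le> 1 * (t * \<rho> x)" by (rule u_le(2)[OF t])
      also have "\<rho> x \<le> 2 powr \<alpha>" unfolding \<rho>_def using \<alpha> le2 by (intro powr_mono2) auto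
      also have "(2::real) powr \<alpha> \<le> 2 powr 2" using \<alpha> by (intro powr_mono) auto
      finally have "norm (exp (u t x) - 1) \<le> 4 * t" using t by (simp add: mult_ac)
      then show "(norm (exp (u t x) - 1))^2 \<le> (4 * t)^2" by (intro power_mono) auto
    qed (intro continuous_intros cu)
    have B: "integral {0..1} (\<lambda>x. (norm (D t 0 x))^2) \<le> (16 * pi * K * t)^2"
      by (rule integral_unit_interval_le) (intro continuous_intros cD power_mono D_le2 t; simp)+
    have "(\<Sum>n\<in>F. norm (circ_coeff (\<lambda>x. exp (u t x) - 1) n)) \<le> sqrt ((1 + 4 * 1) * ((4 * t)^2 + (16 * pi * K * t)^2 / 1^2))"
      using coeff[of t 0 _ 1] cf[of 0 t 1] by (intro Bernstein_coeff_sum_le[OF _ cD[of t 0] _ A B _ F]) (auto simp: expk_def)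
    also have "(1 + 4 * 1) * ((4 * t)^2 + (16 * pi * K * t)^2 / 1^2) = (5 * (16 + (16 * pi * K)^2)) * t^2"
      by (simp add: power_mult_distrib algebra_simps)
    finally show ?thesis using t by (simp add: S3_def real_sqrt_mult)
  qed
  have nn: "0 \<le> S1" "0 \<le> S2" "0 \<le> S3"
    using C12 by (auto simp: S1_def S2_def S3_def)
  show ?thesis
  proof (rule that[of C])
    show "0 \<le> C" using nn unfolding C_def by linarith
    show "(\<Sum>n\<in>F. norm (circ_coeff (\<lambda>x. expk \<kappa> (of_real t * symbol_gt1 \<alpha> (circ x))) n)) \<le> C"
      if "0 < t" "\<kappa> \<in> {0, 1}" "finite F" for t \<kappa> F
    proof (cases "1 \<le> t")
      case True
      then show ?thesis using large[OF True that(2,3)] nn unfolding C_def u_def by linarith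
    next
      case False
      then show ?thesis using small[OF that(1) _ that(2,3)] nn unfolding C_def u_def by linarith
    qed
    show "(\<Sum>n\<in>F. norm (circ_coeff (\<lambda>x. exp (of_real t * symbol_gt1 \<alpha> (circ x)) - 1) n)) \<le> C * t"
      if "0 < t" "finite F" for t F
    proof -
      have "S3 * t \<le> C * t"
        using nn that unfolding C_def by (intro mult_right_mono) linarith+
      then show ?thesis using diff[OF that] unfolding u_def by linarith
    qed
  qed
qed

section \<open>The semigroups\<close>

lemma translation_symbol_mono:
  "translation_symbol S M \<psi> \<Longrightarrow> M \<le> M' \<Longrightarrow> translation_symbol S M' \<psi>"
  unfolding translation_symbol_def by (meson order.trans)

lemma translation_symbol_const:
  assumes "0 \<in> S" "norm b \<le> M"
  shows "translation_symbol S M (\<lambda>k. b)"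
proof -
  have "(\<lambda>j. if j = 0 then b else 0) sums b" "(\<lambda>j. norm (if j = 0 then b else 0)) sums norm b"
    using sums_single[of 0 "\<lambda>j. b"] sums_single[of 0 "\<lambda>j. norm b"] by (simp_all add: if_distrib cong: if_cong)
  then show ?thesis
    unfolding translation_symbol_def using assms
    by (intro exI[of _ "\<lambda>j. if j = 0 then b else 0"] exI[of _ "\<lambda>j. 0"]) (auto simp: sums_iff)
qed

lemma translation_symbol_circle:
  fixes c :: "nat \<Rightarrow> complex" and d :: "nat \<Rightarrow> int"
  assumes "summable (\<lambda>j. norm (c j))" "(\<Sum>j. norm (c j)) \<le> M"
    and \<Phi>: "\<And>z. norm z = 1 \<Longrightarrow> \<Phi> z = (\<Sum>j. c j * z powi d j)"
    and S: "\<And>j. of_int (d j) * h \<in> S"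
  shows "translation_symbol S M (\<lambda>k. \<Phi> (exp (\<i> * of_real (k * h))))"
proof -
  have "exp (\<i> * of_real (k * h)) powi n = exp (\<i> * of_real (k * (of_int n * h)))" for k n
    by (simp add: cis_power_int mult_ac del: of_real_mult flip: cis_conv_exp)
  then have "\<Phi> (exp (\<i> * of_real (k * h))) =
      (\<Sum>j. c j * exp (\<i> * of_real (k * (of_int (d j) * h))))" for k
    by (simp add: \<Phi> del: of_real_mult)
  then show ?thesis
    unfolding translation_symbol_def using assms(1,2) S
    by (intro exI[of _ c] exI[of _ "\<lambda>j. of_int (d j) * h"]) blast
qed

text \<open>
  The estimates of this proof in one statement: bounds, uniform in \<open>t\<close> and \<open>h\<close>, for the semigroup, its
  time derivative multiplied by \<open>t\<close>, and its difference to the identity.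
\<close>

definition uniform_translation_symbols :: "real set \<Rightarrow> real \<Rightarrow> (complex \<Rightarrow> complex) \<Rightarrow> bool" where
  "uniform_translation_symbols S C \<Phi> \<longleftrightarrow> (\<forall>t>0. \<forall>h>0.
     (\<forall>\<kappa>\<in>{0, 1}. translation_symbol S C (\<lambda>k. expk \<kappa> (of_real t * \<Phi> (exp (\<i> * of_real (k * h)))))) \<and>
     translation_symbol S (C * t) (\<lambda>k. exp (of_real t * \<Phi> (exp (\<i> * of_real (k * h)))) - 1))"

text \<open>
  The scaling argument: \<open>t \<phi>\<^sub>h = \<tau> \<Phi>\<close> with \<open>\<tau> = t h\<^sup>-\<^sup>\<alpha>\<close>, and \<open>\<phi>\<^sub>h exp (t \<phi>\<^sub>h)\<close> is \<open>1 / t\<close> times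
  \<open>\<tau> \<Phi> exp (\<tau> \<Phi>)\<close>. Only the Lipschitz constant \<open>C h\<^sup>-\<^sup>\<alpha>\<close> depends on \<open>h\<close>.
\<close>

theorem uniformly_analytic_semigroups_from_symbol:
  fixes \<Phi> :: "complex \<Rightarrow> complex" and \<phi> :: "real \<Rightarrow> real \<Rightarrow> complex"
  defines "e \<equiv> \<lambda>h k. exp (\<i> * of_real (k * h))"
  assumes S: "0 \<in> S" and C: "0 \<le> C"
    and \<Phi>: "uniform_translation_symbols S C \<Phi>"
    and \<phi>: "\<And>h k. 0 < h \<Longrightarrow> \<phi> h k = of_real (h powr - \<alpha>) * \<Phi> (e h k)"
  shows "(\<forall>h>0. (\<forall>t\<ge>0. L1_multiplier (\<lambda>k. exp (complex_of_real t * \<phi> h k))) \<and>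
            strongly_continuous_semigroup_on (support_space S)
              (\<lambda>t. mult_op (\<lambda>k. exp (complex_of_real t * \<phi> h k)))) \<and>
         (\<exists>M>0. \<forall>h>0. \<forall>t\<ge>0.
            onorm_on (support_space S) (mult_op (\<lambda>k. exp (complex_of_real t * \<phi> h k))) \<le> M) \<and>
         (\<exists>M>0. \<forall>h>0. \<forall>t>0.
            L1_multiplier (\<lambda>k. \<phi> h k * exp (complex_of_real t * \<phi> h k)) \<and>
            bounded_operator_on (support_space S) (mult_op (\<lambda>k. \<phi> h k * exp (complex_of_real t * \<phi> h k))) \<and>
            onorm_on (support_space S) (mult_op (\<lambda>k. \<phi> h k * exp (complex_of_real t * \<phi> h k))) \<le> M / t)"
proof -
  have E: "translation_symbol S C (\<lambda>k. expk \<kappa> (of_real t * \<Phi> (e h k)))"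
    and L: "translation_symbol S (C * t) (\<lambda>k. exp (of_real t * \<Phi> (e h k)) - 1)"
    if "0 < t" "0 < h" "\<kappa> \<in> {0, 1}" for t h \<kappa>
    using \<Phi> that unfolding uniform_translation_symbols_def e_def by blast+
  define M where "M = C + 1"
  have M: "0 < M" "1 \<le> M" "C \<le> M" using C by (simp_all add: M_def)
  have scaled: "complex_of_real t * \<phi> h k = of_real (t * h powr - \<alpha>) * \<Phi> (e h k)" if "0 < h" for t h k
    by (simp add: \<phi>[OF that])
  have semi: "translation_symbol S M (\<lambda>k. exp (complex_of_real t * \<phi> h k))" if "0 < h" "0 \<le> t" for h t
  proof (cases "t = 0")
    case True
    then show ?thesis using translation_symbol_const[OF S, of 1 M] M by simp
  next
    case False
    then have "translation_symbol S C (\<lambda>k. expk 0 (of_real (t * h powr - \<alpha>) * \<Phi> (e h k)))"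
      using that by (intro E) auto
    then show ?thesis
      unfolding scaled[OF that(1)] by (intro translation_symbol_mono[OF _ M(3)]) (simp add: expk_def)
  qed
  have lip: "translation_symbol S (C * h powr - \<alpha> * t) (\<lambda>k. exp (complex_of_real t * \<phi> h k) - 1)"
    if "0 < h" "0 \<le> t" for h t
  proof (cases "t = 0")
    case True
    then show ?thesis using translation_symbol_const[OF S, of 0 0] by simp
  next
    case False
    then have "translation_symbol S (C * (t * h powr - \<alpha>)) (\<lambda>k. exp (of_real (t * h powr - \<alpha>) * \<Phi> (e h k)) - 1)"
      using that by (intro L[where \<kappa> = 0]) auto
    then show ?thesis unfolding scaled[OF that(1)] by (simp add: mult_ac)
  qed
  have deriv: "translation_symbol S (M / t) (\<lambda>k. \<phi> h k * exp (complex_of_real t * \<phi> h k))"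
    if "0 < h" "0 < t" for h t
  proof -
    have "translation_symbol S C (\<lambda>k. expk 1 (of_real (t * h powr - \<alpha>) * \<Phi> (e h k)))"
      using that by (intro E) auto
    then have "translation_symbol S (norm (complex_of_real (1 / t)) * C)
        (\<lambda>k. of_real (1 / t) * expk 1 (of_real (t * h powr - \<alpha>) * \<Phi> (e h k)))"
      by (rule translation_symbol_scale)
    moreover have "of_real (1 / t) * expk 1 (of_real (t * h powr - \<alpha>) * \<Phi> (e h k)) =
        \<phi> h k * exp (complex_of_real t * \<phi> h k)" for k
      unfolding scaled[OF that(1), symmetric] using that by (simp add: expk_def)
    moreover have "norm (complex_of_real (1 / t)) * C \<le> M / t"
      using that M by (simp add: norm_divide divide_right_mono)
    ultimately show ?thesis by (simp add: translation_symbol_mono)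
  qed
  show ?thesis
  proof (intro conjI allI impI exI[of _ M])
    fix h t :: real assume h: "0 < h"
    show "L1_multiplier (\<lambda>k. exp (complex_of_real t * \<phi> h k))" if "0 \<le> t"
      by (rule translation_symbol_multiplier[OF semi[OF h that]])
    show "strongly_continuous_semigroup_on (support_space S) (\<lambda>t. mult_op (\<lambda>k. exp (complex_of_real t * \<phi> h k)))"
      using M C by (intro strongly_continuous_semigroup_on_mult_op[OF semi[OF h] lip[OF h]]) auto
    show "onorm_on (support_space S) (mult_op (\<lambda>k. exp (complex_of_real t * \<phi> h k))) \<le> M" if "0 \<le> t"
      using M by (intro onorm_on_mult_op_le[OF semi[OF h that]]) auto
    show "L1_multiplier (\<lambda>k. \<phi> h k * exp (complex_of_real t * \<phi> h k))" if "0 < t"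
      by (rule translation_symbol_multiplier[OF deriv[OF h that]])
    show "bounded_operator_on (support_space S) (mult_op (\<lambda>k. \<phi> h k * exp (complex_of_real t * \<phi> h k)))" if "0 < t"
      by (rule bounded_operator_on_mult_op[OF deriv[OF h that]])
    show "onorm_on (support_space S) (mult_op (\<lambda>k. \<phi> h k * exp (complex_of_real t * \<phi> h k))) \<le> M / t" if "0 < t"
      using M that by (intro onorm_on_mult_op_le[OF deriv[OF h that]]) auto
  qed (use M in auto)
qed

text \<open>
  The coefficients of positive index are bounded already; that of index \<open>0\<close> is the value at \<open>z = 0\<close>,
  where \<open>\<Phi>(0) = 2\<^sup>-\<^sup>\<alpha> - 2\<close> is negative.
\<close>

lemma symbol_lt1_translation_symbols:
  assumes \<alpha>: "0 < \<alpha>" "\<alpha> < 1"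
  obtains C where "0 \<le> C" "uniform_translation_symbols {0..} C (symbol_lt1 \<alpha>)"
proof -
  obtain C where C: "0 \<le> C" and coeffs: "\<And>t \<kappa> N. 0 < t \<Longrightarrow> \<kappa> \<in> {0, 1} \<Longrightarrow>
      (\<Sum>n<N. norm (fps_nth (fps_expansion (\<lambda>z. expk \<kappa> (of_real t * symbol_lt1 \<alpha> z)) 0) (Suc n))) \<le> C * min 1 t"
    using symbol_lt1_semigroup_coeffs[OF \<alpha>] by metis
  define c where "c t \<kappa> = fps_nth (fps_expansion (\<lambda>z. expk \<kappa> (of_real t * symbol_lt1 \<alpha> z)) 0)" for t :: real and \<kappa>
  have sm_Suc: "summable (\<lambda>n. norm (c t \<kappa> (Suc n)))" and sum_Suc: "(\<Sum>n. norm (c t \<kappa> (Suc n))) \<le> C * min 1 t"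
    if "0 < t" "\<kappa> \<in> {0, 1}" for t \<kappa>
  proof -
    show "summable (\<lambda>n. norm (c t \<kappa> (Suc n)))"
      by (rule bounded_imp_summable[of _ "C * min 1 t"])
        (use coeffs[OF that, of "Suc n" for n] in \<open>simp_all only: c_def norm_ge_zero lessThan_Suc_atMost\<close>)
    then show "(\<Sum>n. norm (c t \<kappa> (Suc n))) \<le> C * min 1 t"
      using coeffs[OF that] by (intro suminf_le_const) (auto simp: c_def)
  qed
  have sm: "summable (\<lambda>n. norm (c t \<kappa> n))" if "0 < t" "\<kappa> \<in> {0, 1}" for t \<kappa>
    using sm_Suc[OF that] by (simp add: summable_Suc_iff[of "\<lambda>n. norm (c t \<kappa> n)"])
  have series: "(\<lambda>n. c t \<kappa> n * z ^ n) sums expk \<kappa> (of_real t * symbol_lt1 \<alpha> z)"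
    if "0 < t" "\<kappa> \<in> {0, 1}" "norm z \<le> 1" for t \<kappa> z
    unfolding c_def
  proof (rule closed_disc_power_series[OF _ _ _ that(3)])
    show "continuous_on (cball 0 1) (\<lambda>z. expk \<kappa> (of_real t * symbol_lt1 \<alpha> z))"
      by (intro continuous_intros continuous_on_symbol_lt1 \<alpha>)
    have "((\<lambda>z. expk \<kappa> (of_real t * symbol_lt1 \<alpha> z)) field_differentiable at z within ball 0 1)"
      if "z \<in> ball 0 1" for z
    proof -
      have "norm z < 1" using that by simp
      note DERIV_cmult[OF has_field_derivative_at_within[OF symbol_lt1_has_field_derivative[OF this]], of "of_real t"]
      from expk_has_field_derivative[OF this] show ?thesis
        unfolding field_differentiable_def by blast
    qed
    then show "(\<lambda>z. expk \<kappa> (of_real t * symbol_lt1 \<alpha> z)) holomorphic_on ball 0 1"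
      by (rule holomorphic_onI)
    show "summable (\<lambda>n. norm (fps_nth (fps_expansion (\<lambda>z. expk \<kappa> (of_real t * symbol_lt1 \<alpha> z)) 0) n))"
      using sm[OF that(1,2)] by (simp add: c_def)
  qed
  define m where "m = 2 - 2 powr - \<alpha>"
  have m: "0 < m" "m \<le> 2" using \<alpha> powr_less_one[of 2 "- \<alpha>"] by (auto simp: m_def)
  have c0: "c t \<kappa> 0 = expk \<kappa> (of_real (- (t * m)))" if "0 < t" "\<kappa> \<in> {0, 1}" for t \<kappa>
    using sums_unique2[OF series[OF that, of 0] powser_sums_zero] by (simp add: symbol_lt1_def m_def algebra_simps)
  have c0_le: "norm (c t \<kappa> 0) \<le> 1" if "0 < t" "\<kappa> \<in> {0, 1}" for t \<kappa>
  proof -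
    have tm: "0 < t * m" using that m by simp
    have "t * m * exp (- (t * m)) \<le> exp (t * m) * exp (- (t * m))"
      using exp_ge_add_one_self[of "t * m"] by (intro mult_right_mono) (linarith, simp)
    then have "t * m * exp (- (t * m)) \<le> 1" by (simp flip: exp_add)
    then show ?thesis using that tm m unfolding c0[OF that]
      by (auto simp: expk_def norm_mult abs_mult simp del: of_real_minus of_real_mult)
  qed
  have c0_diff_le: "norm (c t 0 0 - 1) \<le> 2 * t" if "0 < t" for t
  proof -
    have "norm (c t 0 0 - 1) \<le> norm (complex_of_real (- (t * m)))"
      unfolding c0[OF that insertI1] expk_def using that m
      by (simp add: norm_exp_minus_one_le del: of_real_minus of_real_mult norm_of_real)
    also have "\<dots> = t * m" using that m by (simp del: of_real_minus of_real_mult)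
    also have "\<dots> \<le> t * 2" using that m by (intro mult_left_mono) auto
    finally show ?thesis by simp
  qed
  have "uniform_translation_symbols {0..} (C + 2) (symbol_lt1 \<alpha>)"
    unfolding uniform_translation_symbols_def
  proof (intro allI impI conjI ballI)
    show "translation_symbol {0..} (C + 2) (\<lambda>k. expk \<kappa> (of_real t * symbol_lt1 \<alpha> (exp (\<i> * of_real (k * h)))))"
      if t: "0 < t" and h: "0 < h" and \<kappa>: "\<kappa> \<in> {0, 1}" for t h \<kappa>
    proof (rule translation_symbol_circle[OF sm[OF t \<kappa>], where d = int])
      have "(\<Sum>n. norm (c t \<kappa> n)) = norm (c t \<kappa> 0) + (\<Sum>n. norm (c t \<kappa> (Suc n)))"
        using suminf_split_head[OF sm[OF t \<kappa>]] by simp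
      also have "\<dots> \<le> 1 + C * min 1 t"
        by (intro add_mono c0_le sum_Suc t \<kappa>)
      also have "\<dots> \<le> C + 2" using C mult_left_mono[of "min 1 t" 1 C] by simp
      finally show "(\<Sum>n. norm (c t \<kappa> n)) \<le> C + 2" .
      show "expk \<kappa> (of_real t * symbol_lt1 \<alpha> z) = (\<Sum>n. c t \<kappa> n * z powi int n)" if "norm z = 1" for z
        using series[OF t \<kappa>, of z] that by (simp add: sums_iff)
    qed (use h in auto)
    show "translation_symbol {0..} ((C + 2) * t) (\<lambda>k. exp (of_real t * symbol_lt1 \<alpha> (exp (\<i> * of_real (k * h)))) - 1)"
      if t: "0 < t" and h: "0 < h" for t h
    proof -
      define c' where "c' n = (if n = 0 then c t 0 0 - 1 else c t 0 n)" for n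
      have Suc': "c' (Suc n) = c t 0 (Suc n)" for n by (simp add: c'_def)
      have \<kappa>: "(0::complex) \<in> {0, 1}" by simp
      have sm': "summable (\<lambda>n. norm (c' n))"
        using sm_Suc[OF t \<kappa>] summable_Suc_iff[of "\<lambda>n. norm (c' n)"] by (simp add: Suc')
      show ?thesis
      proof (rule translation_symbol_circle[OF sm', where d = int])
        have "(\<Sum>n. norm (c' n)) = norm (c t 0 0 - 1) + (\<Sum>n. norm (c t 0 (Suc n)))"
          using suminf_split_head[OF sm'] by (simp add: Suc') (simp add: c'_def)
        also have "\<dots> \<le> 2 * t + C * min 1 t"
          by (intro add_mono c0_diff_le sum_Suc t \<kappa>)
        also have "\<dots> \<le> (C + 2) * t" using C mult_left_mono[of "min 1 t" t C] by (simp add: algebra_simps)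
        finally show "(\<Sum>n. norm (c' n)) \<le> (C + 2) * t" .
        show "exp (of_real t * symbol_lt1 \<alpha> z) - 1 = (\<Sum>n. c' n * z powi int n)" if "norm z = 1" for z
        proof -
          have "(\<lambda>n. c t 0 n * z ^ n - (if n = 0 then 1 else 0)) sums (expk 0 (of_real t * symbol_lt1 \<alpha> z) - 1)"
            using series[OF t \<kappa>, of z] sums_single[of 0 "\<lambda>n. 1 :: complex"] that
            by (intro sums_diff) (auto simp: if_distrib cong: if_cong)
          moreover have "c t 0 n * z ^ n - (if n = 0 then 1 else 0) = c' n * z powi int n" for n
            by (simp add: c'_def)
          ultimately show ?thesis by (simp add: sums_iff expk_def)
        qed
      qed (use h in auto)
    qed
  qed
  then show ?thesis by (rule that[rotated]) (use C in simp)
qed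

lemma symbol_gt1_translation_symbols:
  assumes \<alpha>: "1 < \<alpha>" "\<alpha> < 2"
  obtains C where "0 \<le> C" "uniform_translation_symbols UNIV C (symbol_gt1 \<alpha>)"
proof -
  obtain C where C: "0 \<le> C"
    and E: "\<And>t \<kappa> F. 0 < t \<Longrightarrow> \<kappa> \<in> {0, 1} \<Longrightarrow> finite F \<Longrightarrow>
      (\<Sum>n\<in>F. norm (circ_coeff (\<lambda>x. expk \<kappa> (of_real t * symbol_gt1 \<alpha> (circ x))) n)) \<le> C"
    and L: "\<And>t F. 0 < t \<Longrightarrow> finite F \<Longrightarrow>
      (\<Sum>n\<in>F. norm (circ_coeff (\<lambda>x. exp (of_real t * symbol_gt1 \<alpha> (circ x)) - 1) n)) \<le> C * t"
    using symbol_gt1_semigroup_coeffs[OF \<alpha>] by metis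
  have cont: "continuous_on (sphere 0 1) (symbol_gt1 \<alpha>)"
    using \<alpha> by (intro continuous_on_symbol_gt1) simp
  have circle: "translation_symbol UNIV M (\<lambda>k. \<Psi> (exp (\<i> * of_real (k * h))))"
    if "continuous_on (sphere 0 1) \<Psi>" "\<And>F. finite F \<Longrightarrow> (\<Sum>n\<in>F. norm (circ_coeff (\<lambda>x. \<Psi> (circ x)) n)) \<le> M"
    for \<Psi> M h
    by (rule translation_symbol_circle[OF circle_Fourier_series[OF that]]) auto
  have "uniform_translation_symbols UNIV C (symbol_gt1 \<alpha>)"
    unfolding uniform_translation_symbols_def
  proof (intro allI impI conjI ballI)
    show "translation_symbol UNIV C (\<lambda>k. expk \<kappa> (of_real t * symbol_gt1 \<alpha> (exp (\<i> * of_real (k * h)))))"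
      if "0 < t" "\<kappa> \<in> {0, 1}" for t h \<kappa>
      by (rule circle) (intro continuous_intros cont, rule E[OF that])
    show "translation_symbol UNIV (C * t) (\<lambda>k. exp (of_real t * symbol_gt1 \<alpha> (exp (\<i> * of_real (k * h)))) - 1)"
      if "0 < t" for t h
      by (rule circle) (intro continuous_intros cont, rule L[OF that])
  qed
  then show ?thesis by (rule that[OF C])
qed

lemma phi_symbol_lt1:
  assumes "0 < h"
  shows "phi \<alpha> 0 2 0 0 h k = of_real (h powr - \<alpha>) * symbol_lt1 \<alpha> (exp (\<i> * of_real (k * h)))"
proof -
  have "exp (\<i> * of_real (k * (2 * h))) = (exp (\<i> * of_real (k * h)))^2"
    by (simp add: power2_eq_square mult_ac flip: exp_add)
  moreover have "(2 * h) powr - \<alpha> = 2 powr - \<alpha> * h powr - \<alpha>"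
    using assms by (simp add: powr_mult)
  ultimately show ?thesis
    by (simp add: phi_def psi_def symbol_lt1_def algebra_simps)
qed

lemma phi_symbol_gt1:
  assumes "0 < h"
  shows "phi \<alpha> 1 (2 - 2 / \<alpha>) 1 (1 / 2) h k = of_real (h powr - \<alpha>) * symbol_gt1 \<alpha> (exp (\<i> * of_real (k * h)))"
proof -
  have "exp (\<i> * of_real (k * (2 * h))) = (exp (\<i> * of_real (k * h)))^2"
    by (simp add: power2_eq_square mult_ac flip: exp_add)
  moreover have "exp (- \<i> * of_real (1 * k * h)) = inverse (exp (\<i> * of_real (k * h)))"
    "exp (- \<i> * of_real (1 / 2 * k * (2 * h))) = inverse (exp (\<i> * of_real (k * h)))"
    by (simp_all add: exp_minus)
  moreover have "(2 * h) powr - \<alpha> = 2 powr - \<alpha> * h powr - \<alpha>"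
    using assms by (simp add: powr_mult)
  moreover have "1 - (2 - 2 / \<alpha>) = 2 / \<alpha> - 1" by simp
  ultimately show ?thesis
    unfolding phi_def psi_def symbol_gt1_def by (simp only: of_real_mult) (simp add: algebra_simps)
qed

theorem theorem4p5:
  fixes \<alpha> a p1 p2 :: real and q :: nat and X :: "L1R set"
  assumes "(0 < \<alpha> \<and> \<alpha> < 1 \<and> q = 0 \<and> a = 2 \<and> p1 = 0 \<and> p2 = 0 \<and> X = L1_Rplus) \<or>
           (1 < \<alpha> \<and> \<alpha> < 2 \<and> q = 1 \<and> a = 2 - 2 / \<alpha> \<and> p1 = 1 \<and> p2 = 1 / 2 \<and> X = UNIV)"
  shows "(\<forall>h>0. (\<forall>t\<ge>0. L1_multiplier (\<lambda>k. exp (complex_of_real t * phi \<alpha> q a p1 p2 h k))) \<and>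
            strongly_continuous_semigroup_on X
              (\<lambda>t. mult_op (\<lambda>k. exp (complex_of_real t * phi \<alpha> q a p1 p2 h k)))) \<and>
         (\<exists>M>0. \<forall>h>0. \<forall>t\<ge>0.
            onorm_on X (mult_op (\<lambda>k. exp (complex_of_real t * phi \<alpha> q a p1 p2 h k))) \<le> M) \<and>
         (\<exists>M>0. \<forall>h>0. \<forall>t>0.
            L1_multiplier (\<lambda>k. phi \<alpha> q a p1 p2 h k * exp (complex_of_real t * phi \<alpha> q a p1 p2 h k)) \<and>
            bounded_operator_on X
              (mult_op (\<lambda>k. phi \<alpha> q a p1 p2 h k * exp (complex_of_real t * phi \<alpha> q a p1 p2 h k))) \<and>
            onorm_on X
              (mult_op (\<lambda>k. phi \<alpha> q a p1 p2 h k * exp (complex_of_real t * phi \<alpha> q a p1 p2 h k)))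
              \<le> M / t)"
  using assms
proof (elim disjE conjE)
  assume \<alpha>: "0 < \<alpha>" "\<alpha> < 1" and p: "q = 0" "a = 2" "p1 = 0" "p2 = 0" and X: "X = L1_Rplus"
  obtain C where C: "0 \<le> C" "uniform_translation_symbols {0..} C (symbol_lt1 \<alpha>)"
    using symbol_lt1_translation_symbols[OF \<alpha>] by blast
  have "X = support_space {0..}" by (simp add: X support_space_def)
  then show ?thesis
    unfolding p
    by (simp only:) (rule uniformly_analytic_semigroups_from_symbol[OF _ C phi_symbol_lt1]; simp)
next
  assume \<alpha>: "1 < \<alpha>" "\<alpha> < 2" and p: "q = 1" "a = 2 - 2 / \<alpha>" "p1 = 1" "p2 = 1 / 2" and X: "X = UNIV"
  obtain C where C: "0 \<le> C" "uniform_translation_symbols UNIV C (symbol_gt1 \<alpha>)"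
    using symbol_gt1_translation_symbols[OF \<alpha>] by blast
  have "\<not> UNIV \<subseteq> {0::real..}" by (metis UNIV_I atLeast_iff not_one_le_zero subsetD neg_0_le_iff_le)
  then have "X = support_space UNIV" by (simp add: X support_space_def)
  then show ?thesis
    unfolding p
    by (simp only:) (rule uniformly_analytic_semigroups_from_symbol[OF _ C phi_symbol_gt1]; simp)
qed

end
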